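(* Let $R$ be a commutative, $\sigma$-elementary ring with unity for which $\sigma(R)$ is finite, and let $J$ be the Jacobson radical of $R$. (1) If $J = \{0\}$, then $R \cong \prod_{i=1}^{\tau(q)} \mathbb{F}_q$ for some finite field $\mathbb{F}_q$. (2) If $J \neq \{0\}$, then for some finite field $\mathbb{F}_q$, $R$ is isomorphic to the following ring of $3 \times 3$ matrices: $$\left\{ \begin{pmatrix} a & b & c \\ 0 & a & 0 \\ 0 & 0 & a \end{pmatrix} : a, b, c \in \mathbb{F}_q \right\}.$$
   Context: All rings are associative and unital. A subring of a ring $R$ is a subset that is a group under addition and is closed under multiplication; it need not contain a multiplicative identity. A cover of $R$ is a collection of proper subrings of $R$ whose set-theoretic union equals $R$. If a cover exists, $R$ is coverable and $\sigma(R)$ denotes the cardinality of a minimal cover (a cover of least cardinality); if $R$ is not coverable, $\sigma(R) = \infty$. A ring $R$ is $\sigma$-elementary if $R$ is coverable and $\sigma(R) < \sigma(R/I)$ for every nonzero two-sided ideal $I$ of $R$. For a prime $p$ and $n \geq 1$, let $\psi(p,n)$ be the number of monic irreducible polynomials of degree $n$ in $\mathbb{F}_p[x]$. For a prime power $q = p^n$, define $\tau(q) = p$ if $n = 1$, and $\tau(q) = \psi(p,n) + 1$ if $n > 1$. $\mathbb{F}_q$ is the field with $q$ elements. *)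

theory Defs
  imports
    "HOL-Algebra.Algebra"
    "HOL-Number_Theory.Prime_Powers"
    "HOL-Number_Theory.Residues"
    "Jordan_Normal_Form.Matrix"
begin

unbundle cardinal_syntax

text \<open>
  Library rings are unital.  The subrings forming a cover need not contain an identity, so
  the predicate \<^const>\<open>subring\<close> of the library is not the right notion here.
\<close>

definition nonunital_subring :: "'a set \<Rightarrow> ('a, 'm) ring_scheme \<Rightarrow> bool" where
  "nonunital_subring S R \<longleftrightarrow>
     additive_subgroup S R \<and> (\<forall>x\<in>S. \<forall>y\<in>S. x \<otimes>\<^bsub>R\<^esub> y \<in> S)"

definition ring_cover :: "('a, 'm) ring_scheme \<Rightarrow> 'a set set \<Rightarrow> bool" where
  "ring_cover R C \<longleftrightarrow>
     (\<forall>S\<in>C. nonunital_subring S R \<and> S \<noteq> carrier R) \<and> \<Union>C = carrier R"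

definition coverable :: "('a, 'm) ring_scheme \<Rightarrow> bool" where
  "coverable R \<longleftrightarrow> (\<exists>C. ring_cover R C)"

definition minimal_cover :: "('a, 'm) ring_scheme \<Rightarrow> 'a set set \<Rightarrow> bool" where
  "minimal_cover R C \<longleftrightarrow> ring_cover R C \<and> (\<forall>D. ring_cover R D \<longrightarrow> |C| \<le>o |D| )"

lemma minimal_cover_exists:
  assumes "coverable R"
  shows "\<exists>C. minimal_cover R C"
proof -
  have "\<exists>r\<in>card_of ` Collect (ring_cover R). \<forall>r'\<in>card_of ` Collect (ring_cover R). r \<le>o r'"
    by (rule exists_minim_Card_order) (use assms in \<open>auto simp: coverable_def\<close>)
  then show ?thesis
    by (auto simp: minimal_cover_def)
qed

text \<open>
  The covering number is a cardinal, possibly an infinite one, and cardinals are rendered as in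
  the library by well-orders; \<^const>\<open>None\<close> is the value \<open>\<infinity>\<close> given to rings without a cover.
  The choice of the minimal cover affects the value only up to order isomorphism.
\<close>

definition covering_number :: "('a, 'm) ring_scheme \<Rightarrow> 'a set rel option" where
  "covering_number R =
     (if coverable R then Some |SOME C. minimal_cover R C| else None)"

text \<open>The strict order of cardinals, with \<open>\<infinity>\<close> above all of them.\<close>

fun cardinal_less :: "'a rel option \<Rightarrow> 'b rel option \<Rightarrow> bool" where
  "cardinal_less (Some r) (Some s) \<longleftrightarrow> r <o s"
| "cardinal_less (Some r) None \<longleftrightarrow> True"
| "cardinal_less None s \<longleftrightarrow> False"

definition finite_covering_number :: "('a, 'm) ring_scheme \<Rightarrow> bool" where
  "finite_covering_number R \<longleftrightarrow> (\<exists>r. covering_number R = Some r \<and> finite (Field r))"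

definition sigma_elementary :: "('a, 'm) ring_scheme \<Rightarrow> bool" where
  "sigma_elementary R \<longleftrightarrow>
     coverable R \<and>
     (\<forall>I. ideal I R \<and> I \<noteq> {\<zero>\<^bsub>R\<^esub>} \<longrightarrow>
        cardinal_less (covering_number R) (covering_number (R Quot I)))"

text \<open>
  Over a commutative ring the maximal one-sided ideals are the maximal ideals.  Intersecting
  with the carrier only matters for the zero ring, which has no maximal ideal.
\<close>

definition jacobson_radical :: "('a, 'm) ring_scheme \<Rightarrow> 'a set" where
  "jacobson_radical R = carrier R \<inter> \<Inter>{M. maximalideal M R}"

text \<open>A polynomial over \<open>\<int>/p\<close> is the list of its coefficients, the leading one first.\<close>

definition num_monic_irreducible :: "nat \<Rightarrow> nat \<Rightarrow> nat" where
  "num_monic_irreducible p n =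
     card {f \<in> carrier (poly_ring (residue_ring (int p))).
             Polynomials.degree f = n \<and>
             Polynomials.lead_coeff f = \<one>\<^bsub>residue_ring (int p)\<^esub> \<and>
             ring_irreducible\<^bsub>poly_ring (residue_ring (int p))\<^esub> f}"

text \<open>
  For a prime power \<open>q = p ^ n\<close>, \<open>aprimedivisor q\<close> is \<open>p\<close> and the multiplicity of \<open>p\<close> in \<open>q\<close>
  is \<open>n\<close>.
\<close>

definition tau :: "nat \<Rightarrow> nat" where
  "tau q =
     (let p = aprimedivisor q; n = multiplicity p q
      in if n = 1 then p else num_monic_irreducible p n + 1)"

text \<open>
  The arithmetic that the matrix library puts on \<^typ>\<open>'a mat\<close> is that of a type class; here
  the operations on the entries are those of the record \<open>F\<close>.
\<close>

definition matrix_ring :: "nat \<Rightarrow> ('a, 'm) ring_scheme \<Rightarrow> 'a mat ring" where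
  "matrix_ring n F =
     \<lparr>carrier = {A \<in> carrier_mat n n. \<forall>i<n. \<forall>j<n. A $$ (i, j) \<in> carrier F},
      monoid.mult = \<lambda>A B. mat n n (\<lambda>(i, j). \<Oplus>\<^bsub>F\<^esub>k\<in>{..<n}. A $$ (i, k) \<otimes>\<^bsub>F\<^esub> B $$ (k, j)),
      monoid.one = mat n n (\<lambda>(i, j). if i = j then \<one>\<^bsub>F\<^esub> else \<zero>\<^bsub>F\<^esub>),
      ring.zero = mat n n (\<lambda>(i, j). \<zero>\<^bsub>F\<^esub>),
      ring.add = \<lambda>A B. mat n n (\<lambda>(i, j). A $$ (i, j) \<oplus>\<^bsub>F\<^esub> B $$ (i, j))\<rparr>"

definition local_matrix_ring :: "('a, 'm) ring_scheme \<Rightarrow> 'a mat ring" where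
  "local_matrix_ring F =
     (matrix_ring 3 F)
       \<lparr>carrier := {mat_of_rows_list 3
                     [[a,        b,        c       ],
                      [\<zero>\<^bsub>F\<^esub>, a,        \<zero>\<^bsub>F\<^esub>],
                      [\<zero>\<^bsub>F\<^esub>, \<zero>\<^bsub>F\<^esub>, a       ]] | a b c.
                     a \<in> carrier F \<and> b \<in> carrier F \<and> c \<in> carrier F}\<rparr>"

end

theory Submission
  imports Defs
begin

text \<open>
  By Neumann's argument the intersection of a minimal cover has finite index; it contains no
  nonzero ideal, so \<open>R\<close> is finite, and the cover may be taken to consist of maximal subrings.  If
  \<open>A + B = R\<close> for ideals such that every member of the cover contains \<open>A\<close> or \<open>B\<close>, then one of
  them is zero; hence \<open>R\<close> has prime characteristic \<open>p\<close>.  A power \<open>x \<mapsto> x ^ q\<close> of the Frobenius map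
  is idempotent and splits \<open>R = S \<oplus> J\<close> with \<open>S\<close> a reduced subring and \<open>J\<close> the nilradical.  The
  main tool is that a maximal subring complementing a nonzero ideal belongs to the cover.

  If \<open>J \<noteq> 0\<close>, then \<open>J\<^sup>2 = 0\<close>, every maximal subring containing \<open>S\<close> is in the cover, and those not
  containing a given ideal may be discarded unless \<open>J\<close> becomes cyclic modulo that ideal.  So \<open>J\<close>
  is not cyclic but each of its proper quotients is, which makes \<open>S\<close> a field and \<open>J\<close> a plane over it.

  If \<open>J = 0\<close>, then \<open>R\<close> is a product of finite fields and every maximal subring is in the cover.
  Hence for each nonzero ideal \<open>I\<close> some \<open>x\<close> generates \<open>R\<close> modulo \<open>I\<close>, and the minimal polynomials
  of the components of such an \<open>x\<close> outside \<open>I\<close> are distinct and different from \<open>X\<close>.  Omitting one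
  factor of order \<open>p ^ d\<close>, they exhaust the monic irreducible polynomials of degree \<open>d\<close> other than
  \<open>X\<close>, which leaves no room for factors of another order.
\<close>

text \<open>A cover of \<open>R\<close> by subrings containing an ideal is a cover of the quotient.
  So an ideal is shown to vanish by covering \<open>R\<close> with at most \<open>card C\<close>
  subrings that contain it. Idempotents, inverses and supports are all obtained as powers, from
  \<open>x [^] q = x\<close>.

  The obstacle in the reduced case is that a maximal subring need not complement an ideal: it may
  meet a factor in a subfield, and intersecting the cover with it then need not give a cover of a
  quotient. Hence the separate argument with a generator of that subfield. Once every maximal
  subring is in the cover, being covered means that no single element generates \<open>R\<close>,
  while modulo every nonzero ideal one element does. Both halves are counts: a generator modulo one
  factor bounds the number of the other factors from above, and the absence of a generator of
  \<open>R\<close> bounds it from below. Since subrings need no identity, a generator modulo an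
  ideal has no zero component outside the ideal. This excludes \<open>X\<close> and explains the
  value \<open>p\<close> of \<open>tau\<close> at a prime: \<open>p - 1\<close> polynomials
  \<open>X - a\<close> with \<open>a\<close> nonzero, plus one for the omitted factor.\<close>

no_notation Sum_Type.Plus (infixr "<+>" 65)

section \<open>Subrings, ideals and covers\<close>

lemma nonunital_subringD:
  assumes "nonunital_subring S R"
  shows "S \<subseteq> carrier R" "\<zero>\<^bsub>R\<^esub> \<in> S"
    "\<And>x y. x \<in> S \<Longrightarrow> y \<in> S \<Longrightarrow> x \<oplus>\<^bsub>R\<^esub> y \<in> S"
    "\<And>x y. x \<in> S \<Longrightarrow> y \<in> S \<Longrightarrow> x \<otimes>\<^bsub>R\<^esub> y \<in> S"
proof -
  interpret additive_subgroup S R using assms by (simp add: nonunital_subring_def)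
  show "S \<subseteq> carrier R" "\<zero>\<^bsub>R\<^esub> \<in> S"
    "\<And>x y. x \<in> S \<Longrightarrow> y \<in> S \<Longrightarrow> x \<oplus>\<^bsub>R\<^esub> y \<in> S"
    by (simp_all add: a_subset)
  show "\<And>x y. x \<in> S \<Longrightarrow> y \<in> S \<Longrightarrow> x \<otimes>\<^bsub>R\<^esub> y \<in> S"
    using assms by (simp add: nonunital_subring_def)
qed

lemma (in ring) nonunital_subring_a_inv:
  assumes "nonunital_subring S R" "x \<in> S"
  shows "\<ominus> x \<in> S"
  using assms by (simp add: nonunital_subring_def additive_subgroup.a_inv_closed)

lemma (in ring) nonunital_subring_minus:
  assumes "nonunital_subring S R" "x \<in> S" "y \<in> S"
  shows "x \<ominus> y \<in> S"
  unfolding a_minus_def using nonunital_subringD(3)[OF assms(1) assms(2)] nonunital_subring_a_inv[OF assms(1,3)] by blast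

lemma (in ring) nonunital_subring_pow:
  assumes "nonunital_subring S R" "x \<in> S" "n > 0"
  shows "x [^] (n::nat) \<in> S"
  using assms(3)
proof (induction n rule: nat_induct_non_zero)
  case 1
  then show ?case using assms nonunital_subringD(1)[OF assms(1)] by auto
next
  case (Suc n)
  then show ?case using assms nonunital_subringD(4)[OF assms(1)] by auto
qed

lemma (in ring) additive_subgroupI':
  assumes "S \<subseteq> carrier R" "\<zero> \<in> S"
    "\<And>x y. x \<in> S \<Longrightarrow> y \<in> S \<Longrightarrow> x \<oplus> y \<in> S" "\<And>x. x \<in> S \<Longrightarrow> \<ominus> x \<in> S"
  shows "additive_subgroup S R"
proof (rule additive_subgroupI)
  show "subgroup S (add_monoid R)"
    by (rule add.subgroupI) (use assms in \<open>auto simp flip: a_inv_def\<close>)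
qed

lemma (in ring) nonunital_subringI:
  assumes "S \<subseteq> carrier R" "\<zero> \<in> S"
    "\<And>x y. x \<in> S \<Longrightarrow> y \<in> S \<Longrightarrow> x \<oplus> y \<in> S" "\<And>x. x \<in> S \<Longrightarrow> \<ominus> x \<in> S"
    "\<And>x y. x \<in> S \<Longrightarrow> y \<in> S \<Longrightarrow> x \<otimes> y \<in> S"
  shows "nonunital_subring S R"
  unfolding nonunital_subring_def
  using additive_subgroupI'[OF assms(1-4)] assms(5) by blast

text \<open>Negatives are multiples by \<open>\<ominus> \<one>\<close>, so closure under
  multiplication takes care of them.\<close>

lemma (in cring) idealI':
  assumes "S \<subseteq> carrier R" "\<zero> \<in> S"
    "\<And>x y. x \<in> S \<Longrightarrow> y \<in> S \<Longrightarrow> x \<oplus> y \<in> S"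
    "\<And>x r. x \<in> S \<Longrightarrow> r \<in> carrier R \<Longrightarrow> r \<otimes> x \<in> S"
  shows "ideal S R"
proof (rule ideal.intro)
  have "\<ominus> x \<in> S" if "x \<in> S" for x
    using assms(4)[OF that, of "\<ominus> \<one>"] that assms(1) by (auto simp: l_minus)
  then show "additive_subgroup S R"
    using assms by (intro additive_subgroupI') auto
  show "ideal_axioms S R"
    using assms by (intro ideal_axioms.intro) (auto simp: m_comm subset_eq)
qed (rule ring_axioms)

lemma ideal_nonunital_subring:
  assumes "ideal I R"
  shows "nonunital_subring I R"
  unfolding nonunital_subring_def
  using ideal.axioms(1)[OF assms] ideal.I_l_closed[OF assms] ideal.Icarr[OF assms] by auto

lemma set_add_iff: "x \<in> A <+>\<^bsub>R\<^esub> B \<longleftrightarrow> (\<exists>a\<in>A. \<exists>b\<in>B. x = a \<oplus>\<^bsub>R\<^esub> b)"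
  by (auto simp: set_add_defs)

lemma set_addI: "a \<in> A \<Longrightarrow> b \<in> B \<Longrightarrow> a \<oplus>\<^bsub>R\<^esub> b \<in> A <+>\<^bsub>R\<^esub> B"
  by (auto simp: set_add_iff)

lemma (in cring) nonunital_subring_Int:
  assumes "nonunital_subring S R" "nonunital_subring T R"
  shows "nonunital_subring (S \<inter> T) R"
  using nonunital_subringD[OF assms(1)] nonunital_subringD[OF assms(2)]
    nonunital_subring_a_inv[OF assms(1)] nonunital_subring_a_inv[OF assms(2)]
  by (intro nonunital_subringI) auto

lemma (in cring) nonunital_subring_add_ideal:
  assumes "nonunital_subring S R" "ideal I R"
  shows "nonunital_subring (S <+> I) R"
proof -
  note S = nonunital_subringD[OF assms(1)] and I = nonunital_subringD[OF ideal_nonunital_subring[OF assms(2)]]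
  have sc: "s \<in> carrier R" if "s \<in> S" for s using that S by blast
  have ic: "s \<in> carrier R" if "s \<in> I" for s using that I by blast
  show ?thesis
  proof (rule nonunital_subringI)
    show "S <+> I \<subseteq> carrier R" using sc ic by (auto simp: set_add_iff)
    show "\<zero> \<in> S <+> I" using S I by (auto simp: set_add_iff intro!: bexI[of _ \<zero>])
  next
    fix x y assume "x \<in> S <+> I" "y \<in> S <+> I"
    then obtain s i t j where st: "s \<in> S" "i \<in> I" "t \<in> S" "j \<in> I" "x = s \<oplus> i" "y = t \<oplus> j"
      by (auto simp: set_add_iff)
    have c: "s \<in> carrier R" "i \<in> carrier R" "t \<in> carrier R" "j \<in> carrier R" using st sc ic by auto
    have "x \<oplus> y = (s \<oplus> t) \<oplus> (i \<oplus> j)" using c st by (simp add: a_ac)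
    then show "x \<oplus> y \<in> S <+> I" using set_addI[OF S(3) I(3)] st by simp
    have "x \<otimes> y = (s \<otimes> t) \<oplus> (i \<otimes> (t \<oplus> j) \<oplus> s \<otimes> j)" using c st by algebra
    moreover have "i \<otimes> (t \<oplus> j) \<oplus> s \<otimes> j \<in> I"
      using st c by (intro I(3) ideal.I_l_closed[OF assms(2)] ideal.I_r_closed[OF assms(2)]) auto
    ultimately show "x \<otimes> y \<in> S <+> I" using set_addI[OF S(4)] st by metis
  next
    fix x assume "x \<in> S <+> I"
    then obtain s i where st: "s \<in> S" "i \<in> I" "x = s \<oplus> i"
      by (auto simp: set_add_iff)
    then have "\<ominus> x = \<ominus> s \<oplus> \<ominus> i" using sc ic by (simp add: minus_add)
    then show "\<ominus> x \<in> S <+> I"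
      using set_addI[OF nonunital_subring_a_inv[OF assms(1)] nonunital_subring_a_inv[OF ideal_nonunital_subring[OF assms(2)]]] st
      by simp
  qed
qed

lemma (in cring) subset_set_add:
  assumes "S \<subseteq> carrier R" "\<zero> \<in> S" "I \<subseteq> carrier R" "\<zero> \<in> I"
  shows "S \<subseteq> S <+> I" "I \<subseteq> S <+> I"
proof -
  have "x = x \<oplus> \<zero>" if "x \<in> S" for x using assms that by auto
  then show "S \<subseteq> S <+> I" using assms by (force simp: set_add_iff)
  have "x = \<zero> \<oplus> x" if "x \<in> I" for x using assms that by auto
  then show "I \<subseteq> S <+> I" using assms by (force simp: set_add_iff)
qed

text \<open>A subring containing \<open>I\<close> is a union of cosets of \<open>I\<close>, hence
  the full preimage of its image; so a proper one has a proper image.\<close>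

lemma (in cring) ring_cover_Quot:
  assumes I: "ideal I R" and D: "ring_cover R D" "\<forall>S\<in>D. I \<subseteq> S"
  shows "ring_cover (R Quot I) ((\<lambda>S. (\<lambda>x. I +> x) ` S) ` D)"
proof -
  interpret ideal I R by fact
  interpret h: ring_hom_ring R "R Quot I" "(+>) I" by (rule rcos_ring_hom_ring)
  have surj: "(\<lambda>x. I +> x) ` carrier R = carrier (R Quot I)"
    unfolding FactRing_def A_RCOSETS_def' by auto
  have sub: "nonunital_subring ((\<lambda>x. I +> x) ` S) (R Quot I)" if "nonunital_subring S R" for S
  proof -
    note S = nonunital_subringD[OF that] nonunital_subring_a_inv[OF that]
    have sc: "s \<in> carrier R" if "s \<in> S" for s using that S by blast
    show ?thesis
    proof (rule h.S.nonunital_subringI)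
      show "(+>) I ` S \<subseteq> carrier (R Quot I)" using sc h.hom_closed by blast
      show "\<zero>\<^bsub>R Quot I\<^esub> \<in> (+>) I ` S"
        using imageI[OF S(2), of "(+>) I"] by (simp only: h.hom_zero)
      fix x y assume "x \<in> (+>) I ` S" "y \<in> (+>) I ` S"
      then obtain s t where st: "x = I +> s" "y = I +> t" "s \<in> S" "t \<in> S" by blast
      show "x \<oplus>\<^bsub>R Quot I\<^esub> y \<in> (+>) I ` S"
        using imageI[OF S(3)[OF st(3,4)], of "(+>) I"] st
        by (simp only: h.hom_add[OF sc sc])
      show "x \<otimes>\<^bsub>R Quot I\<^esub> y \<in> (+>) I ` S"
        using imageI[OF S(4)[OF st(3,4)], of "(+>) I"] st
        by (simp only: h.hom_mult[OF sc sc])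
    next
      fix x assume "x \<in> (+>) I ` S"
      then obtain s where st: "x = I +> s" "s \<in> S" by blast
      show "\<ominus>\<^bsub>R Quot I\<^esub> x \<in> (+>) I ` S"
        using imageI[OF S(5)[OF st(2)], of "(+>) I"] st
        by (simp only: h.hom_a_inv[OF sc])
    qed
  qed
  have proper: "(\<lambda>x. I +> x) ` S \<noteq> carrier (R Quot I)"
    if S: "nonunital_subring S R" "S \<noteq> carrier R" "I \<subseteq> S" for S
  proof
    assume eq: "(\<lambda>x. I +> x) ` S = carrier (R Quot I)"
    have "x \<in> S" if x: "x \<in> carrier R" for x
    proof -
      obtain s where s: "s \<in> S" "I +> x = I +> s" using eq surj x by blast
      then have sc: "s \<in> carrier R" using nonunital_subringD[OF S(1)] by auto
      have "x \<ominus> s \<in> S"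
        using quotient_eq_iff_same_a_r_cos[OF I x sc] s S(3) by auto
      moreover have "x = (x \<ominus> s) \<oplus> s" using x sc by algebra
      ultimately show ?thesis using nonunital_subringD(3)[OF S(1)] s by metis
    qed
    then show False using S nonunital_subringD(1)[OF S(1)] by auto
  qed
  have un: "(\<Union>S\<in>D. (\<lambda>x. I +> x) ` S) = carrier (R Quot I)"
    using D(1) surj unfolding ring_cover_def image_Union[symmetric] by (simp only:)
  have "nonunital_subring T (R Quot I) \<and> T \<noteq> carrier (R Quot I)"
    if T: "T \<in> (\<lambda>S. (\<lambda>x. I +> x) ` S) ` D" for T
  proof -
    obtain S where S: "S \<in> D" "T = (\<lambda>x. I +> x) ` S" using T by blast
    then have S': "nonunital_subring S R" "S \<noteq> carrier R" "I \<subseteq> S"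
      using D unfolding ring_cover_def by blast+
    show ?thesis unfolding S(2) using sub[OF S'(1)] proper[OF S'] by (rule conjI)
  qed
  then have "\<forall>T\<in>(\<lambda>S. (\<lambda>x. I +> x) ` S) ` D. nonunital_subring T (R Quot I) \<and> T \<noteq> carrier (R Quot I)"
    by (rule ballI)
  then show ?thesis unfolding ring_cover_def using un by (rule conjI)
qed

text \<open>Replaces cardinals by numbers. The last clause is the form in which sigma-elementarity
  is used from here on: the images of \<open>D\<close> would cover \<open>R Quot I\<close> with no
  more members than \<open>C\<close>, although the covering number must grow strictly.\<close>

lemma (in cring) finite_minimal_cover:
  assumes sig: "sigma_elementary R" and fin: "finite_covering_number R"
  obtains C where "ring_cover R C" "finite C"
    "\<And>D. ring_cover R D \<Longrightarrow> finite D \<Longrightarrow> card C \<le> card D"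
    "\<And>I D. ideal I R \<Longrightarrow> ring_cover R D \<Longrightarrow> finite D \<Longrightarrow> (\<forall>S\<in>D. I \<subseteq> S) \<Longrightarrow> card D \<le> card C \<Longrightarrow> I = {\<zero>}"
proof -
  define C where "C = (SOME C. minimal_cover R C)"
  have cov: "coverable R" using sig by (simp add: sigma_elementary_def)
  then have min: "minimal_cover R C"
    unfolding C_def by (rule someI_ex[OF minimal_cover_exists])
  have num: "covering_number R = Some |C|"
    using cov by (simp add: covering_number_def C_def)
  have finC: "finite C"
    using fin num by (auto simp: finite_covering_number_def Field_card_of)
  show thesis
  proof (rule that)
    show "ring_cover R C" "finite C" using min finC by (auto simp: minimal_cover_def)
    show "card C \<le> card D" if "ring_cover R D" "finite D" for D
    proof -
      have "|C| \<le>o |D|" using min that by (simp add: minimal_cover_def)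
      then show ?thesis using finite_card_of_iff_card2[OF finC that(2)] by simp
    qed
    fix I D assume I: "ideal I R" and D: "ring_cover R D" "finite D" "\<forall>S\<in>D. I \<subseteq> S" "card D \<le> card C"
    show "I = {\<zero>}"
    proof (rule ccontr)
      assume "I \<noteq> {\<zero>}"
      then have less: "cardinal_less (covering_number R) (covering_number (R Quot I))"
        using sig I by (auto simp: sigma_elementary_def)
      define E where "E = (\<lambda>S. (\<lambda>x. I +> x) ` S) ` D"
      have E: "ring_cover (R Quot I) E"
        using ring_cover_Quot[OF I D(1,3)] by (simp add: E_def)
      \<comment> \<open>This excludes the value \<open>None\<close> for the quotient, for which
        \<open>less\<close> would hold trivially.\<close>
      then have cov': "coverable (R Quot I)" by (auto simp: coverable_def)
      define C' where "C' = (SOME C. minimal_cover (R Quot I) C)"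
      have "minimal_cover (R Quot I) C'"
        unfolding C'_def by (rule someI_ex[OF minimal_cover_exists[OF cov']])
      then have "|C'| \<le>o |E|" using E by (auto simp: minimal_cover_def)
      moreover have "|E| \<le>o |C|"
      proof -
        have "card E \<le> card C" using D card_image_le[OF D(2)] unfolding E_def by (meson le_trans)
        moreover have "finite E" using D by (simp add: E_def)
        ultimately show ?thesis using finC by (simp add: finite_card_of_iff_card2)
      qed
      moreover have "|C| <o |C'|"
        using less num cov' by (simp add: covering_number_def C'_def)
      ultimately show False
        by (meson not_ordLess_ordLeq ordLeq_transitive)
    qed
  qed
qed

section \<open>Finiteness of the ring\<close>

lemma (in ring) additive_subgroup_minus:
  assumes "additive_subgroup S R" "x \<in> S" "y \<in> S"
  shows "x \<ominus> y \<in> S"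
  unfolding a_minus_def
  by (rule additive_subgroup.a_closed[OF assms(1,2) additive_subgroup.a_inv_closed[OF assms(1,3)]])

text \<open>
  B. H. Neumann's argument: for \<open>j \<notin> T\<close> and \<open>x\<close> covered by \<open>j\<close> alone, the coset of \<open>x\<close> modulo
  \<open>\<Inter>T\<close> avoids all members of \<open>T\<close>, hence is covered by the remaining ones.
\<close>

lemma (in ring) irredundant_cover_finite_index:
  assumes fin: "finite C" and sub: "\<And>S. S \<in> C \<Longrightarrow> additive_subgroup S R"
    and cov: "\<Union>C = carrier R" and irr: "\<And>j. j \<in> C \<Longrightarrow> \<Union>(C - {j}) \<noteq> carrier R"
  shows "\<exists>F. finite F \<and> F \<subseteq> carrier R \<and> carrier R \<subseteq> F <+> (carrier R \<inter> \<Inter>C)"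
proof -
  \<comment> \<open>Downward induction on \<open>T\<close>: for \<open>T = C\<close> the single
    representative \<open>\<zero>\<close> suffices, and \<open>T = {}\<close> is the claim.\<close>
  have "\<exists>F. finite F \<and> F \<subseteq> carrier R \<and> carrier R \<inter> \<Inter>T \<subseteq> F <+> (carrier R \<inter> \<Inter>C)"
    if "T \<subseteq> C" for T
    using that
  proof (induction "card (C - T)" arbitrary: T rule: less_induct)
    case less
    show ?case
    proof (cases "C - T = {}")
      case True
      then have "T = C" using less.prems by blast
      moreover have "x \<in> {\<zero>} <+> (carrier R \<inter> \<Inter>C)" if "x \<in> carrier R \<inter> \<Inter>C" for x
      proof -
        have "x = \<zero> \<oplus> x" using that by simp
        then show ?thesis using that set_addI[of \<zero> "{\<zero>}" x] by (metis singletonI)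
      qed
      ultimately show ?thesis by (intro exI[of _ "{\<zero>}"]) blast
    next
      case False
      then obtain j where j: "j \<in> C" "j \<notin> T" by blast
      have "\<Union>(C - {j}) \<subseteq> carrier R" using cov by blast
      then obtain x where x: "x \<in> carrier R" "x \<notin> \<Union>(C - {j})" using irr[OF j(1)] by blast
      define E where "E i z \<longleftrightarrow> z \<in> carrier R \<inter> \<Inter>T \<and> x \<oplus> z \<in> i" for i z
      \<comment> \<open>\<open>K\<close> collects the members outside \<open>T\<close> that meet the
        coset of \<open>x\<close>. Two points of the coset in the same \<open>i\<close> differ by an
        element of \<open>\<Inter>(insert i T)\<close>, so one point \<open>x \<oplus> z i\<close>
        for each \<open>i\<close>, together with the induction hypothesis, gives the representatives
        \<open>F\<close>.\<close>
      define K where "K = {i \<in> C - T. \<exists>z. E i z}"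
      have "\<forall>i\<in>C-T. \<exists>F. finite F \<and> F \<subseteq> carrier R \<and> carrier R \<inter> \<Inter>(insert i T) \<subseteq> F <+> (carrier R \<inter> \<Inter>C)"
      proof
        fix i assume i: "i \<in> C - T"
        have "card (C - insert i T) < card (C - T)"
          using i fin by (intro psubset_card_mono) auto
        then show "\<exists>F. finite F \<and> F \<subseteq> carrier R \<and> carrier R \<inter> \<Inter>(insert i T) \<subseteq> F <+> (carrier R \<inter> \<Inter>C)"
          using less.hyps less.prems i by (metis DiffD1 insert_subset)
      qed
      then obtain G where G: "\<And>i. i \<in> C - T \<Longrightarrow> finite (G i) \<and> G i \<subseteq> carrier R \<and> carrier R \<inter> \<Inter>(insert i T) \<subseteq> G i <+> (carrier R \<inter> \<Inter>C)"
        by metis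
      obtain z where z: "\<And>i. i \<in> K \<Longrightarrow> E i (z i)"
      proof -
        have "\<forall>i\<in>K. \<exists>z. E i z" by (simp add: K_def)
        then show ?thesis using that by metis
      qed
      define F where "F = (\<Union>i\<in>K. (\<lambda>f. z i \<oplus> f) ` G i)"
      have KC: "K \<subseteq> C - T" by (auto simp: K_def)
      have zc: "z i \<in> carrier R" if "i \<in> K" for i using z[OF that] by (simp add: E_def)
      have "finite K" using fin KC by (meson finite_Diff finite_subset)
      then have "finite F" unfolding F_def using G KC by blast
      moreover have "F \<subseteq> carrier R"
      proof
        fix y assume "y \<in> F"
        then obtain i f where i: "i \<in> K" "f \<in> G i" "y = z i \<oplus> f" by (auto simp: F_def)
        then have "f \<in> carrier R" using G KC by blast
        then show "y \<in> carrier R" using i zc by simp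
      qed
      moreover have "y \<in> F <+> (carrier R \<inter> \<Inter>C)" if y: "y \<in> carrier R \<inter> \<Inter>T" for y
      proof -
        have yc: "y \<in> carrier R" using y by blast
        have "x \<oplus> y \<in> \<Union>C" using x(1) yc cov by simp
        then obtain i where i: "i \<in> C" "x \<oplus> y \<in> i" by blast
        \<comment> \<open>Otherwise \<open>y\<close>, and with it \<open>x\<close>, would lie in
          \<open>i\<close>, which differs from \<open>j\<close> since
          \<open>j \<notin> T\<close>.\<close>
        have "i \<notin> T"
        proof
          assume iT: "i \<in> T"
          then have "y \<in> i" using y by blast
          then have "(x \<oplus> y) \<ominus> y \<in> i" using i additive_subgroup_minus[OF sub[OF i(1)]] by blast
          moreover have "(x \<oplus> y) \<ominus> y = x" using x(1) yc by algebra
          ultimately show False using x(2) iT j i(1) by auto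
        qed
        then have iK: "i \<in> K" using i y by (auto simp: K_def E_def)
        have zi: "z i \<in> carrier R \<inter> \<Inter>T" "x \<oplus> z i \<in> i" using z[OF iK] by (auto simp: E_def)
        have "(x \<oplus> y) \<ominus> (x \<oplus> z i) \<in> i" by (rule additive_subgroup_minus[OF sub[OF i(1)] i(2) zi(2)])
        moreover have "(x \<oplus> y) \<ominus> (x \<oplus> z i) = y \<ominus> z i" using x(1) yc zc[OF iK] by algebra
        moreover have "y \<ominus> z i \<in> t" if "t \<in> T" for t
          using y zi(1) that less.prems by (intro additive_subgroup_minus[OF sub]) auto
        ultimately have "y \<ominus> z i \<in> carrier R \<inter> \<Inter>(insert i T)" using yc zc[OF iK] by auto
        then have "y \<ominus> z i \<in> G i <+> (carrier R \<inter> \<Inter>C)" using G KC iK by blast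
        then obtain f d where f: "f \<in> G i" "d \<in> carrier R \<inter> \<Inter>C" "y \<ominus> z i = f \<oplus> d"
          by (auto simp: set_add_iff)
        have fc: "f \<in> carrier R" "d \<in> carrier R" using f G KC iK by blast+
        have "y = z i \<oplus> (y \<ominus> z i)" using yc zc[OF iK] by algebra
        also have "\<dots> = (z i \<oplus> f) \<oplus> d" using f(3) fc zc[OF iK] by (simp add: a_assoc)
        finally have "y = (z i \<oplus> f) \<oplus> d" .
        moreover have "z i \<oplus> f \<in> F" using iK f by (auto simp: F_def)
        ultimately show ?thesis using f(2) set_addI by metis
      qed
      ultimately show ?thesis by blast
    qed
  qed
  from this[of "{}"] show ?thesis by simp
qed

text \<open>The \<open>x\<close> with \<open>R x\<close> inside \<open>D\<close> form the largest
  ideal inside \<open>D\<close>, which is zero by \<open>elem\<close>. Writing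
  \<open>r = g + d\<close> with \<open>g\<close> in \<open>F\<close> shows that an element of
  \<open>D\<close> is determined by the cosets modulo \<open>D\<close> of its products with the
  finitely many \<open>g\<close>; so \<open>D\<close> embeds into a finite set of functions.\<close>

lemma (in cring) finite_index_subring_imp_finite:
  assumes D: "nonunital_subring D R" and F: "finite F" "F \<subseteq> carrier R" "carrier R \<subseteq> F <+> D"
    and elem: "\<And>I. ideal I R \<Longrightarrow> I \<subseteq> D \<Longrightarrow> I = {\<zero>}"
  shows "finite (carrier R)"
proof -
  note Ds = nonunital_subringD[OF D] nonunital_subring_minus[OF D]
  have dc: "d \<in> carrier R" if "d \<in> D" for d using that Ds(1) by blast
  have fc: "d \<in> carrier R" if "d \<in> F" for d using that F(2) by blast
  define I where "I = {x \<in> carrier R. \<forall>r\<in>carrier R. r \<otimes> x \<in> D}"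
  have "ideal I R"
  proof (rule idealI')
    show "I \<subseteq> carrier R" "\<zero> \<in> I" using Ds(2) by (auto simp: I_def)
    show "x \<oplus> y \<in> I" if "x \<in> I" "y \<in> I" for x y
      using that Ds(3) by (simp add: I_def r_distr)
    show "r \<otimes> x \<in> I" if "x \<in> I" "r \<in> carrier R" for x r
      using that by (simp add: I_def m_assoc[symmetric])
  qed
  moreover have "I \<subseteq> D"
  proof
    fix x assume "x \<in> I"
    then have "\<one> \<otimes> x \<in> D" "x \<in> carrier R" unfolding I_def by blast+
    then show "x \<in> D" by simp
  qed
  ultimately have I0: "I = {\<zero>}" by (rule elem)
  have "\<exists>g\<in>F. x \<ominus> g \<in> D" if "x \<in> carrier R" for x
  proof -
    have "x \<in> F <+> D" using F(3) that by blast
    then obtain g d where g: "g \<in> F" "d \<in> D" "x = g \<oplus> d" by (auto simp: set_add_iff)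
    then have "x \<ominus> g = d" using fc[OF g(1)] dc[OF g(2)] by algebra
    then show ?thesis using g by metis
  qed
  then obtain c where c: "\<And>x. x \<in> carrier R \<Longrightarrow> c x \<in> F \<and> x \<ominus> c x \<in> D" by metis
  define \<Phi> where "\<Phi> x = restrict (\<lambda>f. c (x \<otimes> f)) F" for x
  have "inj_on \<Phi> D"
  proof
    fix x y assume xy: "x \<in> D" "y \<in> D" "\<Phi> x = \<Phi> y"
    have xyc: "x \<in> carrier R" "y \<in> carrier R" using xy dc by auto
    have "x \<ominus> y \<in> I"
      unfolding I_def
    proof (intro CollectI conjI ballI)
      show "x \<ominus> y \<in> carrier R" using xyc by simp
      fix r assume r: "r \<in> carrier R"
      then have "r \<in> F <+> D" using F(3) by blast
      then obtain g d where g: "g \<in> F" "d \<in> D" "r = g \<oplus> d" by (auto simp: set_add_iff)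
      have gc: "g \<in> carrier R" "d \<in> carrier R" using g fc dc by auto
      have eq: "c (x \<otimes> g) = c (y \<otimes> g)" using fun_cong[OF xy(3), of g] g by (simp add: \<Phi>_def)
      define e where "e = c (x \<otimes> g)"
      have e: "x \<otimes> g \<ominus> e \<in> D" "y \<otimes> g \<ominus> e \<in> D" "e \<in> F"
        using c[of "x \<otimes> g"] c[of "y \<otimes> g"] xyc gc eq by (auto simp: e_def)
      have "(x \<otimes> g \<ominus> e) \<ominus> (y \<otimes> g \<ominus> e) \<in> D" using Ds(5) e by blast
      moreover have "d \<otimes> (x \<ominus> y) \<in> D" using Ds(4,5) g xy by blast
      ultimately have "((x \<otimes> g \<ominus> e) \<ominus> (y \<otimes> g \<ominus> e)) \<oplus> d \<otimes> (x \<ominus> y) \<in> D" by (rule Ds(3))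
      moreover have "((x \<otimes> g \<ominus> e) \<ominus> (y \<otimes> g \<ominus> e)) \<oplus> d \<otimes> (x \<ominus> y) = r \<otimes> (x \<ominus> y)"
        unfolding g(3) using xyc gc fc[OF e(3)] by algebra
      ultimately show "r \<otimes> (x \<ominus> y) \<in> D" by simp
    qed
    then have "x \<ominus> y = \<zero>" using I0 by simp
    then show "x = y" using xyc by simp
  qed
  moreover have "\<Phi> ` D \<subseteq> (\<Pi>\<^sub>E f\<in>F. F)"
  proof
    fix h assume "h \<in> \<Phi> ` D"
    then obtain x where x: "x \<in> D" "h = \<Phi> x" by blast
    have "c (x \<otimes> f) \<in> F" if "f \<in> F" for f using c dc[OF x(1)] fc[OF that] by simp
    then show "h \<in> (\<Pi>\<^sub>E f\<in>F. F)" unfolding x(2) \<Phi>_def by (simp add: PiE_iff)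
  qed
  then have "finite (\<Phi> ` D)" using F(1) by (meson finite_PiE finite_subset)
  ultimately have "finite D" by (simp add: finite_image_iff)
  moreover have "carrier R \<subseteq> (\<lambda>(f, d). f \<oplus> d) ` (F \<times> D)"
    using F(3) by (auto simp: set_add_iff subset_eq image_iff)
  ultimately show ?thesis using F(1) by (meson finite_SigmaI finite_imageI finite_subset)
qed

section \<open>Finite elementary rings\<close>

definition maximal_subring :: "('a, 'm) ring_scheme \<Rightarrow> 'a set \<Rightarrow> bool" where
  "maximal_subring R M \<longleftrightarrow> nonunital_subring M R \<and> M \<noteq> carrier R \<and>
     (\<forall>T. nonunital_subring T R \<and> M \<subseteq> T \<longrightarrow> T = M \<or> T = carrier R)"

lemma maximal_subringD:
  assumes "maximal_subring R M"
  shows "nonunital_subring M R" "M \<noteq> carrier R"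
    "\<And>T. nonunital_subring T R \<Longrightarrow> M \<subseteq> T \<Longrightarrow> T = M \<or> T = carrier R"
  using assms unfolding maximal_subring_def by simp_all

lemma maximal_subring_exists:
  assumes fin: "finite (carrier R)" and S: "nonunital_subring S R" "S \<noteq> carrier R"
  shows "\<exists>M. maximal_subring R M \<and> S \<subseteq> M"
proof -
  define P where "P = {T. nonunital_subring T R \<and> T \<noteq> carrier R \<and> S \<subseteq> T}"
  have "P \<subseteq> Pow (carrier R)" using nonunital_subringD(1) unfolding P_def by fast
  then have "finite P" using fin by (meson finite_Pow_iff finite_subset)
  moreover have "S \<in> P" using S by (simp add: P_def)
  ultimately obtain M where M: "M \<in> P" "S \<subseteq> M" "\<And>T. T \<in> P \<Longrightarrow> M \<subseteq> T \<Longrightarrow> T = M"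
    using finite_has_maximal2 by metis
  have "maximal_subring R M"
    unfolding maximal_subring_def
  proof (intro conjI allI impI)
    show "nonunital_subring M R" "M \<noteq> carrier R" using M(1) by (simp_all add: P_def)
    fix T assume T: "nonunital_subring T R \<and> M \<subseteq> T"
    then show "T = M \<or> T = carrier R" using M(2) M(3)[of T] by (auto simp: P_def)
  qed
  then show ?thesis using M(2) by blast
qed

text \<open>
  Covers of a quotient by \<open>I\<close> are rendered as covers of \<open>R\<close> by subrings containing \<open>I\<close>, so
  \<open>elementary\<close> says that proper quotients have a covering number above \<open>card C\<close>.
\<close>

locale finite_elementary_ring = cring R for R (structure) +
  fixes C :: "'a set set"
  assumes finite_carrier: "finite (carrier R)"
    and C_maximal: "\<And>M. M \<in> C \<Longrightarrow> maximal_subring R M"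
    and C_cover: "\<Union>C = carrier R"
    and elementary: "\<And>I D. ideal I R \<Longrightarrow> ring_cover R D \<Longrightarrow> (\<And>S. S \<in> D \<Longrightarrow> I \<subseteq> S) \<Longrightarrow>
      card D \<le> card C \<Longrightarrow> I = {\<zero>}"

text \<open>A minimal cover is irredundant, so its intersection has finite index, and an ideal
  inside the intersection lies in every member, hence is zero; this makes \<open>R\<close> finite.
  By finiteness every member then lies in a maximal subring.\<close>

lemma (in cring) sigma_elementary_imp_finite_elementary_ring:
  assumes sig: "sigma_elementary R" and fin: "finite_covering_number R"
  shows "\<exists>C. finite_elementary_ring R C"
proof -
  obtain C where C: "ring_cover R C" "finite C"
    "\<And>D. ring_cover R D \<Longrightarrow> finite D \<Longrightarrow> card C \<le> card D"
    "\<And>I D. ideal I R \<Longrightarrow> ring_cover R D \<Longrightarrow> finite D \<Longrightarrow> (\<forall>S\<in>D. I \<subseteq> S) \<Longrightarrow> card D \<le> card C \<Longrightarrow> I = {\<zero>}"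
    using finite_minimal_cover[OF sig fin] by metis
  have Csub: "\<And>S. S \<in> C \<Longrightarrow> nonunital_subring S R \<and> S \<noteq> carrier R" and Cun: "\<Union>C = carrier R"
    using C(1) by (auto simp: ring_cover_def)
  have irr: "\<Union>(C - {j}) \<noteq> carrier R" if "j \<in> C" for j
  proof
    assume "\<Union>(C - {j}) = carrier R"
    then have "ring_cover R (C - {j})" using Csub by (simp add: ring_cover_def)
    then have "card C \<le> card (C - {j})" using C(2,3) by blast
    then show False using that C(2) by (meson card_Diff1_less not_le)
  qed
  have "\<exists>F. finite F \<and> F \<subseteq> carrier R \<and> carrier R \<subseteq> F <+> (carrier R \<inter> \<Inter>C)"
    using irredundant_cover_finite_index[OF C(2) _ Cun irr] Csub by (simp add: nonunital_subring_def)
  then obtain F where F: "finite F" "F \<subseteq> carrier R" "carrier R \<subseteq> F <+> (carrier R \<inter> \<Inter>C)" by blast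
  have fc: "finite (carrier R)"
  proof (rule finite_index_subring_imp_finite[OF _ F])
    have S: "S \<in> C \<Longrightarrow> \<zero> \<in> S" "S \<in> C \<Longrightarrow> x \<in> S \<Longrightarrow> \<ominus> x \<in> S"
      "S \<in> C \<Longrightarrow> x \<in> S \<Longrightarrow> y \<in> S \<Longrightarrow> x \<oplus> y \<in> S"
      "S \<in> C \<Longrightarrow> x \<in> S \<Longrightarrow> y \<in> S \<Longrightarrow> x \<otimes> y \<in> S" for S x y
      using Csub nonunital_subringD(2,3,4)[of S R] nonunital_subring_a_inv[of S] by blast+
    show "nonunital_subring (carrier R \<inter> \<Inter>C) R"
      by (rule nonunital_subringI) (simp_all add: S)
    fix I assume I: "ideal I R" "I \<subseteq> carrier R \<inter> \<Inter>C"
    show "I = {\<zero>}"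
      by (rule C(4)[OF I(1) C(1,2)]) (use I(2) in blast)+
  qed
  have "\<forall>S\<in>C. \<exists>M. maximal_subring R M \<and> S \<subseteq> M"
    using maximal_subring_exists[OF fc] Csub by blast
  then obtain m where m: "\<And>S. S \<in> C \<Longrightarrow> maximal_subring R (m S) \<and> S \<subseteq> m S" by metis
  \<comment> \<open>Enlarging the members does not increase their number, so a bound by the new
    cover is also a bound by \<open>C\<close>.\<close>
  have "finite_elementary_ring R (m ` C)"
  proof
    show "finite (carrier R)" by fact
    show "maximal_subring R M" if "M \<in> m ` C" for M
      using that m by (elim imageE) simp
    show "\<Union>(m ` C) = carrier R"
    proof
      show "\<Union>(m ` C) \<subseteq> carrier R"
      proof (rule UN_least)
        fix S assume "S \<in> C"
        then have "maximal_subring R (m S)" using m by blast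
        then show "m S \<subseteq> carrier R" by (rule nonunital_subringD(1)[OF maximal_subringD(1)])
      qed
      show "carrier R \<subseteq> \<Union>(m ` C)"
      proof
        fix x assume "x \<in> carrier R"
        then obtain S where "S \<in> C" "x \<in> S" using Cun by blast
        then show "x \<in> \<Union>(m ` C)" using m[of S] by blast
      qed
    qed
    fix I D assume ID: "ideal I R" "ring_cover R D" "\<And>S. S \<in> D \<Longrightarrow> I \<subseteq> S" "card D \<le> card (m ` C)"
    have "D \<subseteq> Pow (carrier R)" using ID(2) by (auto simp: ring_cover_def)
    then have "finite D" using fc by (meson finite_Pow_iff finite_subset)
    moreover have "card D \<le> card C" using ID(4) card_image_le[OF C(2), of m] by linarith
    ultimately show "I = {\<zero>}" using C(4)[OF ID(1,2)] ID(3) by blast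
  qed
  then show ?thesis by blast
qed

section \<open>Ideals, maximal subrings and the cover\<close>

lemma (in cring) cgenideal_iff: "x \<in> PIdl a \<longleftrightarrow> (\<exists>r\<in>carrier R. x = r \<otimes> a)"
  unfolding cgenideal_def by blast

lemma (in cring) maximal_subring_add_ideal:
  assumes M: "maximal_subring R M" and I: "ideal I R" and nI: "\<not> I \<subseteq> M"
  shows "M <+> I = carrier R"
proof -
  note M' = nonunital_subringD[OF maximal_subringD(1)[OF M]]
    and I' = nonunital_subringD[OF ideal_nonunital_subring[OF I]]
  have "M \<subseteq> M <+> I" "I \<subseteq> M <+> I"
    using subset_set_add[OF M'(1,2) I'(1,2)] .
  moreover have "nonunital_subring (M <+> I) R"
    by (rule nonunital_subring_add_ideal[OF maximal_subringD(1)[OF M] I])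
  ultimately show ?thesis using maximal_subringD(3)[OF M, of "M <+> I"] nI by blast
qed

context finite_elementary_ring
begin

lemma C_subring: "S \<in> C \<Longrightarrow> nonunital_subring S R" and C_proper: "S \<in> C \<Longrightarrow> S \<noteq> carrier R"
  using maximal_subringD(1,2)[OF C_maximal] by simp_all

lemma C_carrier: "S \<in> C \<Longrightarrow> S \<subseteq> carrier R"
  by (rule nonunital_subringD(1)[OF C_subring])

lemma finite_C: "finite C"
proof (rule finite_subset)
  show "C \<subseteq> Pow (carrier R)" using C_carrier by blast
  show "finite (Pow (carrier R))" using finite_carrier by simp
qed

lemma C_covers:
  assumes "x \<in> carrier R"
  obtains S where "S \<in> C" "x \<in> S"
  using assms C_cover by blast

lemma nontrivial: "\<one> \<noteq> \<zero>"
proof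
  assume "\<one> = \<zero>"
  then have "carrier R = {\<zero>}" by (rule one_zeroD)
  obtain S where S: "S \<in> C" "\<zero> \<in> S" using C_covers[OF zero_closed] .
  then show False using C_proper[OF S(1)] C_carrier[OF S(1)] S(2) \<open>carrier R = {\<zero>}\<close> by auto
qed

text \<open>Subsets of \<open>C\<close> meet the bound of \<open>elementary\<close> automatically.
  Hence the members over a nonzero ideal never cover \<open>R\<close>, which is how most ideals
  below are shown to vanish.\<close>

lemma elementary_subset:
  assumes "ideal I R" "D \<subseteq> C" "carrier R \<subseteq> \<Union>D" "\<And>S. S \<in> D \<Longrightarrow> I \<subseteq> S"
  shows "I = {\<zero>}"
proof (rule elementary[OF assms(1) _ assms(4)])
  have sub: "\<And>S. S \<in> D \<Longrightarrow> nonunital_subring S R \<and> S \<noteq> carrier R \<and> S \<subseteq> carrier R"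
    using assms(2) C_subring C_proper C_carrier by blast
  then have "\<Union>D = carrier R" using assms(3) by blast
  then show "ring_cover R D" using sub by (simp add: ring_cover_def)
  show "card D \<le> card C" by (rule card_mono[OF finite_C assms(2)])
qed

text \<open>
  Here \<open>M\<close> is isomorphic to the quotient by \<open>I\<close>; if \<open>M\<close> were not in the cover, then the cover
  would restrict to one of \<open>M\<close>, which has too few members.
\<close>

lemma complement_in_C:
  assumes M: "maximal_subring R M" and I: "ideal I R" "I \<noteq> {\<zero>}"
    and MI: "M \<inter> I = {\<zero>}" "M <+> I = carrier R"
  shows "M \<in> C"
proof (rule ccontr)
  assume notin: "M \<notin> C"
  note M' = nonunital_subringD[OF maximal_subringD(1)[OF M]] nonunital_subring_minus[OF maximal_subringD(1)[OF M]]
  note I' = nonunital_subringD[OF ideal_nonunital_subring[OF I(1)]]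
  have mc: "m \<in> carrier R" if "m \<in> M" for m using that M'(1) by blast
  have ic: "m \<in> carrier R" if "m \<in> I" for m using that I'(1) by blast
  define D where "D = (\<lambda>S. (S \<inter> M) <+> I) ` C"
  have sub: "nonunital_subring (S \<inter> M) R" if "S \<in> C" for S
    by (rule nonunital_subring_Int[OF C_subring[OF that] maximal_subringD(1)[OF M]])
  have "ring_cover R D"
    unfolding ring_cover_def D_def
  proof (intro conjI ballI)
    fix T assume "T \<in> (\<lambda>S. (S \<inter> M) <+> I) ` C"
    then obtain S where S: "S \<in> C" "T = (S \<inter> M) <+> I" by blast
    show "nonunital_subring T R"
      unfolding S(2) by (rule nonunital_subring_add_ideal[OF sub[OF S(1)] I(1)])
    show "T \<noteq> carrier R"
    proof
      assume T: "T = carrier R"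
      \<comment> \<open>Since \<open>M\<close> and \<open>I\<close> meet in zero, the component of
        \<open>m\<close> in \<open>M\<close> is unique and is \<open>m\<close> itself; thus
        \<open>M\<close> lies in \<open>S\<close>, and maximality leaves \<open>S = M\<close> or
        \<open>S = carrier R\<close>.\<close>
      have "m \<in> S" if m: "m \<in> M" for m
      proof -
        have "m \<in> (S \<inter> M) <+> I" using mc[OF m] T S(2) by simp
        then obtain s i where si: "s \<in> S" "s \<in> M" "i \<in> I" "m = s \<oplus> i" by (auto simp: set_add_iff)
        have "m \<ominus> s = i" using si(4) mc[OF si(2)] ic[OF si(3)] by algebra
        moreover have "m \<ominus> s \<in> M" by (rule M'(5)[OF m si(2)])
        ultimately have "i = \<zero>" using si(3) MI(1) by blast
        then show ?thesis using si mc[OF si(2)] by simp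
      qed
      then have "S = M \<or> S = carrier R"
        using maximal_subringD(3)[OF M C_subring[OF S(1)]] by blast
      then show False using notin S(1) C_proper by blast
    qed
  next
    show "(\<Union>S\<in>C. (S \<inter> M) <+> I) = carrier R"
    proof
      show "(\<Union>S\<in>C. (S \<inter> M) <+> I) \<subseteq> carrier R"
        using nonunital_subringD(1)[OF nonunital_subring_add_ideal[OF sub I(1)]] by (rule UN_least)
      show "carrier R \<subseteq> (\<Union>S\<in>C. (S \<inter> M) <+> I)"
      proof
        fix x assume "x \<in> carrier R"
        then have "x \<in> M <+> I" using MI(2) by simp
        then obtain m i where mi: "m \<in> M" "i \<in> I" "x = m \<oplus> i" by (auto simp: set_add_iff)
        obtain S where S: "S \<in> C" "m \<in> S" using C_covers[OF mc[OF mi(1)]] .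
        then have "x \<in> (S \<inter> M) <+> I" unfolding mi(3) using mi by (intro set_addI) auto
        then show "x \<in> (\<Union>S\<in>C. (S \<inter> M) <+> I)" using S(1) by (rule UN_I[rotated])
      qed
    qed
  qed
  moreover have "I \<subseteq> T" if T: "T \<in> D" for T
  proof -
    obtain S where S: "S \<in> C" "T = (S \<inter> M) <+> I" using T unfolding D_def by blast
    note N = nonunital_subringD[OF sub[OF S(1)]]
    show ?thesis unfolding S(2) by (rule subset_set_add(2)[OF N(1,2) I'(1,2)])
  qed
  moreover have "card D \<le> card C" unfolding D_def by (rule card_image_le[OF finite_C])
  ultimately show False using elementary[OF I(1)] I(2) by blast
qed

text \<open>Chinese remaindering: choose \<open>x\<close> outside all members over \<open>A\<close>
  and \<open>y\<close> outside all members over \<open>B\<close>. Some \<open>z\<close> is congruent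
  to \<open>x\<close> modulo \<open>A\<close> and to \<open>y\<close> modulo \<open>B\<close>. A
  member through \<open>z\<close> contains \<open>A\<close> or \<open>B\<close>, hence
  \<open>x\<close> or \<open>y\<close>, a contradiction.\<close>

lemma ideals_dichotomy:
  assumes A: "ideal A R" and B: "ideal B R" and AB: "A <+> B = carrier R"
    and dich: "\<And>M. M \<in> C \<Longrightarrow> A \<subseteq> M \<or> B \<subseteq> M"
  shows "A = {\<zero>} \<or> B = {\<zero>}"
proof (rule ccontr)
  assume neg: "\<not> (A = {\<zero>} \<or> B = {\<zero>})"
  have nA: "\<not> carrier R \<subseteq> \<Union>{M \<in> C. A \<subseteq> M}"
    using elementary_subset[OF A, of "{M \<in> C. A \<subseteq> M}"] neg by blast
  have nB: "\<not> carrier R \<subseteq> \<Union>{M \<in> C. B \<subseteq> M}"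
    using elementary_subset[OF B, of "{M \<in> C. B \<subseteq> M}"] neg by blast
  obtain x where x: "x \<in> carrier R" "\<And>M. M \<in> C \<Longrightarrow> A \<subseteq> M \<Longrightarrow> x \<notin> M" using nA by blast
  obtain y where y: "y \<in> carrier R" "\<And>M. M \<in> C \<Longrightarrow> B \<subseteq> M \<Longrightarrow> y \<notin> M" using nB by blast
  have "\<one> \<in> A <+> B" using AB by simp
  then obtain a b where ab: "a \<in> A" "b \<in> B" "\<one> = a \<oplus> b" by (auto simp: set_add_iff)
  have c: "a \<in> carrier R" "b \<in> carrier R" using ideal.Icarr[OF A ab(1)] ideal.Icarr[OF B ab(2)] by simp_all
  define z where "z = b \<otimes> x \<oplus> a \<otimes> y"
  have zc: "z \<in> carrier R" unfolding z_def using c x y by simp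
  have "x = \<one> \<otimes> x" "y = \<one> \<otimes> y" using x y by simp_all
  then have xe: "x = z \<oplus> a \<otimes> (x \<ominus> y)" and ye: "y = z \<oplus> b \<otimes> (y \<ominus> x)"
    unfolding z_def ab(3) using c x(1) y(1) by algebra+
  obtain S where S: "S \<in> C" "z \<in> S" using C_covers[OF zc] .
  note S' = nonunital_subringD[OF C_subring[OF S(1)]]
  have "a \<otimes> (x \<ominus> y) \<in> A" "b \<otimes> (y \<ominus> x) \<in> B"
    using ideal.I_r_closed[OF A ab(1)] ideal.I_r_closed[OF B ab(2)] x(1) y(1) by auto
  then have "x \<in> S \<or> y \<in> S" if "A \<subseteq> S \<or> B \<subseteq> S"
    using that S'(3)[OF S(2)] xe ye by (metis subsetD)
  then show False using dich[OF S(1)] x(2)[OF S(1)] y(2)[OF S(1)]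
    S'(3)[OF S(2)] xe ye \<open>a \<otimes> (x \<ominus> y) \<in> A\<close> \<open>b \<otimes> (y \<ominus> x) \<in> B\<close> by (metis subsetD)
qed

end

section \<open>The characteristic is prime\<close>

lemma (in ring) nonunital_subring_add_pow:
  assumes "nonunital_subring S R" "x \<in> S"
  shows "[(n::nat)] \<cdot> x \<in> S"
proof -
  note S = nonunital_subringD[OF assms(1)]
  show ?thesis using assms(2) S by (induction n) auto
qed

text \<open>Substituting \<open>R = M + a R\<close> into its own last summand gives
  \<open>R = M + a M + a\<^sup>2 R\<close>, and \<open>M\<close> absorbs \<open>a M\<close>; then
  iterate. In the application \<open>a\<close> is a multiple of the identity, which maps every
  subring into itself.\<close>

lemma (in cring) subring_add_multiples_pow:
  assumes M: "nonunital_subring M R" and a: "a \<in> carrier R" and aM: "\<And>m. m \<in> M \<Longrightarrow> a \<otimes> m \<in> M"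
    and eq: "M <+> PIdl a = carrier R"
  shows "x \<in> carrier R \<Longrightarrow> \<exists>m\<in>M. \<exists>r\<in>carrier R. x = m \<oplus> a [^] (k::nat) \<otimes> r"
proof (induction k arbitrary: x)
  note M' = nonunital_subringD[OF M]
  case 0
  then have "x = \<zero> \<oplus> a [^] (0::nat) \<otimes> x" by simp
  then show ?case using M'(2) 0 by blast
next
  note M' = nonunital_subringD[OF M]
  have mc: "m \<in> carrier R" if "m \<in> M" for m using that M'(1) by blast
  case (Suc k)
  then obtain m r where m: "m \<in> M" "r \<in> carrier R" "x = m \<oplus> a [^] k \<otimes> r" by blast
  have "r \<in> M <+> PIdl a" using eq m by simp
  then obtain m' s where m': "m' \<in> M" "s \<in> carrier R" "r = m' \<oplus> s \<otimes> a"
    by (auto simp: set_add_iff cgenideal_iff)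
  have "a [^] k \<otimes> m' \<in> M"
  proof (induction k)
    case 0
    then show ?case using m' mc by simp
  next
    case (Suc k)
    have "a [^] Suc k \<otimes> m' = a \<otimes> (a [^] k \<otimes> m')"
      using a mc[OF m'(1)] by (simp add: m_ac)
    then show ?case using aM[OF Suc] by simp
  qed
  then have "m \<oplus> a [^] k \<otimes> m' \<in> M" using M'(3) m by blast
  moreover have "x = (m \<oplus> a [^] k \<otimes> m') \<oplus> a [^] Suc k \<otimes> s"
    unfolding m(3) m'(3) nat_pow_Suc
    using a m(2) m'(2) mc[OF m(1)] mc[OF m'(1)] nat_pow_closed[OF a, of k] by algebra
  ultimately show ?case using m' by blast
qed

lemma (in ring) finite_imp_add_pow_one_zero:
  assumes "finite (carrier R)"
  shows "\<exists>n>0. [(n::nat)] \<cdot> \<one> = \<zero>"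
proof (intro exI conjI)
  show "card (carrier R) > 0" using assms one_closed by (auto simp: card_gt_0_iff)
  show "[card (carrier R)] \<cdot> \<one> = \<zero>"
    using add.pow_order_eq_1[OF one_closed] by (simp add: Coset.order_def)
qed

lemma (in cring) add_pow_one_mult: "[(m * n :: nat)] \<cdot> \<one> = ([m] \<cdot> \<one>) \<otimes> ([n] \<cdot> \<one>)"
proof -
  have "([m] \<cdot> \<one>) \<otimes> ([n] \<cdot> \<one>) = [m] \<cdot> ([n] \<cdot> \<one>)"
    by (simp add: add_pow_ldistr)
  also have "\<dots> = [(n * m)] \<cdot> \<one>" by (simp add: add.nat_pow_pow)
  finally show ?thesis by (simp add: mult.commute)
qed

lemma (in cring) add_pow_one_power: "[(m ^ k :: nat)] \<cdot> \<one> = ([m] \<cdot> \<one>) [^] k"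
  by (induction k) (simp_all add: add_pow_one_mult m_comm)

text \<open>Let \<open>m\<close> be the part of the characteristic \<open>n\<close> prime to
  \<open>p\<close>. A member \<open>M\<close> not containing \<open>p R\<close> satisfies
  \<open>R = M + p ^ k R\<close>, and multiplying by \<open>m\<close> kills the second summand, so
  \<open>m R = m M\<close> lies in \<open>M\<close>. By \<open>ideals_dichotomy\<close> one of
  \<open>p R\<close> and \<open>m R\<close> is zero, and \<open>m R\<close> is not because
  \<open>m < n\<close>.\<close>

lemma (in finite_elementary_ring) prime_characteristic:
  "\<exists>p. Factorial_Ring.prime (p::nat) \<and> [p] \<cdot> \<one> = \<zero>"
proof -
  define P where "P n \<longleftrightarrow> n > 0 \<and> [n] \<cdot> \<one> = \<zero>" for n :: nat
  define n where "n = (LEAST n. P n)"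
  have exP: "\<exists>n. P n" using finite_imp_add_pow_one_zero[OF finite_carrier] by (simp add: P_def)
  have n: "P n" unfolding n_def by (rule LeastI_ex[OF exP])
  have least: "n \<le> m" if "P m" for m unfolding n_def using that by (rule Least_le)
  have "n \<noteq> 1" using n nontrivial by (auto simp: P_def)
  then obtain p where p: "Factorial_Ring.prime p" "p dvd n" using prime_factor_nat by blast
  define k where "k = multiplicity p n"
  obtain m where m: "n = p ^ k * m" "\<not> p dvd m"
    unfolding k_def using multiplicity_decompose'[of n p] n p by (metis P_def not_prime_unit neq0_conv)
  define A where "A = PIdl ([p] \<cdot> \<one>)"
  define B where "B = PIdl ([m] \<cdot> \<one>)"
  have A: "ideal A R" and B: "ideal B R" unfolding A_def B_def by (auto intro: cgenideal_ideal)
  have AB: "A <+> B = carrier R"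
  proof -
    have "coprime p m" using p m(2) prime_imp_coprime by blast
    then obtain u v where uv: "p * u = m * v + 1"
      using bezout_nat[of p m] p by (metis coprime_iff_gcd_eq_1 not_prime_0)
    have "([p] \<cdot> \<one>) \<otimes> ([u] \<cdot> \<one>) = ([m] \<cdot> \<one>) \<otimes> ([v] \<cdot> \<one>) \<oplus> \<one>"
      using arg_cong[OF uv, of "\<lambda>n. [n] \<cdot> \<one>"] by (simp add: add_pow_one_mult)
    then have "\<one> = ([u] \<cdot> \<one>) \<otimes> ([p] \<cdot> \<one>) \<oplus> (\<ominus> ([v] \<cdot> \<one>)) \<otimes> ([m] \<cdot> \<one>)"
      using add.nat_pow_closed[OF one_closed, of p] add.nat_pow_closed[OF one_closed, of m]
        add.nat_pow_closed[OF one_closed, of u] add.nat_pow_closed[OF one_closed, of v]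
        one_closed by algebra
    also have "\<dots> \<in> A <+> B"
      unfolding A_def B_def by (intro set_addI) (auto simp: cgenideal_iff)
    finally have "\<one> \<in> A <+> B" .
    then show ?thesis by (rule ideal.one_imp_carrier[OF add_ideals[OF A B]])
  qed
  have "A = {\<zero>} \<or> B = {\<zero>}"
  proof (rule ideals_dichotomy[OF A B AB])
    fix M assume M: "M \<in> C"
    note M' = C_subring[OF M] nonunital_subringD[OF C_subring[OF M]]
    have mc: "m \<in> carrier R" if "m \<in> M" for m using that M'(2) by blast
    have mult: "([j] \<cdot> \<one>) \<otimes> x \<in> M" if "x \<in> M" for j :: nat and x
      using nonunital_subring_add_pow[OF M'(1) that, of j] mc[OF that] by (simp add: add_pow_ldistr)
    show "A \<subseteq> M \<or> B \<subseteq> M"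
    proof (cases "A \<subseteq> M")
      case False
      then have eq: "M <+> PIdl ([p] \<cdot> \<one>) = carrier R"
        using maximal_subring_add_ideal[OF C_maximal[OF M] A] by (simp add: A_def)
      have "B \<subseteq> M"
      proof
        fix b assume "b \<in> B"
        then obtain x where x: "x \<in> carrier R" "b = x \<otimes> ([m] \<cdot> \<one>)" by (auto simp: B_def cgenideal_iff)
        obtain y r where y: "y \<in> M" "r \<in> carrier R" "x = y \<oplus> ([p] \<cdot> \<one>) [^] k \<otimes> r"
          using subring_add_multiples_pow[OF M'(1) _ mult eq x(1), of k] by auto
        have z: "([p] \<cdot> \<one>) [^] k \<otimes> ([m] \<cdot> \<one>) = \<zero>"
          using n m(1) by (simp add: P_def add_pow_one_mult add_pow_one_power)
        define u where "u = ([p] \<cdot> \<one>) [^] k"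
        define v where "v = [m] \<cdot> \<one>"
        have uv: "u \<in> carrier R" "v \<in> carrier R" by (simp_all add: u_def v_def)
        have "b = v \<otimes> y \<oplus> (u \<otimes> v) \<otimes> r"
          unfolding x(2) y(3) u_def[symmetric] v_def[symmetric] using uv mc[OF y(1)] y(2) by algebra
        also have "\<dots> = v \<otimes> y" using z uv mc[OF y(1)] y(2) by (simp add: u_def v_def)
        finally show "b \<in> M" using mult[OF y(1), of m] by (simp add: v_def)
      qed
      then show ?thesis by blast
    qed blast
  qed
  moreover have "B \<noteq> {\<zero>}"
  proof
    assume "B = {\<zero>}"
    moreover have "[m] \<cdot> \<one> \<in> B" unfolding B_def by (rule cgenideal_self) simp
    ultimately have "P m" using n m(1) by (auto simp: P_def)
    then have "n \<le> m" by (rule least)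
    moreover have "k > 0" unfolding k_def using p n by (simp add: P_def prime_multiplicity_gt_zero_iff)
    then have "p ^ k > 1" using one_less_power[OF prime_gt_1_nat[OF p(1)]] by blast
    then have "m < n" using m(1) n by (auto simp: P_def)
    ultimately show False by simp
  qed
  moreover have "[p] \<cdot> \<one> \<in> A" unfolding A_def by (rule cgenideal_self) simp
  ultimately show ?thesis using p(1) by blast
qed

section \<open>The Frobenius splitting\<close>

lemma (in cring) binomial_theorem:
  assumes x: "x \<in> carrier R" and y: "y \<in> carrier R"
  shows "(x \<oplus> y) [^] (n::nat) = (\<Oplus>k\<in>{..n}. [(n choose k)] \<cdot> (x [^] k \<otimes> y [^] (n - k)))"
proof (induction n)
  case 0
  then show ?case using x y by simp
next
  case (Suc n)
  define T where "T k = [(n choose k)] \<cdot> (x [^] k \<otimes> y [^] (n - k))" for k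
  define U where "U k = [(n choose k)] \<cdot> (x [^] k \<otimes> y [^] (Suc n - k))" for k
  define V where "V k = [(Suc n choose k)] \<cdot> (x [^] k \<otimes> y [^] (Suc n - k))" for k
  have c: "T k \<in> carrier R" "U k \<in> carrier R" "V k \<in> carrier R" for k
    using x y by (simp_all add: T_def U_def V_def)
  have VS: "V (Suc k) = x \<otimes> T k \<oplus> U (Suc k)" for k
    using x y by (simp add: V_def T_def U_def add.nat_pow_mult[symmetric] add_pow_rdistr m_assoc m_comm m_lcomm)
  have V0: "V 0 = U 0" using x y by (simp add: V_def U_def)
  have UT: "U k = y \<otimes> T k" if "k \<le> n" for k
    using x y that by (simp add: U_def T_def add_pow_rdistr Suc_diff_le m_ac)
  have Un: "U (Suc n) = \<zero>" using x y by (simp add: U_def binomial_eq_0)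
  have "(\<Oplus>k\<in>{..Suc n}. V k) = (\<Oplus>k\<in>{..n}. V (Suc k)) \<oplus> V 0"
    using c by (intro finsum_Suc2) auto
  also have "(\<Oplus>k\<in>{..n}. V (Suc k)) = (\<Oplus>k\<in>{..n}. x \<otimes> T k) \<oplus> (\<Oplus>k\<in>{..n}. U (Suc k))"
    unfolding VS using c x by (intro finsum_addf) auto
  also have "\<dots> \<oplus> V 0 = (\<Oplus>k\<in>{..n}. x \<otimes> T k) \<oplus> ((\<Oplus>k\<in>{..n}. U (Suc k)) \<oplus> U 0)"
    unfolding V0 using c x by (intro a_assoc finsum_closed) auto
  also have "(\<Oplus>k\<in>{..n}. U (Suc k)) \<oplus> U 0 = (\<Oplus>k\<in>{..Suc n}. U k)"
    using c by (intro finsum_Suc2[symmetric]) auto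
  also have "\<dots> = U (Suc n) \<oplus> (\<Oplus>k\<in>{..n}. U k)"
    using c by (intro finsum_Suc) auto
  also have "\<dots> = (\<Oplus>k\<in>{..n}. U k)"
    unfolding Un using c by (intro l_zero finsum_closed) auto
  also have "\<dots> = (\<Oplus>k\<in>{..n}. y \<otimes> T k)"
    using UT c y by (intro finsum_cong') auto
  also have "(\<Oplus>k\<in>{..n}. x \<otimes> T k) \<oplus> (\<Oplus>k\<in>{..n}. y \<otimes> T k) = x \<otimes> (\<Oplus>k\<in>{..n}. T k) \<oplus> y \<otimes> (\<Oplus>k\<in>{..n}. T k)"
    using c x y by (subst (1 2) finsum_rdistr) auto
  also have "\<dots> = (\<Oplus>k\<in>{..n}. T k) \<otimes> (x \<oplus> y)"
  proof -
    have "finsum R T {..n} \<in> carrier R" using c by (intro finsum_closed) auto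
    then show ?thesis using x y by algebra
  qed
  also have "\<dots> = (x \<oplus> y) [^] Suc n"
    using Suc by (simp add: T_def)
  finally show ?case by (simp add: V_def)
qed

lemma (in cring) frobenius_add:
  assumes p: "Factorial_Ring.prime p" "[(p::nat)] \<cdot> \<one> = \<zero>" and x: "x \<in> carrier R" and y: "y \<in> carrier R"
  shows "(x \<oplus> y) [^] (p ^ k) = x [^] (p ^ k) \<oplus> y [^] (p ^ k)"
proof -
  have pz: "[p] \<cdot> z = \<zero>" if "z \<in> carrier R" for z
    using add_pow_ldistr[OF one_closed that, of p] that p(2) by simp
  have step: "(x \<oplus> y) [^] p = x [^] p \<oplus> y [^] p" if x: "x \<in> carrier R" and y: "y \<in> carrier R" for x y
  proof -
    define T where "T k = [(p choose k)] \<cdot> (x [^] k \<otimes> y [^] (p - k))" for k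
    have c: "T k \<in> carrier R" for k using x y by (simp add: T_def)
    \<comment> \<open>The two end terms are split off the sum; the inner ones vanish because
      \<open>p\<close> divides their coefficients.\<close>
    obtain q where q: "p = Suc (Suc q)" using prime_ge_2_nat[OF p(1)] by (metis add_2_eq_Suc le_Suc_ex)
    have z: "T (Suc k) = \<zero>" if k: "k \<in> {..q}" for k
    proof -
      have "p dvd (p choose Suc k)" using p(1) q k by (intro dvd_choose_prime) auto
      then obtain j where j: "p choose Suc k = p * j" by blast
      have "[(p * j)] \<cdot> w = \<zero>" if "w \<in> carrier R" for w
        using add.nat_pow_pow[of w j p] pz[OF that] that by simp
      then show ?thesis unfolding T_def j using x y by simp
    qed
    have "(x \<oplus> y) [^] p = (\<Oplus>k\<in>{..p}. T k)"
      unfolding T_def by (rule binomial_theorem[OF x y])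
    also have "\<dots> = T p \<oplus> (\<Oplus>k\<in>{..Suc q}. T k)"
      unfolding q using c by (intro finsum_Suc) auto
    also have "(\<Oplus>k\<in>{..Suc q}. T k) = (\<Oplus>k\<in>{..q}. T (Suc k)) \<oplus> T 0"
      using c by (intro finsum_Suc2) auto
    also have "(\<Oplus>k\<in>{..q}. T (Suc k)) = (\<Oplus>k\<in>{..q}. \<zero>)"
      using z by (intro finsum_cong') auto
    also have "\<dots> = \<zero>" by simp
    finally show ?thesis using x y c by (simp add: T_def)
  qed
  show ?thesis
    using x y
  proof (induction k)
    case (Suc k)
    have "(x \<oplus> y) [^] (p ^ Suc k) = ((x \<oplus> y) [^] (p ^ k)) [^] p"
      using Suc.prems by (simp add: nat_pow_pow mult.commute)
    also have "\<dots> = (x [^] (p ^ k)) [^] p \<oplus> (y [^] (p ^ k)) [^] p"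
      using Suc step by simp
    finally show ?case using Suc.prems by (simp add: nat_pow_pow mult.commute)
  qed simp
qed

text \<open>The sequence \<open>x [^] (p ^ i)\<close> repeats within its first \<open>N + 1\<close>
  terms, so its preperiod and its period are at most \<open>N\<close>. The exponent
  \<open>fact N\<close> is at least every preperiod and divisible by every period, hence serves all
  \<open>x\<close> at once.\<close>

lemma (in monoid) finite_pow_iterate_idempotent:
  assumes fin: "finite (carrier G)"
  shows "\<exists>k>0. \<forall>x\<in>carrier G. (x [^] ((p::nat) ^ k)) [^] (p ^ k) = x [^] (p ^ k)"
proof -
  define N where "N = card (carrier G)"
  define k :: nat where "k = fact N"
  have "(x [^] (p ^ k)) [^] (p ^ k) = x [^] (p ^ k)" if x: "x \<in> carrier G" for x
  proof -
    have "\<not> inj_on (\<lambda>i. x [^] (p ^ i)) {..N}"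
    proof
      assume "inj_on (\<lambda>i. x [^] (p ^ i)) {..N}"
      then have "card {..N} \<le> card (carrier G)"
        using fin x by (intro card_inj_on_le) auto
      then show False by (simp add: N_def)
    qed
    then obtain i j where ij: "i < j" "j \<le> N" "x [^] (p ^ i) = x [^] (p ^ j)"
      unfolding inj_on_def by (metis atMost_iff linorder_neqE_nat)
    define d where "d = j - i"
    have step: "x [^] (p ^ (m + d)) = x [^] (p ^ m)" if "i \<le> m" for m
    proof -
      have "x [^] (p ^ (m + d)) = (x [^] (p ^ j)) [^] (p ^ (m - i))"
      proof -
        have "m + d = j + (m - i)" using ij that by (simp add: d_def)
        then show ?thesis using x by (simp add: nat_pow_pow power_add)
      qed
      also have "\<dots> = (x [^] (p ^ i)) [^] (p ^ (m - i))" using ij by simp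
      also have "\<dots> = x [^] (p ^ m)"
        using x that by (simp add: nat_pow_pow flip: power_add)
      finally show ?thesis .
    qed
    have iter: "x [^] (p ^ (m + d * t)) = x [^] (p ^ m)" if "i \<le> m" for m t
    proof (induction t)
      case (Suc t)
      have e: "m + d * Suc t = (m + d * t) + d" by simp
      show ?case unfolding e using step[of "m + d * t"] Suc that by simp
    qed simp
    have "d dvd k" unfolding k_def d_def using ij by (intro dvd_fact) auto
    then obtain t where t: "k = d * t" by blast
    have "i \<le> k" using ij fact_ge_self[of N] by (simp add: k_def)
    then have "x [^] (p ^ (k + k)) = x [^] (p ^ k)" using iter[of k t] t by simp
    then show ?thesis using x by (simp add: nat_pow_pow power_add)
  qed
  moreover have "k > 0" by (simp add: k_def)
  ultimately show ?thesis by blast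
qed

text \<open>
  The Frobenius power \<open>x \<mapsto> x ^ q\<close> is idempotent; its image is a copy of the largest reduced
  quotient and its kernel is the nilradical.
\<close>

locale frobenius_ring = finite_elementary_ring +
  fixes p q k :: nat
  assumes p_prime: "Factorial_Ring.prime p" and p_zero: "[p] \<cdot> \<one> = \<zero>"
    and q_def: "q = p ^ k" and k_pos: "k > 0"
    and q_idem: "\<And>x. x \<in> carrier R \<Longrightarrow> (x [^] q) [^] q = x [^] q"

lemma (in finite_elementary_ring) frobenius_ring_exists: "\<exists>p q k. frobenius_ring R C p q k"
proof -
  obtain p where p: "Factorial_Ring.prime (p::nat)" "[p] \<cdot> \<one> = \<zero>" using prime_characteristic by blast
  obtain k :: nat where k: "k > 0" "\<forall>x\<in>carrier R. (x [^] (p ^ k)) [^] (p ^ k) = x [^] (p ^ k)"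
    using finite_pow_iterate_idempotent[OF finite_carrier, of p] by (elim exE conjE) (rule that)
  have "frobenius_ring R C p (p ^ k) k"
  proof (rule frobenius_ring.intro[OF finite_elementary_ring_axioms], rule frobenius_ring_axioms.intro)
    show "Factorial_Ring.prime p" "[p] \<cdot> \<one> = \<zero>" by (fact p)+
    show "p ^ k = p ^ k" "k > 0" by (rule refl, fact k(1))
    show "(x [^] (p ^ k)) [^] (p ^ k) = x [^] (p ^ k)" if "x \<in> carrier R" for x
      using k(2) that by (rule bspec)
  qed
  then show ?thesis by (intro exI)
qed

context frobenius_ring
begin

text \<open>Fixed points and image of the power map coincide by \<open>q_idem\<close>; with fixed
  points, membership is an equation.\<close>

definition sep :: "'a set" where "sep = {x \<in> carrier R. x [^] q = x}"
definition nil :: "'a set" where "nil = {x \<in> carrier R. x [^] q = \<zero>}"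

lemma q_gt_1: "q > 1"
  unfolding q_def by (rule one_less_power[OF prime_gt_1_nat[OF p_prime] k_pos])

lemma frob_add: "x \<in> carrier R \<Longrightarrow> y \<in> carrier R \<Longrightarrow> (x \<oplus> y) [^] q = x [^] q \<oplus> y [^] q"
  unfolding q_def by (rule frobenius_add[OF p_prime p_zero])

lemma frob_zero: "\<zero> [^] q = \<zero>"
  using q_gt_1 nat_pow_zero by simp

lemma frob_neg:
  assumes "x \<in> carrier R"
  shows "(\<ominus> x) [^] q = \<ominus> (x [^] q)"
proof -
  have "x [^] q \<oplus> (\<ominus> x) [^] q = \<zero>"
    using frob_add[of x "\<ominus> x"] assms frob_zero by (simp add: r_neg)
  then show ?thesis
    using assms by (metis minus_equality a_comm a_inv_closed nat_pow_closed)
qed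

lemma sepD: "x \<in> sep \<Longrightarrow> x \<in> carrier R" "x \<in> sep \<Longrightarrow> x [^] q = x"
  and nilD: "x \<in> nil \<Longrightarrow> x \<in> carrier R" "x \<in> nil \<Longrightarrow> x [^] q = \<zero>"
  unfolding sep_def nil_def by simp_all

lemma sep_subring: "nonunital_subring sep R"
  by (rule nonunital_subringI)
    (auto simp: sep_def frob_zero frob_add frob_neg nat_pow_distrib)

lemmas sep_closed = nonunital_subringD(2,3,4)[OF sep_subring] nonunital_subring_minus[OF sep_subring]

lemma one_sep: "\<one> \<in> sep"
  by (simp add: sep_def)

lemma sep_pow: "x \<in> sep \<Longrightarrow> x [^] (n::nat) \<in> sep"
  using nonunital_subring_pow[OF sep_subring] one_sep by (cases "n = 0") simp_all

lemma nil_ideal: "ideal nil R"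
  by (rule idealI') (auto simp: nil_def frob_zero frob_add nat_pow_distrib)

lemmas nil_closed = nonunital_subringD(2,3,4)[OF ideal_nonunital_subring[OF nil_ideal]]
  nonunital_subring_minus[OF ideal_nonunital_subring[OF nil_ideal]]
  ideal.I_l_closed[OF nil_ideal] ideal.I_r_closed[OF nil_ideal]

lemma frob_sep: "x \<in> carrier R \<Longrightarrow> x [^] q \<in> sep"
  by (simp add: sep_def q_idem)

lemma sep_nil_zero: "x \<in> sep \<Longrightarrow> x \<in> nil \<Longrightarrow> x = \<zero>"
  by (simp add: sep_def nil_def)

lemma sep_nil_decomp:
  assumes "x \<in> carrier R"
  obtains s j where "s \<in> sep" "j \<in> nil" "x = s \<oplus> j"
proof
  show "x [^] q \<in> sep" by (rule frob_sep[OF assms])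
  have "(x \<ominus> x [^] q) [^] q = \<zero>"
    unfolding a_minus_def using assms by (simp add: frob_add frob_neg q_idem r_neg)
  then show "x \<ominus> x [^] q \<in> nil" using assms by (simp add: nil_def)
  have "x [^] q \<in> carrier R" using assms by simp
  then show "x = x [^] q \<oplus> (x \<ominus> x [^] q)" using assms by algebra
qed

text \<open>Among the nilpotents outside \<open>M\<close>, take one whose ideal has least
  cardinality: a multiple \<open>b\<close> of it outside \<open>M\<close> cannot generate a smaller
  ideal, so it generates the same one. This is applied to a nilpotent multiple
  \<open>j \<otimes> a\<close> and to an idempotent multiple
  \<open>(\<one> \<ominus> f) \<otimes> a\<close>.\<close>

lemma minimal_ideal_generator:
  assumes "a0 \<in> nil" "a0 \<notin> M"
  obtains a where "a \<in> nil" "a \<notin> M"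
    "\<And>b. b \<in> nil \<Longrightarrow> b \<in> PIdl a \<Longrightarrow> b \<notin> M \<Longrightarrow> a \<in> PIdl b"
proof -
  obtain a where a: "a \<in> nil \<and> a \<notin> M" "\<And>b. b \<in> nil \<and> b \<notin> M \<Longrightarrow> card (PIdl a) \<le> card (PIdl b)"
    using ex_has_least_nat[of "\<lambda>a. a \<in> nil \<and> a \<notin> M" a0 "\<lambda>a. card (PIdl a)"] assms by blast
  have ac: "a \<in> carrier R" using a nilD by blast
  have "a \<in> PIdl b" if b: "b \<in> nil" "b \<in> PIdl a" "b \<notin> M" for b
  proof -
    have sub: "PIdl b \<subseteq> PIdl a"
      by (rule cgenideal_minimal[OF cgenideal_ideal[OF ac] b(2)])
    have "PIdl a \<subseteq> carrier R" using ac by (auto simp: cgenideal_iff)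
    then have "finite (PIdl a)" using finite_carrier by (rule finite_subset)
    then have "PIdl b = PIdl a" using sub a(2)[of b] b by (intro card_seteq) auto
    then show ?thesis using cgenideal_self[OF ac] by simp
  qed
  then show thesis using that a by blast
qed

text \<open>
  Choosing \<open>a \<in> nil - M\<close> with \<open>R a\<close> smallest forces \<open>nil \<cdot> a \<subseteq> M\<close>, while \<open>nil \<subseteq> M + R a\<close>.
\<close>

lemma nil_mult_in_maximal:
  assumes M: "maximal_subring R M" and x: "x \<in> nil" and y: "y \<in> nil"
  shows "x \<otimes> y \<in> M"
proof (cases "nil \<subseteq> M")
  case True
  then show ?thesis using nil_closed(3)[OF x y] by blast
next
  case False
  note M' = nonunital_subringD[OF maximal_subringD(1)[OF M]]
  have mc: "m \<in> carrier R" if "m \<in> M" for m using that M'(1) by blast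
  obtain a where a: "a \<in> nil" "a \<notin> M" "\<And>b. b \<in> nil \<Longrightarrow> b \<in> PIdl a \<Longrightarrow> b \<notin> M \<Longrightarrow> a \<in> PIdl b"
    using False minimal_ideal_generator by (metis subsetI)
  have ac: "a \<in> carrier R" by (rule nilD(1)[OF a(1)])
  \<comment> \<open>If \<open>j \<otimes> a\<close> were outside \<open>M\<close>, minimality would
    give \<open>a = c \<otimes> a\<close> with \<open>c\<close> nilpotent, and iterating gives
    \<open>a = \<zero>\<close>.\<close>
  have ja: "j \<otimes> a \<in> M" if j: "j \<in> nil" for j
  proof (rule ccontr)
    assume "j \<otimes> a \<notin> M"
    moreover have jc: "j \<in> carrier R" by (rule nilD(1)[OF j])
    then have "j \<otimes> a \<in> PIdl a" by (auto simp: cgenideal_iff)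
    ultimately have "a \<in> PIdl (j \<otimes> a)" using a(3) nil_closed(3)[OF j a(1)] by blast
    then obtain r where r: "r \<in> carrier R" "a = r \<otimes> (j \<otimes> a)" by (auto simp: cgenideal_iff)
    define c where "c = r \<otimes> j"
    have c: "c \<in> nil" unfolding c_def by (rule nil_closed(5)[OF j r(1)])
    have ca: "a = c \<otimes> a" using r jc ac by (simp add: c_def m_assoc)
    have "a = c [^] n \<otimes> a" for n :: nat
    proof (induction n)
      case (Suc n)
      have "c [^] Suc n \<otimes> a = c [^] n \<otimes> (c \<otimes> a)"
        using nilD(1)[OF c] ac by (simp add: m_assoc)
      then show ?case using Suc ca by simp
    qed (use ac in simp)
    from this[of q] have "a = \<zero>" using nilD(2)[OF c] ac by simp
    then show False using a(2) M'(2) by simp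
  qed
  have eq: "M <+> PIdl a = carrier R"
    by (rule maximal_subring_add_ideal[OF M cgenideal_ideal[OF ac]]) (use a(2) cgenideal_self[OF ac] in blast)
  have dec: "\<exists>m r. m \<in> M \<and> m \<in> nil \<and> r \<in> carrier R \<and> z = m \<oplus> r \<otimes> a" if z: "z \<in> nil" for z
  proof -
    have "z \<in> M <+> PIdl a" using eq nilD(1)[OF z] by simp
    then obtain m r where m: "m \<in> M" "r \<in> carrier R" "z = m \<oplus> r \<otimes> a"
      by (auto simp: set_add_iff cgenideal_iff)
    have "m = z \<ominus> r \<otimes> a" unfolding m(3) using mc[OF m(1)] m(2) ac by algebra
    then have "m \<in> nil" using nil_closed(4)[OF z nil_closed(5)[OF a(1) m(2)]] by simp
    then show ?thesis using m by blast
  qed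
  obtain m r where m: "m \<in> M" "m \<in> nil" "r \<in> carrier R" "x = m \<oplus> r \<otimes> a" using dec[OF x] by blast
  obtain n s where n: "n \<in> M" "n \<in> nil" "s \<in> carrier R" "y = n \<oplus> s \<otimes> a" using dec[OF y] by blast
  \<comment> \<open>The bracket lies in \<open>nil\<close>, so its product with \<open>a\<close> is
    in \<open>M\<close> by \<open>ja\<close>.\<close>
  have e: "x \<otimes> y = m \<otimes> n \<oplus> (s \<otimes> m \<oplus> r \<otimes> n \<oplus> (r \<otimes> s) \<otimes> a) \<otimes> a"
    unfolding m(4) n(4) using mc[OF m(1)] mc[OF n(1)] m(3) n(3) ac by algebra
  show ?thesis unfolding e
    by (intro M'(3,4) m(1) n(1) ja nil_closed(2) nil_closed(5) m(2,3) n(2,3) a(1) m_closed)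
qed

text \<open>Each \<open>r \<otimes> (x \<otimes> y)\<close> is again a product of two nilpotents, so
  the ideal generated by \<open>x \<otimes> y\<close> lies in every member of the cover.\<close>

lemma nil_square_zero:
  assumes x: "x \<in> nil" and y: "y \<in> nil"
  shows "x \<otimes> y = \<zero>"
proof -
  have c: "x \<in> carrier R" "y \<in> carrier R" using x y nilD by blast+
  have "PIdl (x \<otimes> y) = {\<zero>}"
  proof (rule elementary_subset[of _ C])
    show "ideal (PIdl (x \<otimes> y)) R" using c by (intro cgenideal_ideal) simp
    show "carrier R \<subseteq> \<Union>C" using C_cover by simp
    fix M assume M: "M \<in> C"
    show "PIdl (x \<otimes> y) \<subseteq> M"
    proof
      fix z assume "z \<in> PIdl (x \<otimes> y)"
      then obtain r where r: "r \<in> carrier R" "z = r \<otimes> (x \<otimes> y)" by (auto simp: cgenideal_iff)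
      then have "z = (r \<otimes> x) \<otimes> y" using c by (simp add: m_assoc)
      then show "z \<in> M" using nil_mult_in_maximal[OF C_maximal[OF M] nil_closed(5)[OF x r(1)] y] by simp
    qed
  qed simp
  then show ?thesis using cgenideal_self[of "x \<otimes> y"] c by simp
qed

text \<open>The nilpotent part of \<open>r\<close> kills \<open>a\<close> because \<open>nil\<close>
  has square zero. So \<open>nil\<close> is a module over \<open>sep\<close>, and the ideals inside
  it are its submodules.\<close>

lemma nil_absorb:
  assumes "r \<in> carrier R" "a \<in> nil"
  obtains s where "s \<in> sep" "r \<otimes> a = s \<otimes> a"
proof -
  obtain s j where s: "s \<in> sep" "j \<in> nil" "r = s \<oplus> j" using sep_nil_decomp[OF assms(1)] .
  have "r \<otimes> a = s \<otimes> a \<oplus> j \<otimes> a"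
    unfolding s(3) by (rule l_distr[OF sepD(1)[OF s(1)] nilD(1)[OF s(2)] nilD(1)[OF assms(2)]])
  also have "\<dots> = s \<otimes> a"
    using nil_square_zero[OF s(2) assms(2)] sepD(1)[OF s(1)] nilD(1)[OF assms(2)] by simp
  finally show thesis using that s(1) by blast
qed

text \<open>Modulo \<open>nil\<close> every \<open>s\<close> agrees with some \<open>m\<close> of
  \<open>M\<close>, and the \<open>q\<close>-th power removes the nilpotent error:
  \<open>s = s [^] q = m [^] q\<close>.\<close>

lemma sep_subset_maximal:
  assumes M: "maximal_subring R M" and "\<not> nil \<subseteq> M"
  shows "sep \<subseteq> M"
proof
  fix s assume s: "s \<in> sep"
  note M' = nonunital_subringD[OF maximal_subringD(1)[OF M]]
  have "s \<in> M <+> nil"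
    using maximal_subring_add_ideal[OF M nil_ideal assms(2)] sepD(1)[OF s] by simp
  then obtain m j where m: "m \<in> M" "j \<in> nil" "s = m \<oplus> j" by (auto simp: set_add_iff)
  have mc: "m \<in> carrier R" using m(1) M'(1) by blast
  have "s = (m \<oplus> j) [^] q" using sepD(2)[OF s] m(3) by simp
  also have "\<dots> = m [^] q" using frob_add[OF mc nilD(1)[OF m(2)]] nilD(2)[OF m(2)] mc by simp
  finally show "s \<in> M" using nonunital_subring_pow[OF maximal_subringD(1)[OF M] m(1), of q] q_gt_1 by simp
qed

text \<open>By \<open>s [^] q = s\<close>, the power \<open>s [^] (q - 1)\<close> acts as identity
  on \<open>s\<close>: it is the support of \<open>s\<close>, and \<open>s [^] (q - 2)\<close>
  inverts \<open>s\<close> on that support.\<close>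

lemma idempotent_power:
  assumes s: "s \<in> sep"
  shows "s \<otimes> s [^] (q - 1) = s" "s [^] (q - 1) \<otimes> s [^] (q - 1) = s [^] (q - 1)"
proof -
  have sc: "s \<in> carrier R" by (rule sepD(1)[OF s])
  obtain t where t: "q = Suc (Suc t)" using q_gt_1 by (metis Suc_lessE less_natE add_Suc_right One_nat_def)
  have e: "s [^] Suc (Suc t) = s" using sepD(2)[OF s] t by simp
  show 1: "s \<otimes> s [^] (q - 1) = s"
    using e sc t by (simp add: m_comm)
  have "s [^] (q - 1) \<otimes> s [^] (q - 1) = s [^] t \<otimes> (s \<otimes> s [^] (q - 1))"
    using sc t by (simp add: m_assoc)
  also have "\<dots> = s [^] t \<otimes> s" by (simp only: 1)
  also have "\<dots> = s [^] (q - 1)" using t by simp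
  finally show "s [^] (q - 1) \<otimes> s [^] (q - 1) = s [^] (q - 1)" .
qed

text \<open>By \<open>complement_in_C\<close> it is enough that \<open>M\<close> meets
  \<open>PIdl a\<close> in zero for a minimal \<open>a\<close> outside \<open>M\<close>. If
  \<open>s \<otimes> a\<close> is in \<open>M\<close> and \<open>f\<close> is the support of
  \<open>s\<close>, then \<open>f \<otimes> a\<close> is in \<open>M\<close>, so
  \<open>a \<ominus> f \<otimes> a\<close> is outside and has \<open>a\<close> as a multiple. But
  \<open>f\<close> kills it, so \<open>f \<otimes> a\<close>, and with it
  \<open>s \<otimes> a\<close>, is zero.\<close>

lemma maximal_over_sep_in_C:
  assumes M: "maximal_subring R M" and SM: "sep \<subseteq> M"
  shows "M \<in> C"
proof -
  note M' = nonunital_subringD[OF maximal_subringD(1)[OF M]]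
  have "\<not> nil \<subseteq> M"
  proof
    assume "nil \<subseteq> M"
    then have "x \<in> M" if "x \<in> carrier R" for x
      using sep_nil_decomp[OF that] SM M'(3) by (metis subsetD)
    then show False using M'(1) maximal_subringD(2)[OF M] by blast
  qed
  then obtain a where a: "a \<in> nil" "a \<notin> M" "\<And>b. b \<in> nil \<Longrightarrow> b \<in> PIdl a \<Longrightarrow> b \<notin> M \<Longrightarrow> a \<in> PIdl b"
    using minimal_ideal_generator by (metis subsetI)
  have ac: "a \<in> carrier R" by (rule nilD(1)[OF a(1)])
  have "x = \<zero>" if x: "x \<in> M" "x \<in> PIdl a" for x
  proof -
    obtain r where r: "r \<in> carrier R" "x = r \<otimes> a" using x(2) by (auto simp: cgenideal_iff)
    obtain s where s: "s \<in> sep" "x = s \<otimes> a" using nil_absorb[OF r(1) a(1)] r(2) by metis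
    have sc: "s \<in> carrier R" by (rule sepD(1)[OF s(1)])
    define f where "f = s [^] (q - 1)"
    have f: "f \<in> sep" unfolding f_def by (rule sep_pow[OF s(1)])
    have fc: "f \<in> carrier R" by (rule sepD(1)[OF f])
    have ff: "f \<otimes> f = f" "s \<otimes> f = s" unfolding f_def using idempotent_power[OF s(1)] by simp_all
    obtain t where t: "q = Suc (Suc t)" using q_gt_1 by (metis Suc_lessE less_natE add_Suc_right One_nat_def)
    have "f \<otimes> a = s [^] t \<otimes> x" unfolding f_def t s(2) using sc ac by (simp add: m_assoc)
    moreover have "s [^] t \<in> M" using sep_pow[OF s(1)] SM by blast
    ultimately have fM: "f \<otimes> a \<in> M" using M'(4) x(1) by simp
    define b where "b = a \<ominus> f \<otimes> a"
    have "b \<in> nil" unfolding b_def by (rule nil_closed(4)[OF a(1) nil_closed(5)[OF a(1) fc]])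
    moreover have "b = (\<one> \<ominus> f) \<otimes> a" unfolding b_def using fc ac by algebra
    then have "b \<in> PIdl a" using fc by (auto simp: cgenideal_iff)
    moreover have "b \<notin> M"
    proof
      assume "b \<in> M"
      then have "b \<oplus> f \<otimes> a \<in> M" using M'(3) fM by blast
      moreover have "b \<oplus> f \<otimes> a = a" unfolding b_def using fc ac by algebra
      ultimately show False using a(2) by simp
    qed
    ultimately have "a \<in> PIdl b" by (rule a(3))
    then obtain u where u: "u \<in> carrier R" "a = u \<otimes> b" by (auto simp: cgenideal_iff)
    have "f \<otimes> a = f \<otimes> (u \<otimes> b)" by (rule arg_cong[OF u(2)])
    also have "\<dots> = u \<otimes> (f \<otimes> a \<ominus> (f \<otimes> f) \<otimes> a)"
      using u(1) fc ac unfolding b_def by algebra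
    also have "\<dots> = \<zero>" unfolding ff(1) using u(1) fc ac by (simp add: r_neg a_minus_def)
    finally have "f \<otimes> a = \<zero>" .
    then have "(s \<otimes> f) \<otimes> a = \<zero>" using sc fc ac by (simp add: m_assoc)
    then show ?thesis using s(2) ff(2) by simp
  qed
  then have int: "M \<inter> PIdl a = {\<zero>}"
    using M'(2) additive_subgroup.zero_closed[OF ideal.axioms(1)[OF cgenideal_ideal[OF ac]]] by blast
  have aM: "\<not> PIdl a \<subseteq> M" using a(2) cgenideal_self[OF ac] by blast
  show ?thesis
  proof (rule complement_in_C[OF M cgenideal_ideal[OF ac] _ int])
    show "PIdl a \<noteq> {\<zero>}" using aM M'(2) by auto
    show "M <+> PIdl a = carrier R"
      by (rule maximal_subring_add_ideal[OF M cgenideal_ideal[OF ac] aM])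
  qed
qed

text \<open>For \<open>x = s \<oplus> j\<close> the subring \<open>sep <+> (PIdl j <+> I)\<close>
  contains \<open>x\<close>, and it is proper because its only nilpotents are those of
  \<open>PIdl j <+> I\<close>. A maximal subring above it is in \<open>C\<close> by
  \<open>maximal_over_sep_in_C\<close>.\<close>

lemma cover_over_sep:
  assumes I: "ideal I R" "I \<subseteq> nil" and nc: "\<And>j. j \<in> nil \<Longrightarrow> PIdl j <+> I \<noteq> nil"
  shows "carrier R \<subseteq> \<Union>{M \<in> C. sep \<subseteq> M \<and> I \<subseteq> M}"
proof
  fix x assume x: "x \<in> carrier R"
  obtain s j where s: "s \<in> sep" "j \<in> nil" "x = s \<oplus> j" using sep_nil_decomp[OF x] .
  have jc: "j \<in> carrier R" by (rule nilD(1)[OF s(2)])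
  define K where "K = PIdl j <+> I"
  have K: "ideal K R" unfolding K_def by (rule add_ideals[OF cgenideal_ideal[OF jc] I(1)])
  note K' = nonunital_subringD[OF ideal_nonunital_subring[OF K]]
  note P' = nonunital_subringD[OF ideal_nonunital_subring[OF cgenideal_ideal[OF jc]]]
  note I' = nonunital_subringD[OF ideal_nonunital_subring[OF I(1)]]
  have PK: "PIdl j \<subseteq> K" "I \<subseteq> K" unfolding K_def using subset_set_add[OF P'(1,2) I'(1,2)] .
  have "PIdl j \<subseteq> nil" using nil_closed(5)[OF s(2)] by (auto simp: cgenideal_iff)
  then have Kn: "K \<subseteq> nil"
    unfolding K_def using I(2) by (auto simp: set_add_iff intro!: nil_closed(2))
  have sub: "nonunital_subring (sep <+> K) R" by (rule nonunital_subring_add_ideal[OF sep_subring K])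
  have "sep <+> K \<noteq> carrier R"
  proof
    assume eq: "sep <+> K = carrier R"
    have "y \<in> K" if y: "y \<in> nil" for y
    proof -
      have "y \<in> sep <+> K" using eq nilD(1)[OF y] by simp
      then obtain t k where t: "t \<in> sep" "k \<in> K" "y = t \<oplus> k" by (auto simp: set_add_iff)
      have kn: "k \<in> nil" using t(2) Kn by blast
      have "t = y \<ominus> k" unfolding t(3) using sepD(1)[OF t(1)] nilD(1)[OF kn] by algebra
      then have "t \<in> nil" using nil_closed(4)[OF y kn] by simp
      then have "t = \<zero>" using sep_nil_zero[OF t(1)] by simp
      then show ?thesis using t nilD(1)[OF kn] by simp
    qed
    then have "K = nil" using Kn by blast
    then show False using nc[OF s(2)] by (simp add: K_def)
  qed
  then obtain M where M: "maximal_subring R M" "sep <+> K \<subseteq> M"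
    using maximal_subring_exists[OF finite_carrier sub] by blast
  note S' = nonunital_subringD[OF sep_subring]
  have sM: "sep \<subseteq> M" "K \<subseteq> M" using subset_set_add[OF S'(1,2) K'(1,2)] M(2) by blast+
  have "M \<in> C" by (rule maximal_over_sep_in_C[OF M(1) sM(1)])
  moreover have "x \<in> M"
  proof -
    have "j \<in> M" using PK(1) sM(2) cgenideal_self[OF jc] by blast
    then show ?thesis unfolding s(3) using nonunital_subringD(3)[OF maximal_subringD(1)[OF M(1)]] s(1) sM(1) by blast
  qed
  ultimately show "x \<in> \<Union>{M \<in> C. sep \<subseteq> M \<and> I \<subseteq> M}" using sM PK by blast
qed

text \<open>Otherwise the members over both \<open>sep\<close> and \<open>I\<close> would cover
  \<open>R\<close>, which forces \<open>I\<close> to vanish.\<close>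

lemma cyclic_quotient:
  assumes I: "ideal I R" "I \<subseteq> nil" "I \<noteq> {\<zero>}"
  obtains j where "j \<in> nil" "PIdl j <+> I = nil"
proof -
  have "I = {\<zero>}" if nc: "\<And>j. j \<in> nil \<Longrightarrow> PIdl j <+> I \<noteq> nil"
    by (rule elementary_subset[OF I(1) _ cover_over_sep[OF I(1,2) nc]]) auto
  then show thesis using that I(3) by blast
qed

section \<open>Nonzero nilradical: a field acting on a plane\<close>

context
  assumes nil_nonzero: "nil \<noteq> {\<zero>}"
begin

text \<open>With a generator \<open>j\<close>, a member through \<open>s \<oplus> j\<close> contains
  \<open>nil\<close>, or else it contains \<open>sep\<close>, hence \<open>j\<close> and all
  multiples of \<open>j\<close> by \<open>sep\<close>, which is \<open>nil\<close> again. So the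
  members over \<open>nil\<close> contain every \<open>s \<oplus> i\<close> and cover
  \<open>R\<close>, forcing \<open>nil\<close> to vanish.\<close>

lemma nil_not_cyclic:
  assumes j: "j \<in> nil"
  shows "PIdl j \<noteq> nil"
proof
  assume cyc: "PIdl j = nil"
  have "carrier R \<subseteq> \<Union>{M \<in> C. nil \<subseteq> M}"
  proof
    fix x assume x: "x \<in> carrier R"
    obtain s i where s: "s \<in> sep" "i \<in> nil" "x = s \<oplus> i" using sep_nil_decomp[OF x] .
    have c: "s \<in> carrier R" "i \<in> carrier R" "j \<in> carrier R" using s j sepD(1) nilD(1) by simp_all
    obtain M where M: "M \<in> C" "s \<oplus> j \<in> M" using C_covers[of "s \<oplus> j"] c by auto
    note M' = C_subring[OF M(1)] nonunital_subringD[OF C_subring[OF M(1)]]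
    have nM: "nil \<subseteq> M"
    proof (rule ccontr)
      assume n: "\<not> nil \<subseteq> M"
      then have sM: "sep \<subseteq> M" by (rule sep_subset_maximal[OF C_maximal[OF M(1)]])
      have "(s \<oplus> j) \<ominus> s \<in> M" by (rule nonunital_subring_minus[OF M'(1) M(2)]) (use s sM in blast)
      moreover have "(s \<oplus> j) \<ominus> s = j" using c by algebra
      ultimately have jM: "j \<in> M" by simp
      have "y \<in> M" if y: "y \<in> nil" for y
      proof -
        have "y \<in> PIdl j" using y cyc by simp
        then obtain r where r: "r \<in> carrier R" "y = r \<otimes> j" unfolding cgenideal_iff by blast
        obtain t where t: "t \<in> sep" "r \<otimes> j = t \<otimes> j" using nil_absorb[OF r(1) j] .
        show ?thesis unfolding r(2) t(2) by (rule M'(5)[OF subsetD[OF sM t(1)] jM])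
      qed
      then have "nil \<subseteq> M" by (rule subsetI)
      then show False using n by simp
    qed
    have e: "x = (s \<oplus> j) \<oplus> (i \<ominus> j)" unfolding s(3) using c by algebra
    have "i \<ominus> j \<in> M" using nM nil_closed(4)[OF s(2) j] by blast
    then have "x \<in> M" unfolding e by (rule M'(4)[OF M(2)])
    then show "x \<in> \<Union>{M \<in> C. nil \<subseteq> M}" using M(1) nM by blast
  qed
  then have "nil = {\<zero>}" by (intro elementary_subset[OF nil_ideal, of "{M \<in> C. nil \<subseteq> M}"]) auto
  then show False using nil_nonzero by simp
qed

text \<open>As \<open>nil\<close> is not cyclic, the members over \<open>sep\<close> already cover
  \<open>R\<close>, and an ideal inside \<open>sep\<close> is contained in all of them. In effect
  \<open>sep\<close> acts faithfully on \<open>nil\<close>.\<close>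

lemma ideal_in_sep:
  assumes I: "ideal I R" "I \<subseteq> sep"
  shows "I = {\<zero>}"
proof -
  have "carrier R \<subseteq> \<Union>{M \<in> C. sep \<subseteq> M \<and> {\<zero>} \<subseteq> M}"
  proof (rule cover_over_sep[OF zeroideal])
    show "{\<zero>} \<subseteq> nil" using nil_closed(1) by simp
    fix j assume j: "j \<in> nil"
    have "PIdl j \<subseteq> carrier R" using nilD(1)[OF j] by (auto simp: cgenideal_iff)
    then have "PIdl j <+> {\<zero>} = PIdl j" by (force simp: set_add_iff subset_eq)
    then show "PIdl j <+> {\<zero>} \<noteq> nil" using nil_not_cyclic[OF j] by simp
  qed
  then show ?thesis
    by (intro elementary_subset[OF I(1), of "{M \<in> C. sep \<subseteq> M \<and> {\<zero>} \<subseteq> M}"]) (use I(2) in auto)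
qed

text \<open>The set is \<open>e\<close> times \<open>nil\<close>. Were it zero,
  \<open>r \<otimes> e\<close> would depend only on the \<open>sep\<close> part of \<open>r\<close>,
  and \<open>PIdl e\<close> would be an ideal inside \<open>sep\<close>.\<close>

lemma eigen_ideal:
  assumes e: "e \<in> sep" "e \<otimes> e = e" "e \<noteq> \<zero>"
  shows "ideal {x \<in> nil. e \<otimes> x = x} R" "{x \<in> nil. e \<otimes> x = x} \<noteq> {\<zero>}"
proof -
  have ec: "e \<in> carrier R" by (rule sepD(1)[OF e(1)])
  show "ideal {x \<in> nil. e \<otimes> x = x} R"
  proof (rule idealI')
    show "{x \<in> nil. e \<otimes> x = x} \<subseteq> carrier R" using nilD(1) by blast
    show "\<zero> \<in> {x \<in> nil. e \<otimes> x = x}" using nil_closed(1) ec by simp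
    show "x \<oplus> y \<in> {x \<in> nil. e \<otimes> x = x}" if "x \<in> {x \<in> nil. e \<otimes> x = x}" "y \<in> {x \<in> nil. e \<otimes> x = x}" for x y
      using that nil_closed(2) nilD(1) ec by (simp add: r_distr)
    show "r \<otimes> x \<in> {x \<in> nil. e \<otimes> x = x}" if "x \<in> {x \<in> nil. e \<otimes> x = x}" "r \<in> carrier R" for x r
    proof -
      have x: "x \<in> nil" "e \<otimes> x = x" using that(1) by simp_all
      have "e \<otimes> (r \<otimes> x) = r \<otimes> (e \<otimes> x)" by (rule m_lcomm[OF ec that(2) nilD(1)[OF x(1)]])
      then show ?thesis using nil_closed(5)[OF x(1) that(2)] x(2) by simp
    qed
  qed
  show "{x \<in> nil. e \<otimes> x = x} \<noteq> {\<zero>}"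
  proof
    assume z: "{x \<in> nil. e \<otimes> x = x} = {\<zero>}"
    have "PIdl e = {\<zero>}"
    proof (rule ideal_in_sep[OF cgenideal_ideal[OF ec]])
      show "PIdl e \<subseteq> sep"
      proof
        fix y assume "y \<in> PIdl e"
        then obtain r where r: "r \<in> carrier R" "y = r \<otimes> e" by (auto simp: cgenideal_iff)
        obtain s j where s: "s \<in> sep" "j \<in> nil" "r = s \<oplus> j" using sep_nil_decomp[OF r(1)] .
        have c: "s \<in> carrier R" "j \<in> carrier R" using s sepD(1) nilD(1) by simp_all
        have "e \<otimes> (j \<otimes> e) = (e \<otimes> e) \<otimes> j" using c ec by algebra
        then have "e \<otimes> (j \<otimes> e) = j \<otimes> e" using e(2) c ec by (simp add: m_comm)
        then have "j \<otimes> e = \<zero>" using z nil_closed(6)[OF s(2) ec] by blast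
        moreover have "y = s \<otimes> e \<oplus> j \<otimes> e" unfolding r(2) s(3) by (rule l_distr[OF c ec])
        ultimately have "y = s \<otimes> e" using c ec by simp
        then show "y \<in> sep" using sep_closed(3)[OF s(1) e(1)] by simp
      qed
    qed
    then show False using cgenideal_self[OF ec] e(3) by blast
  qed
qed

text \<open>A nontrivial \<open>e\<close> with complement \<open>f\<close> splits \<open>nil\<close>
  into two nonzero ideals \<open>E\<close> and \<open>F\<close>. If \<open>a\<close> generates
  \<open>nil\<close> modulo \<open>E\<close> and \<open>b\<close> generates it modulo
  \<open>F\<close>, then \<open>f \<otimes> a\<close> generates \<open>F\<close> and
  \<open>e \<otimes> b\<close> generates \<open>E\<close>. Since \<open>e\<close> and
  \<open>f\<close> separate the two, their sum \<open>c\<close> generates \<open>nil\<close>,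
  contradicting \<open>nil_not_cyclic\<close>.\<close>

lemma sep_idempotent_trivial:
  assumes e: "e \<in> sep" "e \<otimes> e = e"
  shows "e = \<zero> \<or> e = \<one>"
proof (rule ccontr)
  assume neg: "\<not> (e = \<zero> \<or> e = \<one>)"
  have ec: "e \<in> carrier R" by (rule sepD(1)[OF e(1)])
  define f where "f = \<one> \<ominus> e"
  have f: "f \<in> sep" unfolding f_def by (rule sep_closed(4)[OF one_sep e(1)])
  have fc: "f \<in> carrier R" by (rule sepD(1)[OF f])
  have "f \<otimes> f = \<one> \<ominus> e \<ominus> e \<oplus> e \<otimes> e" unfolding f_def using ec by algebra
  also have "\<dots> = f" unfolding f_def e(2) using ec by algebra
  finally have ff: "f \<otimes> f = f" .
  have "e \<otimes> f = e \<ominus> e \<otimes> e" unfolding f_def using ec by algebra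
  then have ef: "e \<otimes> f = \<zero>" using e(2) ec by (simp add: r_neg a_minus_def)
  have fe: "f \<otimes> e = \<zero>" using ef m_comm[OF ec fc] by simp
  have fn: "f \<noteq> \<zero>" unfolding f_def using neg ec by auto
  have esum: "e \<oplus> f = \<one>" unfolding f_def using ec by algebra
  define E where "E = {x \<in> nil. e \<otimes> x = x}"
  define F where "F = {x \<in> nil. f \<otimes> x = x}"
  obtain a where a: "a \<in> nil" "PIdl a <+> E = nil"
    by (rule cyclic_quotient[of E]) (use eigen_ideal[OF e] neg in \<open>auto simp: E_def\<close>)
  obtain b where b: "b \<in> nil" "PIdl b <+> F = nil"
    by (rule cyclic_quotient[of F]) (use eigen_ideal[OF f ff fn] in \<open>auto simp: F_def\<close>)
  have ac: "a \<in> carrier R" and bc: "b \<in> carrier R" using a b nilD(1) by simp_all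
  define c where "c = f \<otimes> a \<oplus> e \<otimes> b"
  have c: "c \<in> nil" unfolding c_def
    by (rule nil_closed(2)[OF nil_closed(5)[OF a(1) fc] nil_closed(5)[OF b(1) ec]])
  have cc: "c \<in> carrier R" by (rule nilD(1)[OF c])
  have fcx: "f \<otimes> c = f \<otimes> a"
  proof -
    have "f \<otimes> c = (f \<otimes> f) \<otimes> a \<oplus> (f \<otimes> e) \<otimes> b" unfolding c_def using fc ec ac bc by algebra
    then show ?thesis using ff fe fc ac bc by simp
  qed
  have ecx: "e \<otimes> c = e \<otimes> b"
  proof -
    have "e \<otimes> c = (e \<otimes> f) \<otimes> a \<oplus> (e \<otimes> e) \<otimes> b" unfolding c_def using fc ec ac bc by algebra
    then show ?thesis using e ef ec ac bc by simp
  qed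
  have sup: "y \<in> PIdl c" if y: "y \<in> nil" for y
  proof -
    have yc: "y \<in> carrier R" by (rule nilD(1)[OF y])
    have "y \<in> PIdl a <+> E" using y a(2) by simp
    then obtain cr u where u0: "cr \<in> PIdl a" "u \<in> E" "y = cr \<oplus> u" unfolding set_add_iff by blast
    obtain r where r0: "r \<in> carrier R" "cr = r \<otimes> a" using u0(1) unfolding cgenideal_iff by blast
    have r: "r \<in> carrier R" "u \<in> nil" "e \<otimes> u = u" "y = r \<otimes> a \<oplus> u"
      using r0 u0(2,3) by (simp_all add: E_def)
    have "y \<in> PIdl b <+> F" using y b(2) by simp
    then obtain cs v where v0: "cs \<in> PIdl b" "v \<in> F" "y = cs \<oplus> v" unfolding set_add_iff by blast
    obtain s where s0: "s \<in> carrier R" "cs = s \<otimes> b" using v0(1) unfolding cgenideal_iff by blast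
    have s: "s \<in> carrier R" "v \<in> nil" "f \<otimes> v = v" "y = s \<otimes> b \<oplus> v"
      using s0 v0(2,3) by (simp_all add: F_def)
    have uc: "u \<in> carrier R" "v \<in> carrier R" using r s nilD(1) by simp_all
    have "f \<otimes> u = (f \<otimes> e) \<otimes> u" using r(3) m_assoc[OF fc ec uc(1)] by simp
    then have fu: "f \<otimes> u = \<zero>" using fe uc by simp
    have "e \<otimes> v = (e \<otimes> f) \<otimes> v" using s(3) m_assoc[OF ec fc uc(2)] by simp
    then have ev: "e \<otimes> v = \<zero>" using ef uc by simp
    have "f \<otimes> y = r \<otimes> (f \<otimes> a) \<oplus> f \<otimes> u" unfolding r(4) using fc r(1) ac uc by algebra
    then have fy: "f \<otimes> y = r \<otimes> (f \<otimes> c)" using fu fcx fc r(1) ac by simp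
    have "e \<otimes> y = s \<otimes> (e \<otimes> b) \<oplus> e \<otimes> v" unfolding s(4) using ec s(1) bc uc by algebra
    then have ey: "e \<otimes> y = s \<otimes> (e \<otimes> c)" using ev ecx ec s(1) bc by simp
    have "y = (e \<oplus> f) \<otimes> y" using esum yc by simp
    also have "\<dots> = e \<otimes> y \<oplus> f \<otimes> y" using ec fc yc by algebra
    also have "\<dots> = (s \<otimes> e \<oplus> r \<otimes> f) \<otimes> c" unfolding ey fy using ec fc cc r(1) s(1) by algebra
    finally show ?thesis using ec fc r(1) s(1) by (auto simp: cgenideal_iff)
  qed
  have "PIdl c \<subseteq> nil" using nil_closed(5)[OF c] by (auto simp: cgenideal_iff)
  moreover have "nil \<subseteq> PIdl c" using sup by (rule subsetI)
  ultimately have "PIdl c = nil" by (rule subset_antisym)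
  then show False by (rule notE[OF nil_not_cyclic[OF c]])
qed

text \<open>The support of a nonzero \<open>s\<close> is a nonzero idempotent of \<open>sep\<close>,
  so it can only be the identity.\<close>

lemma sep_unit:
  assumes s: "s \<in> sep" "s \<noteq> \<zero>"
  shows "s \<otimes> s [^] (q - 2) = \<one>"
proof -
  have sc: "s \<in> carrier R" by (rule sepD(1)[OF s(1)])
  have "s [^] (q - 1) = \<zero> \<or> s [^] (q - 1) = \<one>"
    by (rule sep_idempotent_trivial[OF sep_pow[OF s(1)] idempotent_power(2)[OF s(1)]])
  moreover have "s [^] (q - 1) \<noteq> \<zero>"
    using idempotent_power(1)[OF s(1)] s(2) sc by auto
  moreover have "s [^] (q - 1) = s \<otimes> s [^] (q - 2)"
  proof -
    have "q - 1 = Suc (q - 2)" using q_gt_1 by simp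
    then show ?thesis using sc by (simp add: m_comm)
  qed
  ultimately show ?thesis by simp
qed

text \<open>Take any nonzero \<open>v\<close>; modulo the ideal it generates \<open>nil\<close> is
  cyclic, which yields \<open>w\<close>. A relation with nonzero coefficient at \<open>w\<close>
  would put \<open>w\<close> into \<open>PIdl v\<close> and make \<open>nil\<close> cyclic.\<close>

lemma nil_basis:
  obtains v w where "v \<in> nil" "w \<in> nil"
    "\<And>x. x \<in> nil \<Longrightarrow> \<exists>s\<in>sep. \<exists>t\<in>sep. x = s \<otimes> v \<oplus> t \<otimes> w"
    "\<And>s t. s \<in> sep \<Longrightarrow> t \<in> sep \<Longrightarrow> s \<otimes> v \<oplus> t \<otimes> w = \<zero> \<Longrightarrow> s = \<zero> \<and> t = \<zero>"
proof -
  obtain v where v: "v \<in> nil" "v \<noteq> \<zero>" using nil_nonzero nil_closed(1) by blast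
  have vc: "v \<in> carrier R" by (rule nilD(1)[OF v(1)])
  have Pv: "PIdl v \<subseteq> nil" using nil_closed(5)[OF v(1)] by (auto simp: cgenideal_iff)
  have "PIdl v \<noteq> {\<zero>}" using cgenideal_self[OF vc] v(2) by blast
  then obtain w where w: "w \<in> nil" "PIdl w <+> PIdl v = nil"
    using cyclic_quotient[OF cgenideal_ideal[OF vc] Pv] by metis
  have wc: "w \<in> carrier R" by (rule nilD(1)[OF w(1)])
  show thesis
  proof (rule that[OF v(1) w(1)])
    fix x assume "x \<in> nil"
    then have "x \<in> PIdl w <+> PIdl v" using w(2) by simp
    then obtain a b where ab: "a \<in> PIdl w" "b \<in> PIdl v" "x = a \<oplus> b" unfolding set_add_iff by blast
    obtain r where r0: "r \<in> carrier R" "a = r \<otimes> w" using ab(1) unfolding cgenideal_iff by blast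
    obtain u where u0: "u \<in> carrier R" "b = u \<otimes> v" using ab(2) unfolding cgenideal_iff by blast
    have r: "r \<in> carrier R" "u \<in> carrier R" "x = r \<otimes> w \<oplus> u \<otimes> v"
      using r0 u0 ab(3) by simp_all
    obtain t where t: "t \<in> sep" "r \<otimes> w = t \<otimes> w" using nil_absorb[OF r(1) w(1)] .
    obtain s where s: "s \<in> sep" "u \<otimes> v = s \<otimes> v" using nil_absorb[OF r(2) v(1)] .
    have "x = s \<otimes> v \<oplus> t \<otimes> w"
      unfolding r(3) t(2) s(2) using sepD(1)[OF s(1)] sepD(1)[OF t(1)] vc wc by (simp add: a_comm)
    then show "\<exists>s\<in>sep. \<exists>t\<in>sep. x = s \<otimes> v \<oplus> t \<otimes> w" using s t by blast
  next
    fix s t assume st: "s \<in> sep" "t \<in> sep" "s \<otimes> v \<oplus> t \<otimes> w = \<zero>"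
    have c: "s \<in> carrier R" "t \<in> carrier R" using st sepD(1) by simp_all
    have t0: "t = \<zero>"
    proof (rule ccontr)
      assume tn: "t \<noteq> \<zero>"
      define u where "u = t [^] (q - 2)"
      have u: "u \<in> carrier R" "t \<otimes> u = \<one>" unfolding u_def using c sep_unit[OF st(2) tn] by simp_all
      have "w = u \<otimes> (s \<otimes> v \<oplus> t \<otimes> w) \<ominus> (u \<otimes> s) \<otimes> v \<oplus> (\<one> \<ominus> t \<otimes> u) \<otimes> w"
        using u(1) c vc wc by algebra
      then have "w = (\<ominus> (u \<otimes> s)) \<otimes> v"
        unfolding st(3) u(2) using u(1) c vc wc by (simp add: a_minus_def r_neg l_minus)
      then have "w \<in> PIdl v" using u(1) c by (auto simp: cgenideal_iff)
      then have "PIdl w \<subseteq> PIdl v" by (rule cgenideal_minimal[OF cgenideal_ideal[OF vc]])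
      then have "PIdl w <+> PIdl v \<subseteq> PIdl v"
        by (auto simp: set_add_iff
            intro!: nonunital_subringD(3)[OF ideal_nonunital_subring[OF cgenideal_ideal[OF vc]]])
      then have "PIdl v = nil" using w(2) Pv by blast
      then show False using nil_not_cyclic[OF v(1)] by simp
    qed
    have sv: "s \<otimes> v = \<zero>" using st(3) t0 c vc wc by simp
    have "s = \<zero>"
    proof (rule ccontr)
      assume sn: "s \<noteq> \<zero>"
      have "v = (s \<otimes> s [^] (q - 2)) \<otimes> v" using sep_unit[OF st(1) sn] vc by simp
      also have "\<dots> = s [^] (q - 2) \<otimes> (s \<otimes> v)" using c(1) vc by (simp add: m_ac)
      also have "\<dots> = \<zero>" using sv c(1) by simp
      finally show False using v(2) by simp
    qed
    then show "s = \<zero> \<and> t = \<zero>" using t0 by simp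
  qed
qed

end

end

section \<open>The matrix ring\<close>

text \<open>The operations stay those of \<open>R\<close> and only carrier and identity change. This
  treats \<open>sep\<close>, the ideals of primitive idempotents and the subfields of these at
  once.\<close>

lemma (in cring) corner_field:
  assumes K: "nonunital_subring K R" and e: "e \<in> K" "\<And>x. x \<in> K \<Longrightarrow> e \<otimes> x = x" "e \<noteq> \<zero>"
    and inv: "\<And>x. x \<in> K \<Longrightarrow> x \<noteq> \<zero> \<Longrightarrow> \<exists>y\<in>K. x \<otimes> y = e"
  shows "field (R\<lparr>carrier := K, one := e\<rparr>)"
proof -
  note K' = nonunital_subringD[OF K]
  have c: "x \<in> carrier R" if "x \<in> K" for x using that K'(1) by blast
  have "cring (R\<lparr>carrier := K, one := e\<rparr>)"
  proof (rule cringI)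
    show "abelian_group (R\<lparr>carrier := K, one := e\<rparr>)"
    proof (rule abelian_groupI)
      fix x assume "x \<in> carrier (R\<lparr>carrier := K, one := e\<rparr>)"
      then show "\<exists>y\<in>carrier (R\<lparr>carrier := K, one := e\<rparr>). y \<oplus>\<^bsub>R\<lparr>carrier := K, one := e\<rparr>\<^esub> x = \<zero>\<^bsub>R\<lparr>carrier := K, one := e\<rparr>\<^esub>"
        using nonunital_subring_a_inv[OF K] c l_neg by (intro bexI[of _ "\<ominus> x"]) simp_all
    qed (use K' c in \<open>simp_all add: a_ac\<close>)
    show "comm_monoid (R\<lparr>carrier := K, one := e\<rparr>)"
      by (rule comm_monoidI) (use K' c e in \<open>simp_all add: m_ac\<close>)
    show "\<And>x y z. x \<in> carrier (R\<lparr>carrier := K, one := e\<rparr>) \<Longrightarrow> y \<in> carrier (R\<lparr>carrier := K, one := e\<rparr>) \<Longrightarrow>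
      z \<in> carrier (R\<lparr>carrier := K, one := e\<rparr>) \<Longrightarrow>
      (x \<oplus>\<^bsub>R\<lparr>carrier := K, one := e\<rparr>\<^esub> y) \<otimes>\<^bsub>R\<lparr>carrier := K, one := e\<rparr>\<^esub> z =
      x \<otimes>\<^bsub>R\<lparr>carrier := K, one := e\<rparr>\<^esub> z \<oplus>\<^bsub>R\<lparr>carrier := K, one := e\<rparr>\<^esub> y \<otimes>\<^bsub>R\<lparr>carrier := K, one := e\<rparr>\<^esub> z"
      using c by (simp add: l_distr)
  qed
  then show ?thesis
    by (rule cring.cring_fieldI2) (use e(3) inv in simp_all)
qed

lemma is_ring_isoI: "h \<in> ring_iso R S \<Longrightarrow> R \<simeq> S"
  unfolding is_ring_iso_def by blast

text \<open>The classification asserts a field on the type \<open>nat\<close>; a finite field is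
  carried there by an injection.\<close>

lemma field_nat_copy:
  fixes K :: "('a, 'm) ring_scheme"
  assumes K: "field K" and fin: "finite (carrier K)"
  obtains F :: "nat ring" where "field F" "finite (carrier F)" "K \<simeq> F"
proof -
  obtain f :: "'a \<Rightarrow> nat" where f: "inj_on f (carrier K)"
    using finite_imp_inj_to_nat_seg[OF fin] by blast
  interpret K: field K by fact
  show thesis
  proof (rule that)
    show "field (image_ring f K)" by (rule K.inj_imp_image_ring_is_field[OF f])
    show "finite (carrier (image_ring f K))" using fin by (simp add: image_ring_carrier)
    show "K \<simeq> image_ring f K"
      by (rule is_ring_isoI[OF inj_imp_image_ring_iso[OF f]])
  qed
qed

text \<open>\<open>L\<close> is only asked to have a closed carrier: it will be
  \<open>local_matrix_ring\<close>, which is not shown to be a ring beforehand.\<close>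

lemma is_ring_iso_inverseI:
  assumes h: "h \<in> ring_iso L R" and one: "\<one>\<^bsub>L\<^esub> \<in> carrier L"
    and closed: "\<And>x y. x \<in> carrier L \<Longrightarrow> y \<in> carrier L \<Longrightarrow> x \<otimes>\<^bsub>L\<^esub> y \<in> carrier L"
      "\<And>x y. x \<in> carrier L \<Longrightarrow> y \<in> carrier L \<Longrightarrow> x \<oplus>\<^bsub>L\<^esub> y \<in> carrier L"
  shows "R \<simeq> L"
proof -
  note h' = ring_iso_memE[OF h]
  define g where "g = inv_into (carrier L) h"
  have g: "bij_betw g (carrier R) (carrier L)" unfolding g_def by (rule bij_betw_inv_into[OF h'(5)])
  have gc: "g x \<in> carrier L" if "x \<in> carrier R" for x using bij_betwE[OF g] that by blast
  have hg: "h (g x) = x" if "x \<in> carrier R" for x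
    unfolding g_def by (rule bij_betw_inv_into_right[OF h'(5) that])
  have gh: "g (h x) = x" if "x \<in> carrier L" for x
    unfolding g_def by (rule bij_betw_inv_into_left[OF h'(5) that])
  have "g \<in> ring_iso R L"
  proof (rule ring_iso_memI[OF gc _ _ _ g])
    fix x y assume xy: "x \<in> carrier R" "y \<in> carrier R"
    show "g (x \<otimes>\<^bsub>R\<^esub> y) = g x \<otimes>\<^bsub>L\<^esub> g y"
      using gh[OF closed(1)[OF gc gc], OF xy] h'(2)[OF gc gc, OF xy] hg xy by simp
    show "g (x \<oplus>\<^bsub>R\<^esub> y) = g x \<oplus>\<^bsub>L\<^esub> g y"
      using gh[OF closed(2)[OF gc gc], OF xy] h'(3)[OF gc gc, OF xy] hg xy by simp
  next
    show "g \<one>\<^bsub>R\<^esub> = \<one>\<^bsub>L\<^esub>" using gh[OF one] h'(4) by simp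
  qed
  then show ?thesis by (rule is_ring_isoI)
qed

definition triangular3 :: "('a, 'm) ring_scheme \<Rightarrow> 'a \<Rightarrow> 'a \<Rightarrow> 'a \<Rightarrow> 'a mat" where
  "triangular3 F a b c = mat_of_rows_list 3
     [[a, b, c], [\<zero>\<^bsub>F\<^esub>, a, \<zero>\<^bsub>F\<^esub>], [\<zero>\<^bsub>F\<^esub>, \<zero>\<^bsub>F\<^esub>, a]]"

lemma triangular3_dim [simp]:
  "dim_row (triangular3 F a b c) = 3" "dim_col (triangular3 F a b c) = 3"
  by (simp_all add: triangular3_def mat_of_rows_list_def)

lemma triangular3_index:
  "triangular3 F a b c $$ (0, 0) = a" "triangular3 F a b c $$ (0, Suc 0) = b"
  "triangular3 F a b c $$ (0, 2) = c" "triangular3 F a b c $$ (Suc 0, 0) = \<zero>\<^bsub>F\<^esub>"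
  "triangular3 F a b c $$ (Suc 0, Suc 0) = a" "triangular3 F a b c $$ (Suc 0, 2) = \<zero>\<^bsub>F\<^esub>"
  "triangular3 F a b c $$ (2, 0) = \<zero>\<^bsub>F\<^esub>" "triangular3 F a b c $$ (2, Suc 0) = \<zero>\<^bsub>F\<^esub>"
  "triangular3 F a b c $$ (2, 2) = a"
  by (simp_all add: triangular3_def mat_of_rows_list_def)

lemma less_3_cases: "(i::nat) < 3 \<longleftrightarrow> i = 0 \<or> i = Suc 0 \<or> i = 2"
  by auto

lemma local_matrix_ring_carrier:
  "carrier (local_matrix_ring F) = {triangular3 F a b c | a b c. a \<in> carrier F \<and> b \<in> carrier F \<and> c \<in> carrier F}"
  by (simp add: local_matrix_ring_def triangular3_def)

lemma (in abelian_monoid) finsum_lessThan_3: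
  assumes "\<And>i. i < 3 \<Longrightarrow> f i \<in> carrier G"
  shows "(\<Oplus>i\<in>{..<3::nat}. f i) = f 0 \<oplus> f (Suc 0) \<oplus> f 2"
proof -
  have "{..<3::nat} = insert 2 (insert (Suc 0) {0})" by auto
  then show ?thesis using assms[of 0] assms[of "Suc 0"] assms[of 2]
    by (simp add: a_ac)
qed

lemma (in cring) local_matrix_ring_mult:
  assumes "a \<in> carrier R" "b \<in> carrier R" "c \<in> carrier R" "a' \<in> carrier R" "b' \<in> carrier R" "c' \<in> carrier R"
  shows "triangular3 R a b c \<otimes>\<^bsub>local_matrix_ring R\<^esub> triangular3 R a' b' c' =
    triangular3 R (a \<otimes> a') (a \<otimes> b' \<oplus> b \<otimes> a') (a \<otimes> c' \<oplus> c \<otimes> a')" (is "?L = ?T")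
proof (rule eq_matI)
  fix i j assume ij: "i < dim_row ?T" "j < dim_col ?T"
  have z: "triangular3 R a b c $$ (i, k) \<otimes> triangular3 R a' b' c' $$ (k, j) \<in> carrier R"
    if "k < 3" for k
    using ij that assms by (auto simp: less_3_cases triangular3_index)
  have "?L $$ (i, j) = (\<Oplus>k\<in>{..<3}. triangular3 R a b c $$ (i, k) \<otimes> triangular3 R a' b' c' $$ (k, j))"
    using ij by (simp add: local_matrix_ring_def matrix_ring_def)
  also have "\<dots> = triangular3 R a b c $$ (i, 0) \<otimes> triangular3 R a' b' c' $$ (0, j)
      \<oplus> triangular3 R a b c $$ (i, Suc 0) \<otimes> triangular3 R a' b' c' $$ (Suc 0, j)
      \<oplus> triangular3 R a b c $$ (i, 2) \<otimes> triangular3 R a' b' c' $$ (2, j)"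
    by (rule finsum_lessThan_3[OF z])
  also have "\<dots> = ?T $$ (i, j)"
    using ij assms by (auto simp: less_3_cases triangular3_index)
  finally show "?L $$ (i, j) = ?T $$ (i, j)" .
qed (simp_all add: local_matrix_ring_def matrix_ring_def)

lemma (in cring) local_matrix_ring_add:
  assumes "a \<in> carrier R" "b \<in> carrier R" "c \<in> carrier R" "a' \<in> carrier R" "b' \<in> carrier R" "c' \<in> carrier R"
  shows "triangular3 R a b c \<oplus>\<^bsub>local_matrix_ring R\<^esub> triangular3 R a' b' c' =
    triangular3 R (a \<oplus> a') (b \<oplus> b') (c \<oplus> c')" (is "?L = ?T")
proof (rule eq_matI)
  fix i j assume ij: "i < dim_row ?T" "j < dim_col ?T"
  then show "?L $$ (i, j) = ?T $$ (i, j)"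
    using assms by (auto simp: local_matrix_ring_def matrix_ring_def less_3_cases triangular3_index)
qed (simp_all add: local_matrix_ring_def matrix_ring_def)

lemma (in cring) local_matrix_ring_one: "\<one>\<^bsub>local_matrix_ring R\<^esub> = triangular3 R \<one> \<zero> \<zero>"
proof (rule eq_matI)
  fix i j assume "i < dim_row (triangular3 R \<one> \<zero> \<zero>)" "j < dim_col (triangular3 R \<one> \<zero> \<zero>)"
  then show "\<one>\<^bsub>local_matrix_ring R\<^esub> $$ (i, j) = triangular3 R \<one> \<zero> \<zero> $$ (i, j)"
    by (auto simp: local_matrix_ring_def matrix_ring_def less_3_cases triangular3_index)
qed (simp_all add: local_matrix_ring_def matrix_ring_def)

text \<open>The coefficients are those of \<open>local_matrix_ring_mult\<close>: the matrices model
  triples in which \<open>v\<close> and \<open>w\<close> span an ideal of square zero.\<close>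

lemma (in cring) square_zero_product:
  assumes c: "a \<in> carrier R" "b \<in> carrier R" "c \<in> carrier R" "a' \<in> carrier R" "b' \<in> carrier R" "c' \<in> carrier R"
    and v: "v \<in> carrier R" "w \<in> carrier R" and vw: "v \<otimes> v = \<zero>" "v \<otimes> w = \<zero>" "w \<otimes> w = \<zero>"
  shows "(a \<oplus> b \<otimes> v \<oplus> c \<otimes> w) \<otimes> (a' \<oplus> b' \<otimes> v \<oplus> c' \<otimes> w) =
    a \<otimes> a' \<oplus> (a \<otimes> b' \<oplus> b \<otimes> a') \<otimes> v \<oplus> (a \<otimes> c' \<oplus> c \<otimes> a') \<otimes> w"
proof -
  define j where "j = b \<otimes> v \<oplus> c \<otimes> w"
  define j' where "j' = b' \<otimes> v \<oplus> c' \<otimes> w"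
  have jc: "j \<in> carrier R" "j' \<in> carrier R" using c v by (simp_all add: j_def j'_def)
  have "v \<otimes> j' = b' \<otimes> (v \<otimes> v) \<oplus> c' \<otimes> (v \<otimes> w)" unfolding j'_def using c v by algebra
  then have vj: "v \<otimes> j' = \<zero>" unfolding vw using c by simp
  have "w \<otimes> j' = b' \<otimes> (v \<otimes> w) \<oplus> c' \<otimes> (w \<otimes> w)" unfolding j'_def using c v by algebra
  then have wj: "w \<otimes> j' = \<zero>" unfolding vw using c by simp
  have "j \<otimes> j' = b \<otimes> (v \<otimes> j') \<oplus> c \<otimes> (w \<otimes> j')" unfolding j_def using c v jc by algebra
  then have jj: "j \<otimes> j' = \<zero>" unfolding vj wj using c by simp
  have "(a \<oplus> j) \<otimes> (a' \<oplus> j') = a \<otimes> a' \<oplus> a \<otimes> j' \<oplus> j \<otimes> a' \<oplus> j \<otimes> j'" using c jc by algebra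
  also have "\<dots> = a \<otimes> a' \<oplus> (a \<otimes> j' \<oplus> j \<otimes> a')" unfolding jj using c jc by (simp add: a_assoc)
  also have "a \<otimes> j' \<oplus> j \<otimes> a' = (a \<otimes> b' \<oplus> b \<otimes> a') \<otimes> v \<oplus> (a \<otimes> c' \<oplus> c \<otimes> a') \<otimes> w"
    unfolding j_def j'_def using c v by algebra
  finally show ?thesis unfolding j_def j'_def using c v by (simp add: a_assoc)
qed

lemma (in cring) is_local_matrix_ring:
  fixes F :: "('f, 'g) ring_scheme"
  assumes F: "cring F" and h: "h \<in> Ring.ring_hom F R" "inj_on h (carrier F)"
    and v: "v \<in> carrier R" "w \<in> carrier R" and vw: "v \<otimes> v = \<zero>" "v \<otimes> w = \<zero>" "w \<otimes> w = \<zero>"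
    and span: "\<And>x. x \<in> carrier R \<Longrightarrow>
      \<exists>a\<in>carrier F. \<exists>b\<in>carrier F. \<exists>c\<in>carrier F. x = h a \<oplus> h b \<otimes> v \<oplus> h c \<otimes> w"
    and indep: "\<And>a b c. a \<in> carrier F \<Longrightarrow> b \<in> carrier F \<Longrightarrow> c \<in> carrier F \<Longrightarrow>
      h a \<oplus> h b \<otimes> v \<oplus> h c \<otimes> w = \<zero> \<Longrightarrow> h a = \<zero> \<and> h b = \<zero> \<and> h c = \<zero>"
  shows "R \<simeq> local_matrix_ring F"
proof -
  interpret F: cring F by fact
  note h' = ring_hom_memE[OF h(1)]
  have h0: "h \<zero>\<^bsub>F\<^esub> = \<zero>" by (rule ring_hom_zero[OF h(1) F.ring_axioms ring_axioms])
  have hinj: "a = \<zero>\<^bsub>F\<^esub>" if "h a = \<zero>" "a \<in> carrier F" for a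
    using h(2) that h0 F.zero_closed by (metis inj_onD)
  \<comment> \<open>A matrix of this shape is determined by its first row, from which
    \<open>H\<close> reads the coefficients of \<open>\<one>\<close>, \<open>v\<close> and
    \<open>w\<close>.\<close>
  define H where "H A = h (A $$ (0, 0)) \<oplus> h (A $$ (0, Suc 0)) \<otimes> v \<oplus> h (A $$ (0, 2)) \<otimes> w" for A
  have HT: "H (triangular3 F a b c) = h a \<oplus> h b \<otimes> v \<oplus> h c \<otimes> w" for a b c
    by (simp add: H_def triangular3_index)
  have L: "triangular3 F a b c \<in> carrier (local_matrix_ring F)"
    if "a \<in> carrier F" "b \<in> carrier F" "c \<in> carrier F" for a b c
    using that by (auto simp: local_matrix_ring_carrier)
  have LE: "\<exists>a b c. A = triangular3 F a b c \<and> a \<in> carrier F \<and> b \<in> carrier F \<and> c \<in> carrier F"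
    if "A \<in> carrier (local_matrix_ring F)" for A
    using that by (auto simp: local_matrix_ring_carrier)
  have iso: "H \<in> ring_iso (local_matrix_ring F) R"
  proof (rule ring_iso_memI)
    fix A assume "A \<in> carrier (local_matrix_ring F)"
    then show "H A \<in> carrier R" using LE[of A] h' v by (auto simp: HT)
  next
    fix A B assume AB: "A \<in> carrier (local_matrix_ring F)" "B \<in> carrier (local_matrix_ring F)"
    obtain a b c where A: "A = triangular3 F a b c" "a \<in> carrier F" "b \<in> carrier F" "c \<in> carrier F"
      using LE[OF AB(1)] by (elim exE conjE) (rule that; assumption)
    obtain a' b' c' where B: "B = triangular3 F a' b' c'" "a' \<in> carrier F" "b' \<in> carrier F" "c' \<in> carrier F"
      using LE[OF AB(2)] by (elim exE conjE) (rule that; assumption)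
    have hc: "h a \<in> carrier R" "h b \<in> carrier R" "h c \<in> carrier R"
      "h a' \<in> carrier R" "h b' \<in> carrier R" "h c' \<in> carrier R" using A B h' by simp_all
    have "H (A \<otimes>\<^bsub>local_matrix_ring F\<^esub> B) = h a \<otimes> h a' \<oplus> (h a \<otimes> h b' \<oplus> h b \<otimes> h a') \<otimes> v \<oplus> (h a \<otimes> h c' \<oplus> h c \<otimes> h a') \<otimes> w"
      unfolding A(1) B(1) using A B by (simp add: F.local_matrix_ring_mult HT h')
    also have "\<dots> = H A \<otimes> H B"
      unfolding A(1) B(1) HT by (rule square_zero_product[symmetric, OF hc v vw])
    finally show "H (A \<otimes>\<^bsub>local_matrix_ring F\<^esub> B) = H A \<otimes> H B" .
    have "H (A \<oplus>\<^bsub>local_matrix_ring F\<^esub> B) = (h a \<oplus> h a') \<oplus> (h b \<oplus> h b') \<otimes> v \<oplus> (h c \<oplus> h c') \<otimes> w"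
      unfolding A(1) B(1) using A B by (simp add: F.local_matrix_ring_add HT h')
    also have "\<dots> = H A \<oplus> H B" unfolding A(1) B(1) HT using hc v by (simp add: l_distr a_ac)
    finally show "H (A \<oplus>\<^bsub>local_matrix_ring F\<^esub> B) = H A \<oplus> H B" .
  next
    show "H \<one>\<^bsub>local_matrix_ring F\<^esub> = \<one>"
      unfolding F.local_matrix_ring_one HT h0 h'(4) using v by simp
    show "bij_betw H (carrier (local_matrix_ring F)) (carrier R)"
      unfolding bij_betw_def
    proof (intro conjI equalityI subsetI)
      show "inj_on H (carrier (local_matrix_ring F))"
      proof (rule inj_onI)
        fix A B assume AB: "A \<in> carrier (local_matrix_ring F)" "B \<in> carrier (local_matrix_ring F)" and eq: "H A = H B"
        obtain a b c where A: "A = triangular3 F a b c" "a \<in> carrier F" "b \<in> carrier F" "c \<in> carrier F"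
          using LE[OF AB(1)] by (elim exE conjE) (rule that; assumption)
        obtain a' b' c' where B: "B = triangular3 F a' b' c'" "a' \<in> carrier F" "b' \<in> carrier F" "c' \<in> carrier F"
          using LE[OF AB(2)] by (elim exE conjE) (rule that; assumption)
        have hc: "h a \<in> carrier R" "h b \<in> carrier R" "h c \<in> carrier R"
          "h a' \<in> carrier R" "h b' \<in> carrier R" "h c' \<in> carrier R" using A B h' by simp_all
        have hm: "h (x \<ominus>\<^bsub>F\<^esub> y) = h x \<ominus> h y" if xy: "x \<in> carrier F" "y \<in> carrier F" for x y
        proof -
          have "h x = h ((x \<ominus>\<^bsub>F\<^esub> y) \<oplus>\<^bsub>F\<^esub> y)" using xy by (intro arg_cong[of _ _ h]) algebra
          also have "\<dots> = h (x \<ominus>\<^bsub>F\<^esub> y) \<oplus> h y" using xy h'(3) by simp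
          finally have e: "h x = h (x \<ominus>\<^bsub>F\<^esub> y) \<oplus> h y" .
          have "h (x \<ominus>\<^bsub>F\<^esub> y) \<in> carrier R" "h y \<in> carrier R" using xy h'(1) by simp_all
          then show ?thesis unfolding e by algebra
        qed
        have "h (a \<ominus>\<^bsub>F\<^esub> a') \<oplus> h (b \<ominus>\<^bsub>F\<^esub> b') \<otimes> v \<oplus> h (c \<ominus>\<^bsub>F\<^esub> c') \<otimes> w = H A \<ominus> H B"
          unfolding A(1) B(1) HT hm[OF A(2) B(2)] hm[OF A(3) B(3)] hm[OF A(4) B(4)] using hc v
          by (simp add: a_minus_def l_distr minus_add l_minus a_ac)
        also have "\<dots> = \<zero>"
          unfolding eq unfolding B(1) HT using hc v by (simp add: r_neg a_minus_def)
        finally have z: "h (a \<ominus>\<^bsub>F\<^esub> a') = \<zero> \<and> h (b \<ominus>\<^bsub>F\<^esub> b') = \<zero> \<and> h (c \<ominus>\<^bsub>F\<^esub> c') = \<zero>"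
          using A B by (intro indep) simp_all
        have "a \<ominus>\<^bsub>F\<^esub> a' = \<zero>\<^bsub>F\<^esub>" by (rule hinj[OF conjunct1[OF z] F.minus_closed[OF A(2) B(2)]])
        moreover have "b \<ominus>\<^bsub>F\<^esub> b' = \<zero>\<^bsub>F\<^esub>"
          by (rule hinj[OF conjunct1[OF conjunct2[OF z]] F.minus_closed[OF A(3) B(3)]])
        moreover have "c \<ominus>\<^bsub>F\<^esub> c' = \<zero>\<^bsub>F\<^esub>"
          by (rule hinj[OF conjunct2[OF conjunct2[OF z]] F.minus_closed[OF A(4) B(4)]])
        ultimately have "a = a'" "b = b'" "c = c'" using A B by simp_all
        then show "A = B" using A B by simp
      qed
      fix x
      show "x \<in> H ` carrier (local_matrix_ring F)" if x: "x \<in> carrier R"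
      proof -
        obtain a b c where abc: "a \<in> carrier F" "b \<in> carrier F" "c \<in> carrier F" "x = h a \<oplus> h b \<otimes> v \<oplus> h c \<otimes> w"
          using span[OF x] by (elim bexE) (rule that; assumption)
        show ?thesis unfolding abc(4) HT[symmetric] by (rule imageI[OF L[OF abc(1-3)]])
      qed
      show "x \<in> carrier R" if x: "x \<in> H ` carrier (local_matrix_ring F)"
      proof -
        obtain A where A: "A \<in> carrier (local_matrix_ring F)" "x = H A" using x by (elim imageE) (rule that; assumption)
        then show ?thesis using LE[OF A(1)] h' v by (auto simp: HT)
      qed
    qed
  qed
  show ?thesis
  proof (rule is_ring_iso_inverseI[OF iso])
    show "\<one>\<^bsub>local_matrix_ring F\<^esub> \<in> carrier (local_matrix_ring F)"
      unfolding F.local_matrix_ring_one by (intro L) simp_all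
    fix A B assume AB: "A \<in> carrier (local_matrix_ring F)" "B \<in> carrier (local_matrix_ring F)"
    obtain a b c where A: "A = triangular3 F a b c" "a \<in> carrier F" "b \<in> carrier F" "c \<in> carrier F"
      using LE[OF AB(1)] by (elim exE conjE) (rule that; assumption)
    obtain a' b' c' where B: "B = triangular3 F a' b' c'" "a' \<in> carrier F" "b' \<in> carrier F" "c' \<in> carrier F"
      using LE[OF AB(2)] by (elim exE conjE) (rule that; assumption)
    show "A \<otimes>\<^bsub>local_matrix_ring F\<^esub> B \<in> carrier (local_matrix_ring F)"
      unfolding A(1) B(1) F.local_matrix_ring_mult[OF A(2-4) B(2-4)] using A B by (intro L) simp_all
    show "A \<oplus>\<^bsub>local_matrix_ring F\<^esub> B \<in> carrier (local_matrix_ring F)"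
      unfolding A(1) B(1) F.local_matrix_ring_add[OF A(2-4) B(2-4)] using A B by (intro L) simp_all
  qed
qed

theorem (in frobenius_ring) nil_nonzero_imp_local_matrix_ring:
  assumes "nil \<noteq> {\<zero>}"
  shows "\<exists>F :: nat ring. field F \<and> finite (carrier F) \<and> R \<simeq> local_matrix_ring F"
proof -
  define K where "K = R\<lparr>carrier := sep, one := \<one>\<rparr>"
  have Kf: "field K"
    unfolding K_def
  proof (rule corner_field[OF sep_subring one_sep])
    show "\<one> \<noteq> \<zero>" by (rule nontrivial)
    show "\<one> \<otimes> x = x" if "x \<in> sep" for x using sepD(1)[OF that] by simp
    show "\<exists>y\<in>sep. x \<otimes> y = \<one>" if "x \<in> sep" "x \<noteq> \<zero>" for x
      using sep_unit[OF assms that] sep_pow[OF that(1)] by blast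
  qed
  have Kfin: "finite (carrier K)"
    unfolding K_def using finite_subset[OF nonunital_subringD(1)[OF sep_subring] finite_carrier] by simp
  obtain F :: "nat ring" where F: "field F" "finite (carrier F)" "K \<simeq> F" by (rule field_nat_copy[OF Kf Kfin])
  interpret F: field F by fact
  have "F \<simeq> K" using ring_iso_sym[OF _ F(3)] Kf by (simp add: field.is_ring)
  then obtain h where "h \<in> ring_iso F K" unfolding is_ring_iso_def by blast
  note h = ring_iso_memE[OF this]
  have hs: "h a \<in> sep" if "a \<in> carrier F" for a using h(1)[OF that] by (simp add: K_def)
  have hr: "h \<in> Ring.ring_hom F R"
    by (rule ring_hom_memI) (use h hs sepD(1) in \<open>simp_all add: K_def\<close>)
  have inj: "inj_on h (carrier F)" by (rule bij_betw_imp_inj_on[OF h(5)])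
  have surj: "\<exists>a\<in>carrier F. h a = s" if "s \<in> sep" for s
  proof -
    have "s \<in> h ` carrier F" using bij_betw_imp_surj_on[OF h(5)] that by (simp add: K_def)
    then show ?thesis by (elim imageE) (rule bexI, rule sym)
  qed
  obtain v w where v: "v \<in> nil" "w \<in> nil"
    and sp: "\<And>x. x \<in> nil \<Longrightarrow> \<exists>s\<in>sep. \<exists>t\<in>sep. x = s \<otimes> v \<oplus> t \<otimes> w"
    and ind: "\<And>s t. s \<in> sep \<Longrightarrow> t \<in> sep \<Longrightarrow> s \<otimes> v \<oplus> t \<otimes> w = \<zero> \<Longrightarrow> s = \<zero> \<and> t = \<zero>"
    using nil_basis[OF assms] by metis
  have vc: "v \<in> carrier R" "w \<in> carrier R" using v nilD(1) by simp_all
  have "R \<simeq> local_matrix_ring F"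
  proof (rule is_local_matrix_ring[OF F.is_cring hr inj vc])
    show "v \<otimes> v = \<zero>" "v \<otimes> w = \<zero>" "w \<otimes> w = \<zero>" using nil_square_zero v by simp_all
    fix x assume x: "x \<in> carrier R"
    obtain s j where s: "s \<in> sep" "j \<in> nil" "x = s \<oplus> j" using sep_nil_decomp[OF x] .
    obtain t u where t: "t \<in> sep" "u \<in> sep" "j = t \<otimes> v \<oplus> u \<otimes> w" using sp[OF s(2)] by (elim bexE) (rule that)
    obtain a where a: "a \<in> carrier F" "h a = s" using surj[OF s(1)] by (elim bexE) (rule that)
    obtain b where b: "b \<in> carrier F" "h b = t" using surj[OF t(1)] by (elim bexE) (rule that)
    obtain c where c: "c \<in> carrier F" "h c = u" using surj[OF t(2)] by (elim bexE) (rule that)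
    have "x = h a \<oplus> h b \<otimes> v \<oplus> h c \<otimes> w"
      unfolding s(3) t(3) a(2) b(2) c(2) using sepD(1)[OF s(1)] sepD(1)[OF t(1)] sepD(1)[OF t(2)] vc
      by (simp add: a_assoc)
    then show "\<exists>a\<in>carrier F. \<exists>b\<in>carrier F. \<exists>c\<in>carrier F. x = h a \<oplus> h b \<otimes> v \<oplus> h c \<otimes> w"
      using a(1) b(1) c(1) by (intro bexI)
  next
    fix a b c assume abc: "a \<in> carrier F" "b \<in> carrier F" "c \<in> carrier F"
      and z: "h a \<oplus> h b \<otimes> v \<oplus> h c \<otimes> w = \<zero>"
    have hc: "h a \<in> carrier R" "h b \<in> carrier R" "h c \<in> carrier R" using abc hs sepD(1) by simp_all
    define j where "j = h b \<otimes> v \<oplus> h c \<otimes> w"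
    have j: "j \<in> nil" unfolding j_def
      by (rule nil_closed(2)[OF nil_closed(5)[OF v(1) hc(2)] nil_closed(5)[OF v(2) hc(3)]])
    \<comment> \<open>This equals \<open>\<ominus> j\<close>, so \<open>h a\<close> lies both in
      \<open>sep\<close> and in \<open>nil\<close>.\<close>
    have "h a = (h a \<oplus> h b \<otimes> v \<oplus> h c \<otimes> w) \<oplus> (\<zero> \<ominus> j)" unfolding j_def using hc vc by algebra
    then have "h a = \<zero> \<ominus> j" unfolding z using nilD(1)[OF j] by simp
    then have "h a \<in> nil" using nil_closed(4)[OF nil_closed(1) j] by simp
    then have a0: "h a = \<zero>" by (rule sep_nil_zero[OF hs[OF abc(1)]])
    then have "h b \<otimes> v \<oplus> h c \<otimes> w = \<zero>" using z hc vc by simp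
    then show "h a = \<zero> \<and> h b = \<zero> \<and> h c = \<zero>" using ind[OF hs hs, OF abc(2,3)] a0 by simp
  qed
  then show ?thesis using F by blast
qed

section \<open>Polynomials over finite fields\<close>

text \<open>Evaluation of a polynomial over \<open>k\<close> in a \<open>k\<close>-algebra with
  structure map \<open>\<iota>\<close>. One polynomial ring over the prime field then serves
  \<open>R\<close> and all its factors.\<close>

definition peval :: "('a, 'm) ring_scheme \<Rightarrow> ('c \<Rightarrow> 'a) \<Rightarrow> 'c list \<Rightarrow> 'a \<Rightarrow> 'a" where
  "peval A \<iota> f x = ring.eval A (map \<iota> f) x"

lemma (in ring) poly_ring_set: "f \<in> carrier (poly_ring R) \<Longrightarrow> set f \<subseteq> carrier R"
  using polynomial_incl univ_poly_carrier by blast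

lemma peval_hom:
  assumes k: "field k" and A: "cring A" and \<iota>: "\<iota> \<in> Ring.ring_hom k A" and x: "x \<in> carrier A"
  shows "ring_hom_ring (poly_ring k) A (\<lambda>f. peval A \<iota> f x)"
proof -
  interpret k: field k by fact
  interpret A: cring A by fact
  have h: "ring_hom_ring k A \<iota>" by (rule ring_hom_ringI2[OF k.ring_axioms A.ring_axioms \<iota>])
  have st: "set (map \<iota> f) \<subseteq> carrier A" if "set f \<subseteq> carrier k" for f
    using that ring_hom_closed[OF \<iota>] by auto
  have cl: "set (map \<iota> f) \<subseteq> carrier A" if "f \<in> carrier (poly_ring k)" for f
    by (rule st[OF k.poly_ring_set[OF that]])
  show ?thesis
  proof (rule ring_hom_ringI2[OF k.univ_poly_is_ring[OF k.carrier_is_subring] A.ring_axioms], rule ring_hom_memI)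
    fix f assume f: "f \<in> carrier (poly_ring k)"
    show "peval A \<iota> f x \<in> carrier A" unfolding peval_def by (rule A.eval_in_carrier[OF cl[OF f] x])
    fix g assume g: "g \<in> carrier (poly_ring k)"
    note fs = k.poly_ring_set[OF f] and gs = k.poly_ring_set[OF g]
    \<comment> \<open>\<open>map \<iota>\<close> may create leading zeros, so the image list need
      not be a polynomial; normalizing does not change its value.\<close>
    have "A.eval (map \<iota> (k.poly_mult f g)) x = A.eval (A.normalize (map \<iota> (k.poly_mult f g))) x"
      by (rule A.eval_normalize[OF st[OF k.poly_mult_in_carrier[OF fs gs]] x, symmetric])
    also have "\<dots> = A.eval (A.poly_mult (map \<iota> f) (map \<iota> g)) x"
      unfolding ring_hom_ring.poly_mult_hom'[OF h fs gs] by (rule refl)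
    also have "\<dots> = A.eval (map \<iota> f) x \<otimes>\<^bsub>A\<^esub> A.eval (map \<iota> g) x"
      by (rule A.eval_poly_mult[OF cl[OF f] cl[OF g] x])
    finally show "peval A \<iota> (f \<otimes>\<^bsub>poly_ring k\<^esub> g) x = peval A \<iota> f x \<otimes>\<^bsub>A\<^esub> peval A \<iota> g x"
      unfolding peval_def univ_poly_mult .
    have "A.eval (map \<iota> (k.poly_add f g)) x = A.eval (A.normalize (map \<iota> (k.poly_add f g))) x"
      by (rule A.eval_normalize[OF st[OF k.poly_add_in_carrier[OF fs gs]] x, symmetric])
    also have "\<dots> = A.eval (A.poly_add (map \<iota> f) (map \<iota> g)) x"
      unfolding ring_hom_ring.poly_add_hom'[OF h fs gs] by (rule refl)
    also have "\<dots> = A.eval (map \<iota> f) x \<oplus>\<^bsub>A\<^esub> A.eval (map \<iota> g) x"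
      by (rule A.eval_poly_add[OF cl[OF f] cl[OF g] x])
    finally show "peval A \<iota> (f \<oplus>\<^bsub>poly_ring k\<^esub> g) x = peval A \<iota> f x \<oplus>\<^bsub>A\<^esub> peval A \<iota> g x"
      unfolding peval_def univ_poly_add .
  next
    show "peval A \<iota> \<one>\<^bsub>poly_ring k\<^esub> x = \<one>\<^bsub>A\<^esub>"
      unfolding peval_def univ_poly_one using ring_hom_one[OF \<iota>] x by simp
  qed
qed

lemma peval_X:
  assumes k: "field k" and A: "cring A" and \<iota>: "\<iota> \<in> Ring.ring_hom k A" and x: "x \<in> carrier A"
  shows "peval A \<iota> X\<^bsub>k\<^esub> x = x"
proof -
  interpret k: field k by fact
  interpret A: cring A by fact
  show ?thesis
    unfolding peval_def var_def
    using ring_hom_one[OF \<iota>] ring_hom_zero[OF \<iota> k.ring_axioms A.ring_axioms] x by simp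
qed

lemma peval_comp:
  assumes k: "field k" and h: "ring_hom_ring A B \<theta>" and \<iota>: "\<iota> \<in> Ring.ring_hom k A"
    and x: "x \<in> carrier A" and f: "f \<in> carrier (poly_ring k)"
  shows "\<theta> (peval A \<iota> f x) = peval B (\<theta> \<circ> \<iota>) f (\<theta> x)"
proof -
  interpret k: field k by fact
  have "set (map \<iota> f) \<subseteq> carrier A"
    using k.poly_ring_set[OF f] ring_hom_closed[OF \<iota>] by auto
  then show ?thesis unfolding peval_def using ring_hom_ring.eval_hom'[OF h x] by simp
qed

text \<open>Lists of length exactly \<open>n\<close> correspond to these polynomials by stripping
  leading zeros, with padding as inverse.\<close>

lemma (in field) card_poly_bounded_length:
  "card {f \<in> carrier (poly_ring R). length f \<le> n} = card (carrier R) ^ n" if fin: "finite (carrier R)"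
proof -
  have "bij_betw normalize {l. set l \<subseteq> carrier R \<and> length l = n} {f \<in> carrier (poly_ring R). length f \<le> n}"
    unfolding bij_betw_def
  proof (intro conjI equalityI subsetI)
    show "inj_on normalize {l. set l \<subseteq> carrier R \<and> length l = n}"
    proof (rule inj_onI)
      fix l m assume lm: "l \<in> {l. set l \<subseteq> carrier R \<and> length l = n}" "m \<in> {l. set l \<subseteq> carrier R \<and> length l = n}"
        "normalize l = normalize m"
      have dec: "l = replicate (n - length (normalize l)) \<zero> @ normalize l" if "length l = n" for l
        using normalize_def'[of l] that by metis
      show "l = m" using dec[of l] dec[of m] lm by simp
    qed
  next
    fix f assume "f \<in> normalize ` {l. set l \<subseteq> carrier R \<and> length l = n}"
    then obtain l where l: "set l \<subseteq> carrier R" "length l = n" "f = normalize l" by auto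
    then show "f \<in> {f \<in> carrier (poly_ring R). length f \<le> n}"
      using normalize_gives_polynomial[OF l(1)] normalize_length_le[of l] univ_poly_carrier[of R "carrier R" f] by simp
  next
    fix f assume f: "f \<in> {f \<in> carrier (poly_ring R). length f \<le> n}"
    then have fs: "set f \<subseteq> carrier R" and fp: "polynomial (carrier R) f"
      using poly_ring_set univ_poly_carrier[of R "carrier R" f] by auto
    have a: "normalize (replicate (n - length f) \<zero> @ f) = f"
      using normalize_replicate_zero normalize_polynomial[OF fp] by simp
    have b: "replicate (n - length f) \<zero> @ f \<in> {l. set l \<subseteq> carrier R \<and> length l = n}"
      using fs f by auto
    show "f \<in> normalize ` {l. set l \<subseteq> carrier R \<and> length l = n}"
      using imageI[OF b, of normalize] unfolding a .
  qed
  then have "card {f \<in> carrier (poly_ring R). length f \<le> n} = card {l. set l \<subseteq> carrier R \<and> length l = n}"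
    by (rule bij_betw_same_card[symmetric])
  then show ?thesis using card_lists_length_eq[OF fin] by simp
qed

text \<open>Remainders modulo \<open>g\<close> represent the values of \<open>h\<close>
  uniquely.\<close>

lemma (in field) card_image_poly_ring:
  assumes fin: "finite (carrier R)" and h: "ring_hom_ring (poly_ring R) A h"
    and g: "g \<in> carrier (poly_ring R)" "degree g > 0"
    and ker: "\<And>f. f \<in> carrier (poly_ring R) \<Longrightarrow> h f = \<zero>\<^bsub>A\<^esub> \<longleftrightarrow> g pdivides f"
  shows "card (h ` carrier (poly_ring R)) = card (carrier R) ^ degree g"
proof -
  interpret P: domain "poly_ring R" by (rule univ_poly_is_domain[OF carrier_is_subring])
  interpret h: ring_hom_ring "poly_ring R" A h by fact
  \<comment> \<open>Length is degree plus one except for the zero polynomial \<open>[]\<close>, so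
    \<open>length f \<le> degree g\<close> describes exactly the remainders modulo \<open>g\<close>,
    zero included.\<close>
  define B where "B = {f \<in> carrier (poly_ring R). length f \<le> degree g}"
  note sf = carrier_is_subfield
  have pm: "f pmod g = f" if "f \<in> B" for f
  proof (rule pmod_const(2)[OF sf _ g(1)])
    show "f \<in> carrier (poly_ring R)" using that by (simp add: B_def)
    have "length f \<le> degree g" using that by (simp add: B_def)
    then show "degree f < degree g" using g(2) by linarith
  qed
  have "inj_on h B"
  proof (rule inj_onI)
    fix a b assume ab: "a \<in> B" "b \<in> B" "h a = h b"
    have c: "a \<in> carrier (poly_ring R)" "b \<in> carrier (poly_ring R)" using ab by (simp_all add: B_def)
    have e: "a = (a \<ominus>\<^bsub>poly_ring R\<^esub> b) \<oplus>\<^bsub>poly_ring R\<^esub> b"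
      by (simp add: a_minus_def P.a_assoc c P.l_neg)
    have hc: "h (a \<ominus>\<^bsub>poly_ring R\<^esub> b) \<in> carrier A" "h b \<in> carrier A"
      by (rule h.hom_closed[OF P.minus_closed[OF c]], rule h.hom_closed[OF c(2)])
    have "h (a \<ominus>\<^bsub>poly_ring R\<^esub> b) \<oplus>\<^bsub>A\<^esub> h b = \<zero>\<^bsub>A\<^esub> \<oplus>\<^bsub>A\<^esub> h b"
      using h.hom_add[OF P.minus_closed[OF c] c(2)] e[symmetric] ab(3) hc by simp
    then have "h (a \<ominus>\<^bsub>poly_ring R\<^esub> b) = \<zero>\<^bsub>A\<^esub>"
      using h.S.add.right_cancel[OF hc(2) hc(1) h.S.zero_closed] by simp
    then have "g pdivides (a \<ominus>\<^bsub>poly_ring R\<^esub> b)" using ker[OF P.minus_closed[OF c]] by simp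
    then have "a pmod g = b pmod g" using same_pmod_iff_pdivides[OF sf c g(1)] by simp
    then show "a = b" using pm ab by simp
  qed
  moreover have "h ` carrier (poly_ring R) = h ` B"
  proof (intro equalityI subsetI)
    fix y assume "y \<in> h ` carrier (poly_ring R)"
    then obtain f where f: "f \<in> carrier (poly_ring R)" "y = h f" by (elim imageE) (rule that; assumption)
    have cl: "f pdiv g \<in> carrier (poly_ring R)" "f pmod g \<in> carrier (poly_ring R)"
      by (rule long_division_closed[OF sf f(1) g(1)])+
    have "g pdivides g" unfolding pdivides_def using g(1) P.divides_refl by simp
    then have hg: "h g = \<zero>\<^bsub>A\<^esub>" using ker[OF g(1)] by simp
    have "h f = h ((g \<otimes>\<^bsub>poly_ring R\<^esub> (f pdiv g)) \<oplus>\<^bsub>poly_ring R\<^esub> (f pmod g))"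
      using pdiv_pmod[OF sf f(1) g(1)] by simp
    also have "\<dots> = h g \<otimes>\<^bsub>A\<^esub> h (f pdiv g) \<oplus>\<^bsub>A\<^esub> h (f pmod g)"
      using h.hom_add[OF P.m_closed[OF g(1) cl(1)] cl(2)] h.hom_mult[OF g(1) cl(1)] by simp
    also have "\<dots> = h (f pmod g)"
      unfolding hg using h.hom_closed[OF cl(1)] h.hom_closed[OF cl(2)] by simp
    finally have "y = h (f pmod g)" using f(2) by simp
    moreover have "f pmod g \<in> B"
    proof -
      have gne: "g \<noteq> []" using g(2) by auto
      show ?thesis
        unfolding B_def pmod_image_characterization[OF sf g(1) gne, symmetric] by (rule imageI[OF f(1)])
    qed
    ultimately show "y \<in> h ` B" by (rule image_eqI)
  qed (auto simp: B_def)
  moreover have "card B = card (carrier R) ^ degree g"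
    unfolding B_def by (rule card_poly_bounded_length[OF fin])
  ultimately show ?thesis by (simp add: card_image)
qed

section \<open>Minimal polynomials and roots over finite fields\<close>

lemma (in field) finite_field_power_card:
  assumes "finite (carrier R)" "x \<in> carrier R"
  shows "x [^] card (carrier R) = x"
proof (cases "x = \<zero>")
  case True
  have "card (carrier R) > 0" using assms by (auto simp: card_gt_0_iff)
  then show ?thesis using True by (simp add: nat_pow_zero)
next
  case False
  have "x [^] card (Units R) = \<one>"
    by (rule units_power_order_eq_one) (use assms False in \<open>simp_all add: field_Units\<close>)
  moreover have "card (carrier R) = Suc (card (Units R))"
    unfolding field_Units using assms(1) card_Suc_Diff1[of "carrier R" \<zero>] by simp
  ultimately show ?thesis using assms(2) by simp
qed

text \<open>For \<open>n\<close> the order of a finite extension field all its elements are roots.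
  Hence evaluation kernels are nonzero, and roots can be counted.\<close>

definition (in field) splitting_poly :: "nat \<Rightarrow> 'a list" where
  "splitting_poly n = X [^]\<^bsub>poly_ring R\<^esub> n \<ominus>\<^bsub>poly_ring R\<^esub> X"

lemma (in field) splitting_poly:
  assumes n: "n > 1"
  shows "splitting_poly n \<in> carrier (poly_ring R)" "splitting_poly n \<noteq> []" "degree (splitting_poly n) \<le> n"
    "cring A \<Longrightarrow> ring_hom_ring (poly_ring R) A h \<Longrightarrow> h (splitting_poly n) = h X [^]\<^bsub>A\<^esub> n \<ominus>\<^bsub>A\<^esub> h X"
proof -
  interpret P: domain "poly_ring R" by (rule univ_poly_is_domain[OF carrier_is_subring])
  have Xc: "X \<in> carrier (poly_ring R)" by (rule var_closed(1)[OF carrier_is_subring])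
  have Xn: "X [^]\<^bsub>poly_ring R\<^esub> n \<in> carrier (poly_ring R)" using Xc by (rule P.nat_pow_closed)
  have Xl: "X [^]\<^bsub>poly_ring R\<^esub> n = \<one> # replicate n \<zero>"
    using unitary_monom_eq_var_pow[OF carrier_is_subring, of n] by (simp add: monom_def)
  show "splitting_poly n \<in> carrier (poly_ring R)"
    unfolding splitting_poly_def by (rule P.minus_closed[OF Xn Xc])
  show "splitting_poly n \<noteq> []"
  proof
    assume "splitting_poly n = []"
    then have "X [^]\<^bsub>poly_ring R\<^esub> n \<ominus>\<^bsub>poly_ring R\<^esub> X = \<zero>\<^bsub>poly_ring R\<^esub>"
      by (simp add: splitting_poly_def univ_poly_zero)
    then have "X [^]\<^bsub>poly_ring R\<^esub> n = X" using Xn Xc by simp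
    then have "length (\<one> # replicate n \<zero>) = length (X :: 'a list)" using Xl by simp
    then show False using n by (simp add: var_def)
  qed
  have "degree (splitting_poly n) \<le> max (degree (X [^]\<^bsub>poly_ring R\<^esub> n)) (degree (\<ominus>\<^bsub>poly_ring R\<^esub> X))"
    unfolding splitting_poly_def a_minus_def univ_poly_add by (rule poly_add_degree)
  moreover have "degree (\<ominus>\<^bsub>poly_ring R\<^esub> X) = 1"
    using univ_poly_a_inv_degree[OF carrier_is_subring Xc] by (simp add: var_def)
  ultimately show "degree (splitting_poly n) \<le> n" using n unfolding Xl by simp
  assume A: "cring A" and "ring_hom_ring (poly_ring R) A h"
  then interpret h: ring_hom_ring "poly_ring R" A h by simp
  show "h (splitting_poly n) = h X [^]\<^bsub>A\<^esub> n \<ominus>\<^bsub>A\<^esub> h X"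
    unfolding splitting_poly_def a_minus_def
      h.hom_add[OF Xn P.a_inv_closed[OF Xc]] h.hom_a_inv[OF Xc] h.hom_nat_pow[OF Xc] by (rule refl)
qed

definition monic_irreducible :: "('c, 'm) ring_scheme \<Rightarrow> 'c list \<Rightarrow> bool" where
  "monic_irreducible k g \<longleftrightarrow> g \<in> carrier (poly_ring k) \<and> Polynomials.lead_coeff g = \<one>\<^bsub>k\<^esub> \<and>
     ring_irreducible\<^bsub>poly_ring k\<^esub> g"

lemma (in field) monic_irreducible_degree:
  assumes "monic_irreducible R g"
  shows "degree g > 0"
  using pirreducible_degree[OF carrier_is_subfield, of g] assms by (simp add: monic_irreducible_def)

text \<open>Irreducibles dividing each other generate the same ideal, whose monic generator is
  unique.\<close>

lemma (in field) monic_irreducible_unique: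
  assumes f: "monic_irreducible R f" and g: "monic_irreducible R g" and "f pdivides g"
  shows "f = g"
proof -
  interpret P: principal_domain "poly_ring R" by (rule univ_poly_is_principal[OF carrier_is_subfield])
  have c: "f \<in> carrier (poly_ring R)" "g \<in> carrier (poly_ring R)"
    and irr: "ring_irreducible\<^bsub>poly_ring R\<^esub> f" "ring_irreducible\<^bsub>poly_ring R\<^esub> g"
    and lc: "lead_coeff f = \<one>" "lead_coeff g = \<one>"
    using f g by (simp_all add: monic_irreducible_def)
  obtain r where r: "r \<in> carrier (poly_ring R)" "g = f \<otimes>\<^bsub>poly_ring R\<^esub> r"
    using assms(3) unfolding pdivides_def by (elim dividesE) (rule that)
  have "g \<in> PIdl\<^bsub>poly_ring R\<^esub> f"
    unfolding P.cgenideal_iff using r P.m_comm[OF c(1) r(1)] by (intro bexI[of _ r]) simp_all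
  then have "f \<sim>\<^bsub>poly_ring R\<^esub> g"
    by (rule cgenideal_pirreducible[OF carrier_is_subfield c(1) irr(1) irr(2)])
  then have eq: "PIdl\<^bsub>poly_ring R\<^esub> f = PIdl\<^bsub>poly_ring R\<^esub> g"
    using P.associated_iff_same_ideal[OF c] by simp
  have "PIdl\<^bsub>poly_ring R\<^esub> f \<noteq> {[]}"
    using P.cgenideal_self[OF c(1)] pirreducibleE(1)[OF carrier_is_subring c(1) irr(1)] by auto
  then show ?thesis
    using exists_unique_gen[OF carrier_is_subfield P.cgenideal_ideal[OF c(1)]] c lc eq by blast
qed

text \<open>The kernel of evaluation at \<open>v\<close> is prime, as preimage of the zero ideal of
  a field, and nonzero, as it contains the splitting polynomial for the order of \<open>F\<close>;
  its monic generator is therefore irreducible.\<close>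

lemma minimal_polynomial_exists:
  assumes k: "field k" and F: "field F" "finite (carrier F)" and \<iota>: "\<iota> \<in> Ring.ring_hom k F" and v: "v \<in> carrier F"
  obtains g where "monic_irreducible k g"
    "\<And>f. f \<in> carrier (poly_ring k) \<Longrightarrow> peval F \<iota> f v = \<zero>\<^bsub>F\<^esub> \<longleftrightarrow> g pdivides\<^bsub>k\<^esub> f"
proof -
  interpret k: field k by fact
  interpret F: field F by fact
  interpret P: principal_domain "poly_ring k" by (rule k.univ_poly_is_principal[OF k.carrier_is_subfield])
  define h where "h f = peval F \<iota> f v" for f
  have h: "ring_hom_ring (poly_ring k) F h"
    unfolding h_def by (rule peval_hom[OF k F.is_cring \<iota> v])
  define I where "I = a_kernel (poly_ring k) F h"
  have Iiff: "f \<in> I \<longleftrightarrow> f \<in> carrier (poly_ring k) \<and> h f = \<zero>\<^bsub>F\<^esub>" for f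
    by (simp add: I_def a_kernel_def')
  have I: "ideal I (poly_ring k)" unfolding I_def by (rule ring_hom_ring.kernel_is_ideal[OF h])
  define n where "n = card (carrier F)"
  have n: "n > 1"
  proof -
    have "card {\<zero>\<^bsub>F\<^esub>, \<one>\<^bsub>F\<^esub>} \<le> n" unfolding n_def by (rule card_mono[OF F(2)]) simp
    then show ?thesis using F.one_not_zero by simp
  qed
  have "h (k.splitting_poly n) = h X\<^bsub>k\<^esub> [^]\<^bsub>F\<^esub> n \<ominus>\<^bsub>F\<^esub> h X\<^bsub>k\<^esub>"
    by (rule k.splitting_poly(4)[OF n F.is_cring h])
  also have "h X\<^bsub>k\<^esub> = v" unfolding h_def by (rule peval_X[OF k F.is_cring \<iota> v])
  also have "v [^]\<^bsub>F\<^esub> n = v" unfolding n_def by (rule F.finite_field_power_card[OF F(2) v])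
  also have "v \<ominus>\<^bsub>F\<^esub> v = \<zero>\<^bsub>F\<^esub>" using v by simp
  finally have "k.splitting_poly n \<in> I" unfolding Iiff using k.splitting_poly(1)[OF n] by simp
  then have Ine: "I \<noteq> {[]}" using k.splitting_poly(2)[OF n] by blast
  obtain g where g: "g \<in> carrier (poly_ring k)" "lead_coeff g = \<one>\<^bsub>k\<^esub>" "I = PIdl\<^bsub>poly_ring k\<^esub> g"
    using k.exists_unique_gen[OF k.carrier_is_subfield I Ine] by (elim ex1E conjE) (rule that; assumption)
  have gn: "g \<in> carrier (poly_ring k) - {\<zero>\<^bsub>poly_ring k\<^esub>}"
  proof -
    have "g \<noteq> \<zero>\<^bsub>poly_ring k\<^esub>"
    proof
      assume "g = \<zero>\<^bsub>poly_ring k\<^esub>"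
      then have "I = {\<zero>\<^bsub>poly_ring k\<^esub>}" unfolding g(3) P.cgenideal_eq_genideal[OF g(1)] by (simp add: P.genideal_zero)
      then show False using Ine by (simp add: univ_poly_zero)
    qed
    then show ?thesis using g(1) by simp
  qed
  have "primeideal I (poly_ring k)"
    using ring_hom_ring.primeideal_vimage[OF h P.is_cring F.zeroprimeideal] by (simp add: I_def a_kernel_def')
  then have "ring_prime\<^bsub>poly_ring k\<^esub> g"
    unfolding g(3) using P.primeideal_iff_prime[OF gn] by simp
  then have "ring_irreducible\<^bsub>poly_ring k\<^esub> g"
    using k.pprime_iff_pirreducible[OF k.carrier_is_subfield g(1)] by simp
  then have "monic_irreducible k g" using g by (simp add: monic_irreducible_def)
  moreover have "peval F \<iota> f v = \<zero>\<^bsub>F\<^esub> \<longleftrightarrow> g pdivides\<^bsub>k\<^esub> f" if f: "f \<in> carrier (poly_ring k)" for f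
  proof -
    have "peval F \<iota> f v = \<zero>\<^bsub>F\<^esub> \<longleftrightarrow> f \<in> PIdl\<^bsub>poly_ring k\<^esub> g"
      using Iiff[of f] f g(3) by (simp add: h_def)
    also have "\<dots> \<longleftrightarrow> g pdivides\<^bsub>k\<^esub> f"
      unfolding P.cgenideal_iff pdivides_def factor_def using P.m_comm[OF g(1)] by (intro bex_cong) simp_all
    finally show ?thesis .
  qed
  ultimately show thesis by (rule that)
qed

lemma root_kernel:
  assumes k: "field k" and F: "field F" "finite (carrier F)" and \<iota>: "\<iota> \<in> Ring.ring_hom k F" and v: "v \<in> carrier F"
    and g: "monic_irreducible k g" "peval F \<iota> g v = \<zero>\<^bsub>F\<^esub>" and f: "f \<in> carrier (poly_ring k)"
  shows "peval F \<iota> f v = \<zero>\<^bsub>F\<^esub> \<longleftrightarrow> g pdivides\<^bsub>k\<^esub> f"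
proof -
  obtain m where m: "monic_irreducible k m"
    "\<And>f. f \<in> carrier (poly_ring k) \<Longrightarrow> peval F \<iota> f v = \<zero>\<^bsub>F\<^esub> \<longleftrightarrow> m pdivides\<^bsub>k\<^esub> f"
    using minimal_polynomial_exists[OF k F \<iota> v] by metis
  have "m pdivides\<^bsub>k\<^esub> g" using m(2)[of g] g by (simp add: monic_irreducible_def)
  then have "m = g" by (rule field.monic_irreducible_unique[OF k m(1) g(1)])
  then show ?thesis using m(2)[OF f] by simp
qed

lemma root_range_card:
  assumes k: "field k" "finite (carrier k)" and F: "field F" "finite (carrier F)" and \<iota>: "\<iota> \<in> Ring.ring_hom k F"
    and v: "v \<in> carrier F" and g: "monic_irreducible k g" "peval F \<iota> g v = \<zero>\<^bsub>F\<^esub>"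
  shows "card ((\<lambda>f. peval F \<iota> f v) ` carrier (poly_ring k)) = card (carrier k) ^ Polynomials.degree g"
proof (rule field.card_image_poly_ring[OF k])
  have F': "cring F" using F(1) by (rule fieldE(1))
  show "ring_hom_ring (poly_ring k) F (\<lambda>f. peval F \<iota> f v)" by (rule peval_hom[OF k(1) F' \<iota> v])
  show "g \<in> carrier (poly_ring k)" using g(1) by (simp add: monic_irreducible_def)
  show "0 < Polynomials.degree g" by (rule field.monic_irreducible_degree[OF k(1) g(1)])
  show "(peval F \<iota> f v = \<zero>\<^bsub>F\<^esub>) = (g pdivides\<^bsub>k\<^esub> f)" if "f \<in> carrier (poly_ring k)" for f
    by (rule root_kernel[OF k(1) F \<iota> v g that])
qed

lemma root_range_eq_carrier:
  assumes k: "field k" "finite (carrier k)" and F: "field F" "finite (carrier F)" and \<iota>: "\<iota> \<in> Ring.ring_hom k F"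
    and v: "v \<in> carrier F" and g: "monic_irreducible k g" "peval F \<iota> g v = \<zero>\<^bsub>F\<^esub>"
    and card: "card (carrier F) = card (carrier k) ^ Polynomials.degree g"
  shows "(\<lambda>f. peval F \<iota> f v) ` carrier (poly_ring k) = carrier F"
proof (rule card_seteq[OF F(2)])
  have F': "cring F" using F(1) by (rule fieldE(1))
  show "(\<lambda>f. peval F \<iota> f v) ` carrier (poly_ring k) \<subseteq> carrier F"
    using ring_hom_memE(1)[OF ring_hom_ring.homh[OF peval_hom[OF k(1) F' \<iota> v]]] by blast
  show "card (carrier F) \<le> card ((\<lambda>f. peval F \<iota> f v) ` carrier (poly_ring k))"
    using root_range_card[OF k F \<iota> v g] card by simp
qed

lemma (in field) finite_field_generator:
  assumes "finite (carrier R)"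
  obtains a where "a \<in> carrier R" "a \<noteq> \<zero>" "\<And>x. x \<in> carrier R \<Longrightarrow> x \<noteq> \<zero> \<Longrightarrow> \<exists>i::nat. x = a [^] i"
proof -
  obtain a where a: "a \<in> carrier (Multiplicative_Group.mult_of R)"
    "carrier (Multiplicative_Group.mult_of R) = {a [^] i | i::nat. i \<in> UNIV}"
    using finite_field_mult_group_has_gen[OF assms] by (elim bexE) (rule that)
  show thesis
  proof (rule that)
    show "a \<in> carrier R" "a \<noteq> \<zero>" using a(1) by simp_all
    fix x assume "x \<in> carrier R" "x \<noteq> \<zero>"
    then have "x \<in> carrier (Multiplicative_Group.mult_of R)" by simp
    then show "\<exists>i::nat. x = a [^] i" unfolding a(2) by (simp only: mem_Collect_eq UNIV_I simp_thms)
  qed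
qed

lemma (in ideal) rcos_eq_zero_iff:
  assumes "x \<in> carrier R"
  shows "I +> x = \<zero>\<^bsub>R Quot I\<^esub> \<longleftrightarrow> x \<in> I"
proof -
  have z: "\<zero>\<^bsub>R Quot I\<^esub> = I" by (simp add: FactRing_def)
  show ?thesis unfolding z using rcos_const_imp_mem[OF assms] a_rcos_zero[OF is_ideal] by blast
qed

text \<open>Polynomials modulo \<open>g\<close> form a field with \<open>n\<close> elements, so
  there \<open>X\<close> equals its \<open>n\<close>-th power and \<open>g\<close> divides the
  splitting polynomial \<open>s\<close>. If \<open>g\<close> had no root in \<open>F\<close>, all
  \<open>n\<close> elements would be roots of the cofactor \<open>c\<close>, whose degree is below
  \<open>n\<close>.\<close>

lemma root_exists:
  assumes k: "field k" "finite (carrier k)" and F: "field F" "finite (carrier F)" and \<iota>: "\<iota> \<in> Ring.ring_hom k F"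
    and g: "monic_irreducible k g" and card: "card (carrier F) = card (carrier k) ^ Polynomials.degree g"
  shows "\<exists>u\<in>carrier F. peval F \<iota> g u = \<zero>\<^bsub>F\<^esub>"
proof (rule ccontr)
  assume neg: "\<not> ?thesis"
  interpret k: field k by fact
  interpret F: field F by fact
  interpret P: principal_domain "poly_ring k" by (rule k.univ_poly_is_principal[OF k.carrier_is_subfield])
  have gP: "g \<in> carrier (poly_ring k)" and girr: "ring_irreducible\<^bsub>poly_ring k\<^esub> g"
    using g by (simp_all add: monic_irreducible_def)
  have gd: "Polynomials.degree g > 0" by (rule k.monic_irreducible_degree[OF g])
  define n where "n = card (carrier F)"
  have n: "n > 1"
  proof -
    have "card {\<zero>\<^bsub>F\<^esub>, \<one>\<^bsub>F\<^esub>} \<le> n" unfolding n_def by (rule card_mono[OF F(2)]) simp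
    then show ?thesis using F.one_not_zero by simp
  qed
  define s where "s = k.splitting_poly n"
  have s: "s \<in> carrier (poly_ring k)" "s \<noteq> []" "Polynomials.degree s \<le> n"
    unfolding s_def by (rule k.splitting_poly[OF n])+
  have gI: "ideal (PIdl\<^bsub>poly_ring k\<^esub> g) (poly_ring k)" by (rule P.cgenideal_ideal[OF gP])
  have "g pdivides\<^bsub>k\<^esub> s"
  proof -
    define L where "L = poly_ring k Quot (PIdl\<^bsub>poly_ring k\<^esub> g)"
    define h where "h f = PIdl\<^bsub>poly_ring k\<^esub> g +>\<^bsub>poly_ring k\<^esub> f" for f
    have "field (Rupt\<^bsub>k\<^esub> (carrier k) g)"
      using k.rupture_is_field_iff_pirreducible[OF k.carrier_is_subfield gP] girr by simp
    then have L: "field L" by (simp add: L_def rupture_def)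
    then have Lc: "cring L" by (rule fieldE(1))
    have h: "ring_hom_ring (poly_ring k) L h"
      unfolding L_def h_def by (rule ideal.rcos_ring_hom_ring[OF gI])
    have surj: "h ` carrier (poly_ring k) = carrier L"
      unfolding L_def h_def FactRing_def A_RCOSETS_def' by auto
    have ker: "h f = \<zero>\<^bsub>L\<^esub> \<longleftrightarrow> g pdivides\<^bsub>k\<^esub> f" if f: "f \<in> carrier (poly_ring k)" for f
    proof -
      have "h f = \<zero>\<^bsub>L\<^esub> \<longleftrightarrow> f \<in> PIdl\<^bsub>poly_ring k\<^esub> g"
        unfolding h_def L_def by (rule ideal.rcos_eq_zero_iff[OF gI f])
      also have "\<dots> \<longleftrightarrow> g pdivides\<^bsub>k\<^esub> f"
        unfolding P.cgenideal_iff pdivides_def factor_def using P.m_comm[OF gP] by (intro bex_cong) simp_all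
      finally show ?thesis .
    qed
    have cardL: "card (carrier L) = n"
      using k.card_image_poly_ring[OF k(2) h gP gd ker] surj card by (simp add: n_def)
    then have finL: "finite (carrier L)" using n card_ge_0_finite[of "carrier L"] by simp
    have Xc: "X\<^bsub>k\<^esub> \<in> carrier (poly_ring k)" by (rule k.var_closed(1)[OF k.carrier_is_subring])
    have hX: "h X\<^bsub>k\<^esub> \<in> carrier L" using surj Xc by blast
    have "h s = h X\<^bsub>k\<^esub> [^]\<^bsub>L\<^esub> n \<ominus>\<^bsub>L\<^esub> h X\<^bsub>k\<^esub>"
      unfolding s_def by (rule k.splitting_poly(4)[OF n Lc h])
    also have "h X\<^bsub>k\<^esub> [^]\<^bsub>L\<^esub> n = h X\<^bsub>k\<^esub>"
      using field.finite_field_power_card[OF L finL hX] cardL by simp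
    also have "h X\<^bsub>k\<^esub> \<ominus>\<^bsub>L\<^esub> h X\<^bsub>k\<^esub> = \<zero>\<^bsub>L\<^esub>"
      using ring.r_right_minus_eq[OF field.is_ring[OF L] hX hX] by simp
    finally show ?thesis using ker[OF s(1)] by simp
  qed
  then obtain c where c: "c \<in> carrier (poly_ring k)" "s = g \<otimes>\<^bsub>poly_ring k\<^esub> c"
    unfolding pdivides_def by (elim dividesE) (rule that)
  have evs: "peval F \<iota> c u = \<zero>\<^bsub>F\<^esub>" if u: "u \<in> carrier F" for u
  proof -
    have h: "ring_hom_ring (poly_ring k) F (\<lambda>f. peval F \<iota> f u)" by (rule peval_hom[OF k(1) F.is_cring \<iota> u])
    have "peval F \<iota> s u = peval F \<iota> X\<^bsub>k\<^esub> u [^]\<^bsub>F\<^esub> n \<ominus>\<^bsub>F\<^esub> peval F \<iota> X\<^bsub>k\<^esub> u"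
      unfolding s_def by (rule k.splitting_poly(4)[OF n F.is_cring h])
    also have "\<dots> = \<zero>\<^bsub>F\<^esub>"
      unfolding peval_X[OF k(1) F.is_cring \<iota> u] n_def F.finite_field_power_card[OF F(2) u] using u by simp
    finally have "peval F \<iota> g u \<otimes>\<^bsub>F\<^esub> peval F \<iota> c u = \<zero>\<^bsub>F\<^esub>"
      unfolding c(2) using ring_hom_mult[OF ring_hom_ring.homh[OF h] gP c(1)] by simp
    moreover have "peval F \<iota> g u \<noteq> \<zero>\<^bsub>F\<^esub>" using neg u by simp
    moreover have "peval F \<iota> g u \<in> carrier F" "peval F \<iota> c u \<in> carrier F"
      using ring_hom_closed[OF ring_hom_ring.homh[OF h]] gP c(1) by simp_all
    ultimately show ?thesis using F.integral by metis
  qed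
  have cn: "c \<noteq> []"
  proof
    assume "c = []"
    then have "s = \<zero>\<^bsub>poly_ring k\<^esub>" unfolding c(2) using P.r_null[OF gP] by (simp add: univ_poly_zero)
    then show False using s(2) by (simp add: univ_poly_zero)
  qed
  \<comment> \<open>This keeps the leading coefficient of \<open>c\<close> nonzero, so
    \<open>map \<iota> c\<close> is a polynomial over \<open>F\<close> of the same degree.\<close>
  have \<iota>nz: "\<iota> a \<noteq> \<zero>\<^bsub>F\<^esub>" if a: "a \<in> carrier k" "a \<noteq> \<zero>\<^bsub>k\<^esub>" for a
  proof
    assume z: "\<iota> a = \<zero>\<^bsub>F\<^esub>"
    have u: "a \<in> Units k" using a k.field_Units by simp
    have "\<one>\<^bsub>F\<^esub> = \<iota> (a \<otimes>\<^bsub>k\<^esub> inv\<^bsub>k\<^esub> a)" using k.Units_r_inv[OF u] ring_hom_one[OF \<iota>] by simp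
    also have "\<dots> = \<zero>\<^bsub>F\<^esub>"
      using ring_hom_mult[OF \<iota> a(1) k.Units_inv_closed[OF u]] z ring_hom_closed[OF \<iota> k.Units_inv_closed[OF u]] by simp
    finally show False using F.one_not_zero by simp
  qed
  have c': "map \<iota> c \<in> carrier (poly_ring F)"
  proof -
    have cs: "set c \<subseteq> carrier k" "polynomial\<^bsub>k\<^esub> (carrier k) c"
      using k.poly_ring_set[OF c(1)] c(1) univ_poly_carrier by blast+
    have "hd c \<in> carrier k" "hd c \<noteq> \<zero>\<^bsub>k\<^esub>" using cs cn hd_in_set[OF cn] by (auto simp: polynomial_def)
    then have "hd (map \<iota> c) \<noteq> \<zero>\<^bsub>F\<^esub>" using \<iota>nz cn by (simp add: hd_map)
    moreover have "set (map \<iota> c) \<subseteq> carrier F" using cs(1) ring_hom_closed[OF \<iota>] by auto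
    ultimately have "polynomial\<^bsub>F\<^esub> (carrier F) (map \<iota> c)" by (simp add: polynomial_def)
    then show ?thesis unfolding univ_poly_carrier .
  qed
  have "carrier F \<subseteq> set_mset (F.roots (map \<iota> c))"
  proof
    fix u assume u: "u \<in> carrier F"
    then have "F.is_root (map \<iota> c) u" unfolding F.is_root_def using evs[OF u] cn by (simp add: peval_def)
    then show "u \<in> set_mset (F.roots (map \<iota> c))" using F.roots_mem_iff_is_root[OF c'] by simp
  qed
  then have "n \<le> card (set_mset (F.roots (map \<iota> c)))" unfolding n_def by (intro card_mono) simp_all
  also have "\<dots> \<le> size (F.roots (map \<iota> c))" unfolding size_multiset_overloaded_eq
    by (rule order_trans[OF _ sum_mono[of _ "\<lambda>_. 1"]]) (simp_all add: Suc_leI)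
  also have "\<dots> \<le> Polynomials.degree (map \<iota> c)" by (rule F.size_roots_le_degree[OF c'])
  finally have nc: "n \<le> Polynomials.degree c" by simp
  have "Polynomials.degree s = Polynomials.degree g + Polynomials.degree c"
  proof -
    have gn: "g \<noteq> []" using gd by auto
    have "polynomial\<^bsub>k\<^esub> (carrier k) g" "polynomial\<^bsub>k\<^esub> (carrier k) c"
      unfolding univ_poly_carrier by (fact gP, fact c(1))
    from k.poly_mult_degree_eq[OF k.carrier_is_subring this] show ?thesis
      using gn cn unfolding c(2) univ_poly_mult by (simp only: if_False simp_thms)
  qed
  then show False using nc s(3) gd by linarith
qed

text \<open>A generator \<open>a\<close> of the multiplicative group makes \<open>F\<close> the
  quotient of the polynomial ring by the minimal polynomial \<open>m\<close> of \<open>a\<close>, so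
  its order fixes the degree of \<open>m\<close>. By \<open>root_exists\<close>, \<open>F'\<close>
  has a root \<open>u\<close> of \<open>m\<close>, and counting shows that \<open>u\<close>
  generates \<open>F'\<close>; both fields are the same quotient.\<close>

lemma finite_fields_iso:
  assumes k: "field k" "finite (carrier k)" and F: "field F" "finite (carrier F)" and \<iota>: "\<iota> \<in> Ring.ring_hom k F"
    and F': "field F'" "finite (carrier F')" and \<iota>': "\<iota>' \<in> Ring.ring_hom k F'"
    and card: "card (carrier F) = card (carrier F')"
  shows "F \<simeq> F'" "\<exists>d. card (carrier F) = card (carrier k) ^ d"
proof -
  interpret k: field k by fact
  interpret F: field F by fact
  interpret F': field F' by fact
  interpret P: principal_domain "poly_ring k" by (rule k.univ_poly_is_principal[OF k.carrier_is_subfield])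
  obtain a where ac: "a \<in> carrier F"
    and gen: "\<And>x. x \<in> carrier F \<Longrightarrow> x \<noteq> \<zero>\<^bsub>F\<^esub> \<Longrightarrow> \<exists>i::nat. x = a [^]\<^bsub>F\<^esub> i"
    using F.finite_field_generator[OF F(2)] by metis
  have h: "ring_hom_ring (poly_ring k) F (\<lambda>f. peval F \<iota> f a)" by (rule peval_hom[OF k(1) F.is_cring \<iota> ac])
  have Xc: "X\<^bsub>k\<^esub> \<in> carrier (poly_ring k)" by (rule k.var_closed(1)[OF k.carrier_is_subring])
  have rng: "(\<lambda>f. peval F \<iota> f a) ` carrier (poly_ring k) = carrier F"
  proof (intro equalityI subsetI)
    fix x assume "x \<in> (\<lambda>f. peval F \<iota> f a) ` carrier (poly_ring k)"
    then show "x \<in> carrier F" by (elim imageE) (simp add: ring_hom_closed[OF ring_hom_ring.homh[OF h]])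
  next
    fix x assume x: "x \<in> carrier F"
    show "x \<in> (\<lambda>f. peval F \<iota> f a) ` carrier (poly_ring k)"
    proof (cases "x = \<zero>\<^bsub>F\<^esub>")
      case True
      have "peval F \<iota> \<zero>\<^bsub>poly_ring k\<^esub> a = x"
        using ring_hom_zero[OF ring_hom_ring.homh[OF h] P.ring_axioms F.ring_axioms] True by simp
      from this[symmetric] show ?thesis by (rule image_eqI) simp
    next
      case False
      obtain i :: nat where i: "x = a [^]\<^bsub>F\<^esub> i" using gen[OF x False] by (elim exE) (rule that)
      have "peval F \<iota> (X\<^bsub>k\<^esub> [^]\<^bsub>poly_ring k\<^esub> i) a = x"
        using ring_hom_ring.hom_nat_pow[OF h Xc, of i] peval_X[OF k(1) F.is_cring \<iota> ac] i by simp
      from this[symmetric] show ?thesis by (rule image_eqI) (rule P.nat_pow_closed[OF Xc])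
    qed
  qed
  obtain m where m: "monic_irreducible k m"
    "\<And>f. f \<in> carrier (poly_ring k) \<Longrightarrow> peval F \<iota> f a = \<zero>\<^bsub>F\<^esub> \<longleftrightarrow> m pdivides\<^bsub>k\<^esub> f"
    using minimal_polynomial_exists[OF k(1) F \<iota> ac] by metis
  have mP: "m \<in> carrier (poly_ring k)" using m(1) by (simp add: monic_irreducible_def)
  have "m pdivides\<^bsub>k\<^esub> m" unfolding pdivides_def using P.divides_refl[OF mP] .
  then have mr: "peval F \<iota> m a = \<zero>\<^bsub>F\<^esub>" using m(2)[OF mP] by simp
  have cd: "card (carrier F) = card (carrier k) ^ Polynomials.degree m"
    using root_range_card[OF k F \<iota> ac m(1) mr] rng by simp
  then show "\<exists>d. card (carrier F) = card (carrier k) ^ d" by blast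
  obtain u where u: "u \<in> carrier F'" "peval F' \<iota>' m u = \<zero>\<^bsub>F'\<^esub>"
    using root_exists[OF k F' \<iota>' m(1)] card cd by (elim meta_impE bexE) (simp, rule that)
  have rng': "(\<lambda>f. peval F' \<iota>' f u) ` carrier (poly_ring k) = carrier F'"
    by (rule root_range_eq_carrier[OF k F' \<iota>' u(1) m(1) u(2)]) (use card cd in simp)
  have h': "ring_hom_ring (poly_ring k) F' (\<lambda>f. peval F' \<iota>' f u)" by (rule peval_hom[OF k(1) F'.is_cring \<iota>' u(1)])
  have ker: "a_kernel (poly_ring k) F (\<lambda>f. peval F \<iota> f a) = a_kernel (poly_ring k) F' (\<lambda>f. peval F' \<iota>' f u)"
    unfolding a_kernel_def'
  proof (rule Collect_cong, rule conj_cong[OF refl])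
    fix f assume f: "f \<in> carrier (poly_ring k)"
    show "(peval F \<iota> f a = \<zero>\<^bsub>F\<^esub>) = (peval F' \<iota>' f u = \<zero>\<^bsub>F'\<^esub>)"
      unfolding m(2)[OF f] root_kernel[OF k(1) F' \<iota>' u(1) m(1) u(2) f] by (rule refl)
  qed
  have 1: "poly_ring k Quot a_kernel (poly_ring k) F (\<lambda>f. peval F \<iota> f a) \<simeq> F"
    by (rule ring_hom_ring.FactRing_iso[OF h rng])
  have 2: "poly_ring k Quot a_kernel (poly_ring k) F (\<lambda>f. peval F \<iota> f a) \<simeq> F'"
    unfolding ker by (rule ring_hom_ring.FactRing_iso[OF h' rng'])
  show "F \<simeq> F'"
    by (rule ring_iso_trans[OF ring_iso_sym[OF ideal.quotient_is_ring[OF ring_hom_ring.kernel_is_ideal[OF h]] 1] 2])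
qed

section \<open>The prime field and the value of \<open>tau\<close>\<close>

lemma (in cring) residue_ring_hom:
  assumes p: "Factorial_Ring.prime p" and pz: "[(p::nat)] \<cdot> \<one> = \<zero>"
  shows "(\<lambda>a. [a] \<cdot> \<one>) \<in> Ring.ring_hom (residue_ring (int p)) R"
proof -
  have md: "[(a mod int p)] \<cdot> \<one> = [a] \<cdot> \<one>" for a :: int
  proof -
    have "[(int p * (a div int p))] \<cdot> \<one> = [(a div int p)] \<cdot> ([(int p)] \<cdot> \<one>)"
      by (rule add.int_pow_pow[OF one_closed, symmetric])
    also have "[(int p)] \<cdot> \<one> = \<zero>" using pz add_pow_int_ge[of "int p" R \<one>] by simp
    finally have z: "[(int p * (a div int p))] \<cdot> \<one> = \<zero>" by simp
    have "[a] \<cdot> \<one> = [(int p * (a div int p) + a mod int p)] \<cdot> \<one>" by simp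
    also have "\<dots> = [(a mod int p)] \<cdot> \<one>" unfolding add.int_pow_mult[OF one_closed] z by simp
    finally show ?thesis by simp
  qed
  show ?thesis
  proof (rule ring_hom_memI)
    fix a b :: int
    show "[a] \<cdot> \<one> \<in> carrier R" by simp
    have "[((a * b) mod int p)] \<cdot> \<one> = [b] \<cdot> ([a] \<cdot> \<one>)" unfolding md by (rule add.int_pow_pow[OF one_closed, symmetric])
    also have "\<dots> = ([a] \<cdot> \<one>) \<otimes> ([b] \<cdot> \<one>)"
      using add_pow_rdistr_int[of "[a] \<cdot> \<one>" \<one> b] by simp
    finally show "[(a \<otimes>\<^bsub>residue_ring (int p)\<^esub> b)] \<cdot> \<one> = ([a] \<cdot> \<one>) \<otimes> ([b] \<cdot> \<one>)"
      by (simp add: residue_ring_def)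
    show "[(a \<oplus>\<^bsub>residue_ring (int p)\<^esub> b)] \<cdot> \<one> = ([a] \<cdot> \<one>) \<oplus> ([b] \<cdot> \<one>)"
      by (simp add: residue_ring_def md add.int_pow_mult)
  next
    show "[(\<one>\<^bsub>residue_ring (int p)\<^esub>)] \<cdot> \<one> = \<one>" by (simp add: residue_ring_def)
  qed
qed

lemma residue_ring_prime:
  assumes "Factorial_Ring.prime (p::nat)"
  shows "field (residue_ring (int p))" "carrier (residue_ring (int p)) = {0..int p - 1}"
    "finite (carrier (residue_ring (int p)))" "card (carrier (residue_ring (int p))) = p"
proof -
  have "residues_prime p" using assms by (simp add: residues_prime_def)
  then show "field (residue_ring (int p))" by (rule residues_prime.is_field)
  show "carrier (residue_ring (int p)) = {0..int p - 1}" by (simp add: residue_ring_def)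
  then show "finite (carrier (residue_ring (int p)))" "card (carrier (residue_ring (int p))) = p" by simp_all
qed

text \<open>
  Excluding \<open>X\<close> matters in degree \<open>1\<close> only, and makes both cases of \<open>tau\<close> the same count plus one.
\<close>

definition eligible_polys :: "nat \<Rightarrow> nat \<Rightarrow> int list set" where
  "eligible_polys p d = {g. monic_irreducible (residue_ring (int p)) g \<and> Polynomials.degree g = d \<and>
     g \<noteq> X\<^bsub>residue_ring (int p)\<^esub>}"

lemma finite_eligible_polys:
  assumes p: "Factorial_Ring.prime p"
  shows "finite (eligible_polys p d)"
proof -
  interpret k: field "residue_ring (int p)" by (rule residue_ring_prime(1)[OF p])
  have "card {f \<in> carrier (poly_ring (residue_ring (int p))). length f \<le> Suc d} = p ^ Suc d"
    using k.card_poly_bounded_length[OF residue_ring_prime(3)[OF p]] residue_ring_prime(4)[OF p] by simp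
  then have "finite {f \<in> carrier (poly_ring (residue_ring (int p))). length f \<le> Suc d}"
    using prime_gt_0_nat[OF p] by (intro card_ge_0_finite) simp
  then show ?thesis
    by (rule finite_subset[rotated]) (auto simp: eligible_polys_def monic_irreducible_def)
qed

lemma tau_eq:
  assumes p: "Factorial_Ring.prime p" and d: "d > 0"
  shows "tau (p ^ d) = card (eligible_polys p d) + 1"
proof -
  interpret k: field "residue_ring (int p)" by (rule residue_ring_prime(1)[OF p])
  have zo: "\<zero>\<^bsub>residue_ring (int p)\<^esub> = 0" "\<one>\<^bsub>residue_ring (int p)\<^esub> = 1" by (simp_all add: residue_ring_def)
  have "aprimedivisor (p ^ d) = p" by (rule aprimedivisor_prime_power[OF p d])
  moreover have "multiplicity p (p ^ d) = d"
    using p by (intro multiplicity_same_power) (auto simp: prime_gt_1_nat)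
  ultimately have t: "tau (p ^ d) = (if d = 1 then p else num_monic_irreducible p d + 1)"
    by (simp add: tau_def)
  show ?thesis
  proof (cases "d = 1")
    case False
    have "eligible_polys p d = {f \<in> carrier (poly_ring (residue_ring (int p))).
        Polynomials.degree f = d \<and> Polynomials.lead_coeff f = \<one>\<^bsub>residue_ring (int p)\<^esub> \<and>
        ring_irreducible\<^bsub>poly_ring (residue_ring (int p))\<^esub> f}"
      using False by (auto simp: eligible_polys_def monic_irreducible_def var_def)
    then show ?thesis using False t by (simp add: num_monic_irreducible_def)
  next
    case True
    have p1: "p > 1" by (rule prime_gt_1_nat[OF p])
    \<comment> \<open>With the leading coefficient first, \<open>[1, a]\<close> is
      \<open>X + a\<close>, and the excluded \<open>X\<close> is \<open>[1, 0]\<close>;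
      \<open>p - 1\<close> polynomials remain.\<close>
    have "eligible_polys p d = (\<lambda>a. [1, a]) ` {1..int p - 1}"
    proof (intro equalityI subsetI)
      fix g assume "g \<in> eligible_polys p d"
      then have g: "g \<in> carrier (poly_ring (residue_ring (int p)))" "hd g = 1" "length g = 2" "g \<noteq> [1, 0]"
        using True by (auto simp: eligible_polys_def monic_irreducible_def var_def zo)
      obtain a b where ab: "g = [a, b]" using g(3) by (metis One_nat_def Suc_1 length_0_conv length_Suc_conv)
      have "b \<in> carrier (residue_ring (int p))" using k.poly_ring_set[OF g(1)] ab by simp
      then show "g \<in> (\<lambda>a. [1, a]) ` {1..int p - 1}"
        using ab g residue_ring_prime(2)[OF p] by (auto simp: image_iff)
    next
      fix g assume "g \<in> (\<lambda>a. [1, a]) ` {1..int p - 1}"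
      then obtain a where a: "g = [1, a]" "1 \<le> a" "a \<le> int p - 1" by auto
      have gP: "g \<in> carrier (poly_ring (residue_ring (int p)))"
        unfolding univ_poly_carrier[symmetric] polynomial_def using a p1 residue_ring_prime(2)[OF p] zo by simp
      have "ring_irreducible\<^bsub>poly_ring (residue_ring (int p))\<^esub> g"
        by (rule k.degree_one_imp_pirreducible[OF k.carrier_is_subfield gP]) (simp add: a)
      then show "g \<in> eligible_polys p d"
        using gP a True by (simp add: eligible_polys_def monic_irreducible_def var_def zo)
    qed
    moreover have "inj_on (\<lambda>a. [1, a]) {1..int p - 1}" by (rule inj_onI) simp
    ultimately have "card (eligible_polys p d) = p - 1" using p1 by (simp add: card_image nat_diff_distrib)
    then show ?thesis using True t p1 by simp
  qed
qed

section \<open>The reduced case\<close>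

lemma (in ring) nonunital_subring_finsum:
  assumes S: "nonunital_subring S R" and "finite A" and f: "\<And>a. a \<in> A \<Longrightarrow> f a \<in> S"
  shows "finsum R f A \<in> S"
  using assms(2) f
proof (induction A rule: finite_induct)
  case empty
  then show ?case using nonunital_subringD(2)[OF S] by simp
next
  case (insert a A)
  have c: "f \<in> A \<rightarrow> carrier R" "f a \<in> carrier R"
    using insert.prems nonunital_subringD(1)[OF S] by auto
  then show ?case
    using insert nonunital_subringD(3)[OF S] by (simp add: finsum_insert)
qed

locale reduced_frobenius_ring = frobenius_ring +
  assumes nil_zero: "nil = {\<zero>}"
begin

lemma pow_q: "x \<in> carrier R \<Longrightarrow> x [^] q = x"
proof -
  assume x: "x \<in> carrier R"
  obtain s j where s: "s \<in> sep" "j \<in> nil" "x = s \<oplus> j" using sep_nil_decomp[OF x] .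
  then have "x = s" using nil_zero sepD(1) by simp
  then show ?thesis using sepD(2)[OF s(1)] by simp
qed

lemma sep_carrier: "x \<in> carrier R \<Longrightarrow> x \<in> sep"
  by (simp add: sep_def pow_q)

lemmas idempotent = idempotent_power[OF sep_carrier]

lemma pow_pred: "x \<in> carrier R \<Longrightarrow> x [^] (q - 1) = x [^] (q - 2) \<otimes> x"
proof -
  assume "x \<in> carrier R"
  have "q - 1 = Suc (q - 2)" using q_gt_1 by simp
  then show ?thesis by simp
qed

text \<open>The primitive idempotents, with \<open>f \<otimes> e = f\<close> expressing that
  \<open>f\<close> lies below \<open>e\<close>. They stand for the factors of \<open>R\<close>:
  \<open>PIdl e\<close> is the factor and \<open>x \<otimes> e\<close> the component of
  \<open>x\<close>.\<close>

definition prim :: "'a set" where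
  "prim = {e \<in> carrier R. e \<noteq> \<zero> \<and> e \<otimes> e = e \<and>
     (\<forall>f\<in>carrier R. f \<otimes> f = f \<longrightarrow> f \<otimes> e = f \<longrightarrow> f = \<zero> \<or> f = e)}"

lemma primD:
  assumes "e \<in> prim"
  shows "e \<in> carrier R" "e \<noteq> \<zero>" "e \<otimes> e = e"
    "\<And>f. f \<in> carrier R \<Longrightarrow> f \<otimes> f = f \<Longrightarrow> f \<otimes> e = f \<Longrightarrow> f = \<zero> \<or> f = e"
  using assms unfolding prim_def by simp_all

lemma finite_prim: "finite prim"
  by (rule finite_subset[OF _ finite_carrier]) (auto simp: prim_def)

lemma corner_iff:
  assumes e: "e \<in> prim"
  shows "x \<in> PIdl e \<longleftrightarrow> x \<in> carrier R \<and> x \<otimes> e = x"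
proof
  note e' = primD[OF e]
  assume "x \<in> PIdl e"
  then obtain r where r: "r \<in> carrier R" "x = r \<otimes> e" unfolding cgenideal_iff by (elim bexE) (rule that)
  have "x \<otimes> e = r \<otimes> (e \<otimes> e)" unfolding r(2) using r(1) e'(1) by (rule m_assoc[OF _ _ e'(1)])
  then show "x \<in> carrier R \<and> x \<otimes> e = x" using r e' by simp
next
  assume "x \<in> carrier R \<and> x \<otimes> e = x"
  then show "x \<in> PIdl e" unfolding cgenideal_iff by (intro bexI[of _ x]) simp_all
qed

lemma corner_ideal: "e \<in> prim \<Longrightarrow> ideal (PIdl e) R"
  by (rule cgenideal_ideal[OF primD(1)])

lemma corner_subring: "e \<in> prim \<Longrightarrow> nonunital_subring (PIdl e) R"
  by (rule ideal_nonunital_subring[OF corner_ideal])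

lemma prim_self: "e \<in> prim \<Longrightarrow> e \<in> PIdl e"
  by (rule cgenideal_self[OF primD(1)])

lemma mult_corner: "e \<in> prim \<Longrightarrow> x \<in> carrier R \<Longrightarrow> x \<otimes> e \<in> PIdl e"
  unfolding cgenideal_iff by (rule bexI[of _ x]) simp_all

lemma corner_nonzero: "e \<in> prim \<Longrightarrow> PIdl e \<noteq> {\<zero>}"
  using prim_self primD(2) by blast

text \<open>The power is a nonzero idempotent below the primitive \<open>e\<close>.\<close>

lemma corner_pow:
  assumes e: "e \<in> prim" and x: "x \<in> PIdl e" "x \<noteq> \<zero>"
  shows "x [^] (q - 1) = e"
proof -
  have xc: "x \<in> carrier R" and xe: "x \<otimes> e = x" using x(1) corner_iff[OF e] by simp_all
  have "x [^] (q - 1) \<otimes> e = x [^] (q - 1)"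
    unfolding pow_pred[OF xc] using xc primD(1)[OF e] xe by (simp add: m_assoc)
  then have "x [^] (q - 1) = \<zero> \<or> x [^] (q - 1) = e"
    using primD(4)[OF e, of "x [^] (q - 1)"] idempotent(2)[OF xc] xc by simp
  moreover have "x [^] (q - 1) \<noteq> \<zero>"
  proof
    assume "x [^] (q - 1) = \<zero>"
    then have "x = \<zero>" using idempotent(1)[OF xc] xc by simp
    then show False using x(2) by simp
  qed
  ultimately show ?thesis by simp
qed

text \<open>An idempotent \<open>g\<close> below \<open>f\<close> with smallest ideal is primitive:
  a nonzero idempotent \<open>h\<close> below \<open>g\<close> generates the same ideal, so
  \<open>g\<close> is a multiple of \<open>h\<close> and equals it.\<close>

lemma prim_below:
  assumes f: "f \<in> carrier R" "f \<noteq> \<zero>" "f \<otimes> f = f"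
  obtains e where "e \<in> prim" "e \<otimes> f = e"
proof -
  define P where "P g \<longleftrightarrow> g \<in> carrier R \<and> g \<noteq> \<zero> \<and> g \<otimes> g = g \<and> g \<otimes> f = g" for g
  obtain g where g: "P g" "\<And>h. P h \<Longrightarrow> card (PIdl g) \<le> card (PIdl h)"
    using ex_has_least_nat[of P f "\<lambda>g. card (PIdl g)"] f unfolding P_def by metis
  have gc: "g \<in> carrier R" and gg: "g \<otimes> g = g" "g \<otimes> f = g" "g \<noteq> \<zero>" using g(1) by (simp_all add: P_def)
  have "h = \<zero> \<or> h = g" if h: "h \<in> carrier R" "h \<otimes> h = h" "h \<otimes> g = h" for h
  proof (rule disjCI)
    assume "h \<noteq> g"
    show "h = \<zero>"
    proof (rule ccontr)
      assume hn: "h \<noteq> \<zero>"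
      have "h \<otimes> f = h \<otimes> (g \<otimes> f)" using h f(1) gc by (metis m_assoc)
      then have "P h" unfolding P_def using h hn gg by simp
      then have card: "card (PIdl g) \<le> card (PIdl h)" by (rule g(2))
      have "h \<in> PIdl g" unfolding cgenideal_iff using h by (intro bexI[of _ h]) simp_all
      then have sub: "PIdl h \<subseteq> PIdl g" by (rule cgenideal_minimal[OF cgenideal_ideal[OF gc]])
      have "PIdl g \<subseteq> carrier R" using gc by (auto simp: cgenideal_iff)
      then have "finite (PIdl g)" using finite_carrier by (rule finite_subset)
      then have "PIdl h = PIdl g" using sub card by (rule card_seteq)
      then have "g \<in> PIdl h" using cgenideal_self[OF gc] by simp
      then obtain r where r: "r \<in> carrier R" "g = r \<otimes> h" unfolding cgenideal_iff by (elim bexE) (rule that)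
      have "g \<otimes> h = r \<otimes> (h \<otimes> h)" unfolding r(2) by (rule m_assoc[OF r(1) h(1) h(1)])
      then have "g \<otimes> h = g" using h(2) r(2) by simp
      then have "g = h" using m_comm[OF gc h(1)] h(3) by simp
      then show False using \<open>h \<noteq> g\<close> by simp
    qed
  qed
  then have "g \<in> prim" using gc gg by (simp add: prim_def)
  then show thesis using gg(2) by (rule that)
qed

lemma prim_orthogonal:
  assumes e: "e \<in> prim" and f: "f \<in> prim" and "e \<noteq> f"
  shows "e \<otimes> f = \<zero>"
proof (rule ccontr)
  assume n: "e \<otimes> f \<noteq> \<zero>"
  note e' = primD[OF e] and f' = primD[OF f]
  have c: "e \<otimes> f \<in> carrier R" using e' f' by simp
  have "(e \<otimes> f) \<otimes> (e \<otimes> f) = (e \<otimes> e) \<otimes> (f \<otimes> f)" using e'(1) f'(1) by algebra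
  then have i: "(e \<otimes> f) \<otimes> (e \<otimes> f) = e \<otimes> f" using e' f' by simp
  have "(e \<otimes> f) \<otimes> e = (e \<otimes> e) \<otimes> f" using e'(1) f'(1) by algebra
  then have "(e \<otimes> f) \<otimes> e = e \<otimes> f" using e' by simp
  then have 1: "e \<otimes> f = e" using e'(4)[OF c i] n by simp
  have "(e \<otimes> f) \<otimes> f = e \<otimes> (f \<otimes> f)" by (rule m_assoc[OF e'(1) f'(1) f'(1)])
  then have "(e \<otimes> f) \<otimes> f = e \<otimes> f" using f' by simp
  then have "e \<otimes> f = f" using f'(4)[OF c i] n by simp
  then show False using 1 assms(3) by simp
qed

lemma prim_orthogonal_corner:
  assumes e: "e \<in> prim" and f: "f \<in> prim" and "e \<noteq> f" and "y \<in> PIdl f"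
  shows "y \<otimes> e = \<zero>"
proof -
  have y: "y \<in> carrier R" "y \<otimes> f = y" using assms(4) corner_iff[OF f] by simp_all
  have "y \<otimes> e = y \<otimes> (f \<otimes> e)" using y m_assoc[OF y(1) primD(1)[OF f] primD(1)[OF e]] by simp
  then show ?thesis using prim_orthogonal[OF f e] assms(3) y by simp
qed

text \<open>A nonzero \<open>x\<close> has the nonzero support \<open>x [^] (q - 1)\<close>, and a
  primitive \<open>e\<close> below it is a multiple of \<open>x \<otimes> e\<close>. This is the
  injectivity half of the product decomposition.\<close>

lemma prim_detect:
  assumes x: "x \<in> carrier R" and z: "\<And>e. e \<in> prim \<Longrightarrow> x \<otimes> e = \<zero>"
  shows "x = \<zero>"
proof (rule ccontr)
  assume n: "x \<noteq> \<zero>"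
  have fn: "x [^] (q - 1) \<noteq> \<zero>" using idempotent(1)[OF x] n x by auto
  obtain e where e: "e \<in> prim" "e \<otimes> x [^] (q - 1) = e"
    using prim_below[OF nat_pow_closed[OF x] fn idempotent(2)[OF x]] .
  have ec: "e \<in> carrier R" by (rule primD(1)[OF e(1)])
  have "e = x [^] (q - 2) \<otimes> (x \<otimes> e)"
    using e(2) unfolding pow_pred[OF x] using x ec by (simp add: m_ac)
  then have "e = \<zero>" using z[OF e(1)] x by simp
  then show False using primD(2)[OF e(1)] by simp
qed

lemma prim_ext:
  assumes "x \<in> carrier R" "y \<in> carrier R" "\<And>e. e \<in> prim \<Longrightarrow> x \<otimes> e = y \<otimes> e"
  shows "x = y"
proof -
  have "x \<ominus> y = \<zero>"
  proof (rule prim_detect)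
    fix e assume e: "e \<in> prim"
    have "(x \<ominus> y) \<otimes> e = x \<otimes> e \<ominus> y \<otimes> e" using assms(1,2) primD(1)[OF e] by algebra
    also have "\<dots> = \<zero>" unfolding assms(3)[OF e] using assms(2) primD(1)[OF e] by simp
    finally show "(x \<ominus> y) \<otimes> e = \<zero>" .
  qed (use assms in simp)
  then show ?thesis using assms by simp
qed

text \<open>Orthogonality leaves only the summand at \<open>e\<close>. This is the surjectivity half
  of the product decomposition.\<close>

lemma corner_sum:
  assumes y: "\<And>f. f \<in> prim \<Longrightarrow> y f \<in> PIdl f" and e: "e \<in> prim"
  shows "(\<Oplus>f\<in>prim. y f) \<otimes> e = y e"
proof -
  have yc: "y f \<in> carrier R" "y f \<otimes> f = y f" if "f \<in> prim" for f using y[OF that] corner_iff[OF that] by simp_all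
  have ec: "e \<in> carrier R" by (rule primD(1)[OF e])
  have t: "y f \<otimes> e = (if e = f then y f else \<zero>)" if f: "f \<in> prim" for f
  proof (cases "e = f")
    case False
    have "y f \<otimes> e = (y f \<otimes> f) \<otimes> e" using yc(2)[OF f] by simp
    also have "\<dots> = y f \<otimes> (f \<otimes> e)" by (rule m_assoc[OF yc(1)[OF f] primD(1)[OF f] ec])
    also have "\<dots> = \<zero>" using prim_orthogonal[OF f e] False yc(1)[OF f] by simp
    finally show ?thesis using False by simp
  qed (use yc(2)[OF f] in simp)
  have "(\<Oplus>f\<in>prim. y f) \<otimes> e = (\<Oplus>f\<in>prim. y f \<otimes> e)"
    using finsum_ldistr[OF finite_prim ec, of y] yc(1) by simp
  also have "\<dots> = (\<Oplus>f\<in>prim. if e = f then y f else \<zero>)"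
    using t yc(1) by (intro finsum_cong') auto
  also have "\<dots> = y e"
    using finsum_singleton[OF e finite_prim, of y] yc(1) by simp
  finally show ?thesis .
qed

lemma corner_decomposition:
  assumes x: "x \<in> carrier R"
  shows "x = (\<Oplus>e\<in>prim. x \<otimes> e)"
proof (rule prim_ext[OF x])
  show "(\<Oplus>e\<in>prim. x \<otimes> e) \<in> carrier R" using x primD(1) by (intro finsum_closed) auto
  fix e assume e: "e \<in> prim"
  show "x \<otimes> e = (\<Oplus>f\<in>prim. x \<otimes> f) \<otimes> e"
    by (rule corner_sum[OF mult_corner[OF _ x] e, symmetric])
qed

section \<open>Maximal subrings of the reduced ring\<close>

lemma maximal_misses_corner:
  assumes M: "maximal_subring R M"
  shows "\<exists>e. e \<in> prim \<and> \<not> PIdl e \<subseteq> M"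
proof (rule ccontr)
  assume neg: "\<not> ?thesis"
  then have sub: "PIdl e \<subseteq> M" if "e \<in> prim" for e using that by simp
  have "x \<in> M" if x: "x \<in> carrier R" for x
  proof -
    have "(\<Oplus>e\<in>prim. x \<otimes> e) \<in> M"
      by (rule nonunital_subring_finsum[OF maximal_subringD(1)[OF M] finite_prim])
        (rule subsetD[OF sub mult_corner[OF _ x]])
    then show ?thesis using corner_decomposition[OF x] by simp
  qed
  then have "carrier R \<subseteq> M" by (rule subsetI)
  then show False
    using maximal_subringD(2)[OF M] nonunital_subringD(1)[OF maximal_subringD(1)[OF M]] by simp
qed

text \<open>A nonzero element of \<open>PIdl e\<close> has \<open>e\<close> as a power. Once
  \<open>e\<close> is in \<open>M\<close>, it cuts off the component at \<open>e\<close> within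
  \<open>M\<close>, and \<open>R = M + PIdl e\<close> supplies all the other components. So
  \<open>M\<close> is \<open>M \<inter> PIdl e\<close> plus the full complement of
  \<open>PIdl e\<close>.\<close>

lemma meets_corner:
  assumes M: "maximal_subring R M" and e: "e \<in> prim" "\<not> PIdl e \<subseteq> M" and y: "y \<in> M" "y \<in> PIdl e" "y \<noteq> \<zero>"
  shows "e \<in> M" "\<And>x. x \<in> carrier R \<Longrightarrow> x \<ominus> x \<otimes> e \<in> M"
proof -
  have "y [^] (q - 1) \<in> M" by (rule nonunital_subring_pow[OF maximal_subringD(1)[OF M] y(1)]) (use q_gt_1 in simp)
  then show eM: "e \<in> M" using corner_pow[OF e(1) y(2,3)] by simp
  note M' = nonunital_subringD[OF maximal_subringD(1)[OF M]]
  have ec: "e \<in> carrier R" by (rule primD(1)[OF e(1)])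
  fix x assume x: "x \<in> carrier R"
  then have "x \<in> M <+> PIdl e" using maximal_subring_add_ideal[OF M corner_ideal[OF e(1)] e(2)] by simp
  then obtain m z where m: "m \<in> M" "z \<in> PIdl e" "x = m \<oplus> z" unfolding set_add_iff by (elim bexE) (rule that)
  have mc: "m \<in> carrier R" using m(1) M'(1) by (rule subsetD[rotated])
  have z: "z \<in> carrier R" "z \<otimes> e = z" using m(2) corner_iff[OF e(1)] by simp_all
  have "x \<ominus> x \<otimes> e = m \<ominus> m \<otimes> e \<oplus> (z \<ominus> z \<otimes> e)" unfolding m(3) using mc z(1) ec by algebra
  also have "\<dots> = m \<ominus> m \<otimes> e" unfolding z(2) using mc ec z(1) by simp
  finally show "x \<ominus> x \<otimes> e \<in> M"
    using nonunital_subring_minus[OF maximal_subringD(1)[OF M] m(1) M'(4)[OF m(1) eM]] by simp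
qed

text \<open>
  If \<open>M\<close> is not in the cover and \<open>M = K \<oplus> R (1 - e)\<close> for a subfield \<open>K\<close> of \<open>R e\<close>, then fixing the
  component in \<open>R e\<close> to be a generator \<open>a\<close> of \<open>K\<close> turns the cover into one of \<open>R / R e\<close>.
\<close>

lemma maximal_in_C:
  assumes M: "maximal_subring R M"
  shows "M \<in> C"
proof (rule ccontr)
  assume notin: "M \<notin> C"
  obtain e where e: "e \<in> prim" "\<not> PIdl e \<subseteq> M"
    using maximal_misses_corner[OF M] by (elim exE conjE) (rule that)
  have ec: "e \<in> carrier R" by (rule primD(1)[OF e(1)])
  note Ms = maximal_subringD(1)[OF M] and I = corner_ideal[OF e(1)] and Is = corner_subring[OF e(1)]
  note M' = nonunital_subringD[OF Ms] and I' = nonunital_subringD[OF Is]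
  have ic: "x \<in> carrier R" "x \<otimes> e = x" if "x \<in> PIdl e" for x using that corner_iff[OF e(1)] by simp_all
  have MI: "M <+> PIdl e = carrier R" by (rule maximal_subring_add_ideal[OF M I e(2)])
  \<comment> \<open>Otherwise \<open>M\<close> would complement the ideal \<open>PIdl e\<close> and
    belong to the cover already.\<close>
  obtain y where y: "y \<in> M" "y \<in> PIdl e" "y \<noteq> \<zero>"
  proof -
    have "M \<inter> PIdl e \<noteq> {\<zero>}"
      using complement_in_C[OF M I corner_nonzero[OF e(1)] _ MI] notin by auto
    then have "\<exists>y. y \<in> M \<and> y \<in> PIdl e \<and> y \<noteq> \<zero>" using M'(2) I'(2) by auto
    then show thesis using that by (elim exE conjE)
  qed
  have eM: "e \<in> M" by (rule meets_corner(1)[OF M e y])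
  define K where "K = M \<inter> PIdl e"
  have K: "nonunital_subring K R" unfolding K_def by (rule nonunital_subring_Int[OF Ms Is])
  note K' = nonunital_subringD[OF K]
  have kc: "x \<in> carrier R" if "x \<in> K" for x using that K'(1) by (rule subsetD[rotated])
  have eK: "e \<in> K" using eM prim_self[OF e(1)] by (simp add: K_def)
  have Kf: "field (R\<lparr>carrier := K, one := e\<rparr>)"
  proof (rule corner_field[OF K eK _ primD(2)[OF e(1)]])
    fix x assume x: "x \<in> K"
    then have xI: "x \<in> PIdl e" by (simp add: K_def)
    show "e \<otimes> x = x" using ic[OF xI] m_comm[OF ec] by simp
    assume xn: "x \<noteq> \<zero>"
    show "\<exists>z\<in>K. x \<otimes> z = e"
    \<comment> \<open>For \<open>q = 2\<close> the power \<open>x [^] (q - 2)\<close> is the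
      identity of \<open>R\<close>, which need not lie in \<open>K\<close>; but then
      \<open>x = e\<close>.\<close>
    proof (cases "q = 2")
      case True
      then have "x = e" using corner_pow[OF e(1) xI xn] ic(1)[OF xI] by simp
      then show ?thesis using eK primD(3)[OF e(1)] by auto
    next
      case False
      then have "q - 2 > 0" using q_gt_1 by simp
      then have "x [^] (q - 2) \<in> K" by (rule nonunital_subring_pow[OF K x])
      moreover have "x \<otimes> x [^] (q - 2) = e"
        using corner_pow[OF e(1) xI xn] pow_pred[OF ic(1)[OF xI]] m_comm[OF ic(1)[OF xI]] ic(1)[OF xI] by simp
      ultimately show ?thesis by (rule bexI[rotated])
    qed
  qed
  have Kfin: "finite (carrier (R\<lparr>carrier := K, one := e\<rparr>))"
    using finite_subset[OF K'(1) finite_carrier] by simp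
  obtain a where a0: "a \<in> carrier (R\<lparr>carrier := K, one := e\<rparr>)" "a \<noteq> \<zero>\<^bsub>R\<lparr>carrier := K, one := e\<rparr>\<^esub>"
    "\<And>x. x \<in> carrier (R\<lparr>carrier := K, one := e\<rparr>) \<Longrightarrow> x \<noteq> \<zero>\<^bsub>R\<lparr>carrier := K, one := e\<rparr>\<^esub> \<Longrightarrow>
      \<exists>i::nat. x = a [^]\<^bsub>R\<lparr>carrier := K, one := e\<rparr>\<^esub> i"
    using field.finite_field_generator[OF Kf Kfin] by metis
  have aK: "a \<in> K" and an: "a \<noteq> \<zero>" using a0 by simp_all
  have ac: "a \<in> carrier R" by (rule kc[OF aK])
  have aI: "a \<in> PIdl e" using aK by (simp add: K_def)
  have apow: "a [^]\<^bsub>R\<lparr>carrier := K, one := e\<rparr>\<^esub> i \<in> S"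
    if "nonunital_subring S R" "a \<in> S" "e \<in> S" for S and i :: nat
    using that nonunital_subringD(4)[OF that(1)] by (induction i) (simp_all add: nat_pow_def)
  \<comment> \<open>\<open>T S\<close> allows any component from \<open>K\<close> at
    \<open>e\<close>, which keeps it a subring, and it contains \<open>PIdl e\<close> by the choice
    \<open>k = \<zero>\<close>. \<open>D0\<close> keeps only the members having a point with
    component \<open>a\<close> at \<open>e\<close>; they suffice to cover \<open>R\<close>, and that
    point is used to show \<open>T S\<close> proper.\<close>
  define T where "T S = {x \<in> carrier R. \<exists>k\<in>K. k \<oplus> (x \<ominus> x \<otimes> e) \<in> S}" for S
  define D0 where "D0 = {S \<in> C. \<exists>x\<in>carrier R. a \<oplus> (x \<ominus> x \<otimes> e) \<in> S}"
  have Tsub: "nonunital_subring (T S) R" if S: "S \<in> C" for S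
  proof -
    note S' = nonunital_subringD[OF C_subring[OF S]]
    show ?thesis
    proof (rule nonunital_subringI)
      show "T S \<subseteq> carrier R" by (auto simp: T_def)
      have "\<zero> \<oplus> (\<zero> \<ominus> \<zero> \<otimes> e) \<in> S" using S'(2) ec by (simp add: a_minus_def)
      then show "\<zero> \<in> T S" using K'(2) by (auto simp: T_def)
    next
      fix x z assume "x \<in> T S" "z \<in> T S"
      then obtain k l where k: "x \<in> carrier R" "k \<in> K" "k \<oplus> (x \<ominus> x \<otimes> e) \<in> S"
        and l: "z \<in> carrier R" "l \<in> K" "l \<oplus> (z \<ominus> z \<otimes> e) \<in> S" by (auto simp: T_def)
      have c: "k \<in> carrier R" "l \<in> carrier R" using kc k l by simp_all
      have "(k \<oplus> (x \<ominus> x \<otimes> e)) \<oplus> (l \<oplus> (z \<ominus> z \<otimes> e)) = (k \<oplus> l) \<oplus> ((x \<oplus> z) \<ominus> (x \<oplus> z) \<otimes> e)"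
        using c k(1) l(1) ec by algebra
      then have "(k \<oplus> l) \<oplus> ((x \<oplus> z) \<ominus> (x \<oplus> z) \<otimes> e) \<in> S" using S'(3)[OF k(3) l(3)] by simp
      then show "x \<oplus> z \<in> T S" using K'(3)[OF k(2) l(2)] k(1) l(1) unfolding T_def by (intro CollectI conjI bexI) simp_all
      have ke: "k \<otimes> e = k" "l \<otimes> e = l" using k(2) l(2) ic(2) by (simp_all add: K_def)
      have compl: "(w \<ominus> w \<otimes> e) \<otimes> e = \<zero>" if w: "w \<in> carrier R" for w
      proof -
        have "(w \<ominus> w \<otimes> e) \<otimes> e = w \<otimes> e \<ominus> w \<otimes> (e \<otimes> e)" using w ec by algebra
        then show ?thesis unfolding primD(3)[OF e(1)] using w ec by simp
      qed
      define U where "U = x \<ominus> x \<otimes> e"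
      define V where "V = z \<ominus> z \<otimes> e"
      have XZc: "U \<in> carrier R" "V \<in> carrier R" using k(1) l(1) ec by (simp_all add: U_def V_def)
      have XZe: "U \<otimes> e = \<zero>" "V \<otimes> e = \<zero>" unfolding U_def V_def by (rule compl[OF k(1)], rule compl[OF l(1)])
      have "k \<otimes> V = (k \<otimes> e) \<otimes> V" unfolding ke by (rule refl)
      also have "\<dots> = k \<otimes> (V \<otimes> e)" using c XZc ec by algebra
      finally have kZ: "k \<otimes> V = \<zero>" unfolding XZe using c by simp
      have "U \<otimes> l = U \<otimes> (l \<otimes> e)" unfolding ke by (rule refl)
      also have "\<dots> = (U \<otimes> e) \<otimes> l" using c XZc ec by algebra
      finally have Xl: "U \<otimes> l = \<zero>" unfolding XZe using c by simp
      have "U \<otimes> V = U \<otimes> z \<ominus> (U \<otimes> e) \<otimes> z" unfolding V_def using XZc(1) l(1) ec by algebra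
      also have "\<dots> = U \<otimes> z" unfolding XZe using XZc(1) l(1) by (simp add: a_minus_def)
      also have "\<dots> = x \<otimes> z \<ominus> x \<otimes> z \<otimes> e" unfolding U_def using k(1) l(1) ec by algebra
      finally have XZ: "U \<otimes> V = x \<otimes> z \<ominus> x \<otimes> z \<otimes> e" .
      have "(k \<oplus> U) \<otimes> (l \<oplus> V) = k \<otimes> l \<oplus> k \<otimes> V \<oplus> U \<otimes> l \<oplus> U \<otimes> V" using c XZc by algebra
      also have "\<dots> = k \<otimes> l \<oplus> (x \<otimes> z \<ominus> x \<otimes> z \<otimes> e)"
        unfolding kZ Xl XZ using c k(1) l(1) ec by simp
      finally have "k \<otimes> l \<oplus> (x \<otimes> z \<ominus> x \<otimes> z \<otimes> e) \<in> S"
        using S'(4)[OF k(3) l(3)] unfolding U_def V_def by simp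
      then show "x \<otimes> z \<in> T S" using K'(4)[OF k(2) l(2)] k(1) l(1) unfolding T_def by (intro CollectI conjI bexI) simp_all
    next
      fix x assume "x \<in> T S"
      then obtain k where k: "x \<in> carrier R" "k \<in> K" "k \<oplus> (x \<ominus> x \<otimes> e) \<in> S" by (auto simp: T_def)
      have "\<ominus> (k \<oplus> (x \<ominus> x \<otimes> e)) = \<ominus> k \<oplus> (\<ominus> x \<ominus> (\<ominus> x) \<otimes> e)"
        using kc[OF k(2)] k(1) ec by (simp add: a_minus_def minus_add l_minus)
      then have "\<ominus> k \<oplus> (\<ominus> x \<ominus> (\<ominus> x) \<otimes> e) \<in> S"
        using nonunital_subring_a_inv[OF C_subring[OF S] k(3)] by simp
      then show "\<ominus> x \<in> T S"
        using nonunital_subring_a_inv[OF K k(2)] k(1) unfolding T_def by (intro CollectI conjI bexI) simp_all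
    qed
  qed
  have Tproper: "T S \<noteq> carrier R" if S: "S \<in> D0" for S
  proof
    assume T: "T S = carrier R"
    have SC: "S \<in> C" using S by (simp add: D0_def)
    obtain x0 where x0: "x0 \<in> carrier R" "a \<oplus> (x0 \<ominus> x0 \<otimes> e) \<in> S" using S unfolding D0_def by auto
    note Ss = C_subring[OF SC]
    note S' = nonunital_subringD[OF Ss]
    have Tx: "\<exists>k\<in>K. k \<oplus> (x \<ominus> x \<otimes> e) \<in> S" if "x \<in> carrier R" for x
      using that T by (auto simp: T_def)
    \<comment> \<open>Three cases. If \<open>S\<close> contains \<open>PIdl e\<close>, it absorbs
      the free component and is all of \<open>R\<close>. If it meets \<open>PIdl e\<close>
      nontrivially, it contains the full complement, hence \<open>a\<close>, hence \<open>K\<close>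
      and \<open>M\<close>, so \<open>S = M\<close>. If it meets \<open>PIdl e\<close> only in zero,
      the other components of a point of \<open>S\<close> determine the one at \<open>e\<close>,
      which cannot always lie in \<open>K\<close>.\<close>
    show False
    proof (cases "PIdl e \<subseteq> S")
      case True
      have "x \<in> S" if x: "x \<in> carrier R" for x
      proof -
        obtain k where k: "k \<in> K" "k \<oplus> (x \<ominus> x \<otimes> e) \<in> S" using Tx[OF x] by (elim bexE) (rule that)
        have kS: "k \<in> S" using k(1) True by (auto simp: K_def)
        have xS: "x \<otimes> e \<in> S" by (rule subsetD[OF True mult_corner[OF e(1) x]])
        have "((k \<oplus> (x \<ominus> x \<otimes> e)) \<ominus> k) \<oplus> x \<otimes> e \<in> S"
          by (rule S'(3)[OF nonunital_subring_minus[OF Ss k(2) kS] xS])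
        moreover have "((k \<oplus> (x \<ominus> x \<otimes> e)) \<ominus> k) \<oplus> x \<otimes> e = x" using kc[OF k(1)] x ec by algebra
        ultimately show ?thesis by simp
      qed
      then show False using C_proper[OF SC] C_carrier[OF SC] by auto
    next
      case nsub: False
      show False
      proof (cases "\<exists>z\<in>S. z \<in> PIdl e \<and> z \<noteq> \<zero>")
        case True
        then obtain z where z: "z \<in> S" "z \<in> PIdl e" "z \<noteq> \<zero>" by auto
        have eS: "e \<in> S" and SE: "\<And>x. x \<in> carrier R \<Longrightarrow> x \<ominus> x \<otimes> e \<in> S"
          using meets_corner[OF C_maximal[OF SC] e(1) nsub z] by simp_all
        have "(a \<oplus> (x0 \<ominus> x0 \<otimes> e)) \<ominus> (x0 \<ominus> x0 \<otimes> e) \<in> S"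
          by (rule nonunital_subring_minus[OF Ss x0(2) SE[OF x0(1)]])
        moreover have "(a \<oplus> (x0 \<ominus> x0 \<otimes> e)) \<ominus> (x0 \<ominus> x0 \<otimes> e) = a" using ac x0(1) ec by algebra
        ultimately have aS: "a \<in> S" by simp
        \<comment> \<open>All nonzero elements of \<open>K\<close> are powers of \<open>a\<close>,
          which is why the component was fixed to be a generator.\<close>
        have KS: "k \<in> S" if k: "k \<in> K" for k
        proof (cases "k = \<zero>")
          case False
          then have "\<exists>i::nat. k = a [^]\<^bsub>R\<lparr>carrier := K, one := e\<rparr>\<^esub> i" using a0(3)[of k] k by simp
          then show ?thesis using apow[OF Ss aS eS] by auto
        qed (use S'(2) in simp)
        have "m \<in> S" if m: "m \<in> M" for m
        proof -
          have mc: "m \<in> carrier R" using m M'(1) by (rule subsetD[rotated])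
          have "m \<otimes> e \<in> K" using M'(4)[OF m eM] mult_corner[OF e(1) mc] by (simp add: K_def)
          then have "(m \<ominus> m \<otimes> e) \<oplus> m \<otimes> e \<in> S" using S'(3)[OF SE[OF mc] KS] by simp
          moreover have "(m \<ominus> m \<otimes> e) \<oplus> m \<otimes> e = m" using mc ec by algebra
          ultimately show ?thesis by simp
        qed
        then have "M \<subseteq> S" by (rule subsetI)
        then have "S = M \<or> S = carrier R" by (rule maximal_subringD(3)[OF M Ss])
        then show False using C_proper[OF SC] SC notin by auto
      next
        case False
        then have SI: "z = \<zero>" if "z \<in> S" "z \<in> PIdl e" for z using that by auto
        define N where "N = {x \<in> carrier R. x \<otimes> e = \<zero>}"
        have N: "ideal N R"
          by (rule idealI') (auto simp: N_def ec l_distr m_assoc)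
        have nN: "x \<ominus> x \<otimes> e \<in> N" if x: "x \<in> carrier R" for x
        proof -
          have "(x \<ominus> x \<otimes> e) \<otimes> e = x \<otimes> e \<ominus> x \<otimes> (e \<otimes> e)" using x ec by algebra
          then show ?thesis unfolding N_def primD(3)[OF e(1)] using x ec by simp
        qed
        have "\<not> N \<subseteq> S"
        proof
          assume NS: "N \<subseteq> S"
          have "(a \<oplus> (x0 \<ominus> x0 \<otimes> e)) \<ominus> (x0 \<ominus> x0 \<otimes> e) \<in> S"
            by (rule nonunital_subring_minus[OF Ss x0(2) subsetD[OF NS nN[OF x0(1)]]])
          moreover have "(a \<oplus> (x0 \<ominus> x0 \<otimes> e)) \<ominus> (x0 \<ominus> x0 \<otimes> e) = a" using ac x0(1) ec by algebra
          ultimately have "a \<in> S" by simp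
          then show False using SI aI an by simp
        qed
        then have SN: "S <+> N = carrier R" by (rule maximal_subring_add_ideal[OF C_maximal[OF SC] N])
        have "\<not> PIdl e \<subseteq> K" using e(2) by (auto simp: K_def)
        \<comment> \<open>Some point \<open>s\<close> of \<open>S\<close> has component
          \<open>u\<close> at \<open>e\<close>. The point provided by \<open>T S = carrier R\<close>
          agrees with it elsewhere but has its component at \<open>e\<close> in \<open>K\<close>;
          the difference is a nonzero element of \<open>S\<close> in \<open>PIdl e\<close>.\<close>
        then obtain u where u: "u \<in> PIdl e" "u \<notin> K" by auto
        have uc: "u \<in> carrier R" by (rule ic(1)[OF u(1)])
        then have "u \<in> S <+> N" using SN by simp
        then obtain s n where s: "s \<in> S" "n \<in> N" "u = s \<oplus> n" unfolding set_add_iff by (elim bexE) (rule that)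
        have nc: "n \<in> carrier R" "n \<otimes> e = \<zero>" using s(2) by (simp_all add: N_def)
        have sc: "s \<in> carrier R" using s(1) S'(1) by (rule subsetD[rotated])
        have zc: "\<ominus> n \<in> carrier R" using nc by simp
        obtain k where k: "k \<in> K" "k \<oplus> (\<ominus> n \<ominus> (\<ominus> n) \<otimes> e) \<in> S" using Tx[OF zc] by (elim bexE) (rule that)
        have "(\<ominus> n) \<otimes> e = \<zero>" using nc ec by (simp add: l_minus)
        then have kS: "k \<oplus> \<ominus> n \<in> S" using k(2) zc by (simp add: a_minus_def)
        have "s \<ominus> (k \<oplus> \<ominus> n) \<in> S" by (rule nonunital_subring_minus[OF Ss s(1) kS])
        moreover have "s \<ominus> (k \<oplus> \<ominus> n) = u \<ominus> k" unfolding s(3) using sc nc(1) kc[OF k(1)] by algebra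
        ultimately have "u \<ominus> k \<in> S" by simp
        moreover have "u \<ominus> k \<in> PIdl e"
          by (rule nonunital_subring_minus[OF Is u(1)]) (use k(1) in \<open>simp add: K_def\<close>)
        ultimately have "u \<ominus> k = \<zero>" by (rule SI)
        then have "u = k" using uc kc[OF k(1)] by simp
        then show False using u(2) k(1) by simp
      qed
    qed
  qed
  have "PIdl e = {\<zero>}"
  proof (rule elementary[OF I])
    show "ring_cover R (T ` D0)"
      unfolding ring_cover_def
    proof (intro conjI ballI)
      fix S assume "S \<in> T ` D0"
      then obtain S0 where S0: "S0 \<in> D0" "S = T S0" by (elim imageE) (rule that)
      then have "S0 \<in> C" by (simp add: D0_def)
      then show "nonunital_subring S R" "S \<noteq> carrier R" using Tsub Tproper[OF S0(1)] S0(2) by simp_all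
    next
      show "\<Union>(T ` D0) = carrier R"
      proof (intro equalityI subsetI)
        fix x assume "x \<in> \<Union>(T ` D0)"
        then show "x \<in> carrier R" by (auto simp: T_def)
      next
        fix x assume x: "x \<in> carrier R"
        have "a \<oplus> (x \<ominus> x \<otimes> e) \<in> carrier R" using ac x ec by simp
        then obtain S where S: "S \<in> C" "a \<oplus> (x \<ominus> x \<otimes> e) \<in> S" by (rule C_covers)
        then have "S \<in> D0" using x by (auto simp: D0_def)
        moreover have "x \<in> T S" using S(2) x aK by (auto simp: T_def)
        ultimately show "x \<in> \<Union>(T ` D0)" by (rule UN_I)
      qed
    qed
    show "PIdl e \<subseteq> S" if S: "S \<in> T ` D0" for S
    proof
      fix x assume x: "x \<in> PIdl e"
      obtain S0 where S0: "S0 \<in> D0" "S = T S0" using S by (elim imageE) (rule that)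
      have "\<zero> \<oplus> (x \<ominus> x \<otimes> e) = \<zero>" using ic[OF x] by (simp add: a_minus_def r_neg)
      moreover have "\<zero> \<in> S0" using S0(1) nonunital_subringD(2)[OF C_subring] by (simp add: D0_def)
      ultimately show "x \<in> S" unfolding S0(2) T_def using ic(1)[OF x] K'(2) by (intro CollectI conjI bexI[of _ \<zero>]) simp_all
    qed
    have "card (T ` D0) \<le> card D0" by (rule card_image_le) (use finite_C in \<open>simp add: D0_def\<close>)
    also have "\<dots> \<le> card C" by (rule card_mono[OF finite_C]) (auto simp: D0_def)
    finally show "card (T ` D0) \<le> card C" .
  qed
  then show False using corner_nonzero[OF e(1)] by simp
qed

text \<open>Every maximal subring is in \<open>C\<close>. If each \<open>x\<close> lay in a proper
  subring over \<open>I\<close>, the members over \<open>I\<close> would cover \<open>R\<close> and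
  \<open>I\<close> would be zero.\<close>

lemma generator_modulo_ideal:
  assumes I: "ideal I R" "I \<noteq> {\<zero>}"
  obtains x where "x \<in> carrier R"
    "\<And>T. nonunital_subring T R \<Longrightarrow> x \<in> T \<Longrightarrow> I \<subseteq> T \<Longrightarrow> T = carrier R"
proof -
  have "\<exists>x\<in>carrier R. \<forall>T. nonunital_subring T R \<longrightarrow> x \<in> T \<longrightarrow> I \<subseteq> T \<longrightarrow> T = carrier R"
  proof (rule ccontr)
    assume neg: "\<not> ?thesis"
    have "carrier R \<subseteq> \<Union>{M \<in> C. I \<subseteq> M}"
    proof
      fix x assume "x \<in> carrier R"
      then have "\<exists>T. nonunital_subring T R \<and> x \<in> T \<and> I \<subseteq> T \<and> T \<noteq> carrier R" using neg by simp
      then obtain T where T: "nonunital_subring T R" "x \<in> T" "I \<subseteq> T" "T \<noteq> carrier R"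
        by (elim exE conjE) (rule that)
      obtain M where M: "maximal_subring R M" "T \<subseteq> M"
        using maximal_subring_exists[OF finite_carrier T(1,4)] by (elim exE conjE) (rule that)
      have "M \<in> C" by (rule maximal_in_C[OF M(1)])
      then show "x \<in> \<Union>{M \<in> C. I \<subseteq> M}" using M(2) T(2,3) by auto
    qed
    then have "I = {\<zero>}" by (intro elementary_subset[OF I(1), of "{M \<in> C. I \<subseteq> M}"]) auto
    then show False using I(2) by simp
  qed
  then show thesis using that by (elim bexE) simp
qed

end

section \<open>Counting the primitive idempotents\<close>

lemma (in cring) peval_in_subring:
  assumes S: "nonunital_subring S R" and one: "\<one> \<in> S" and x: "x \<in> S"
    and l: "\<And>a. a \<in> set l \<Longrightarrow> \<iota> a \<in> S"
  shows "peval R \<iota> l x \<in> S"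
  using l
proof (induction l)
  case Nil
  then show ?case using nonunital_subringD(2)[OF S] by (simp add: peval_def)
next
  case (Cons a l)
  have "x [^] n \<in> S" for n :: nat
    using nonunital_subring_pow[OF S x, of n] one by (cases "n = 0") simp_all
  then have "\<iota> a \<otimes> x [^] length l \<in> S" using Cons.prems nonunital_subringD(4)[OF S] by simp
  then show ?case using Cons nonunital_subringD(3)[OF S] by (simp add: peval_def)
qed

lemma (in ring) nonunital_subring_add_pow_int:
  assumes S: "nonunital_subring S R" and x: "x \<in> S"
  shows "[(a::int)] \<cdot> x \<in> S"
proof (cases "a \<ge> 0")
  case True
  then show ?thesis using nonunital_subring_add_pow[OF S x] by (simp add: add_pow_int_ge)
next
  case False
  then show ?thesis
    using nonunital_subring_a_inv[OF S nonunital_subring_add_pow[OF S x]] by (simp add: add_pow_int_lt)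
qed

section \<open>Components over the prime field\<close>

context reduced_frobenius_ring
begin

abbreviation "prime_field \<equiv> residue_ring (int p)"
abbreviation "polys \<equiv> carrier (poly_ring prime_field)"

definition iota :: "int \<Rightarrow> 'a" where "iota a = [a] \<cdot> \<one>"

lemma iota_hom: "iota \<in> Ring.ring_hom prime_field R"
  unfolding iota_def[abs_def] by (rule residue_ring_hom[OF p_prime p_zero])

lemmas prime_field = residue_ring_prime[OF p_prime]

definition "corner e = R\<lparr>carrier := PIdl e, one := e\<rparr>"

lemma corner_simps: "carrier (corner e) = PIdl e" "\<one>\<^bsub>corner e\<^esub> = e" "\<zero>\<^bsub>corner e\<^esub> = \<zero>"
  by (simp_all add: corner_def)

lemma corner_is_field:
  assumes e: "e \<in> prim"
  shows "field (corner e)" "finite (carrier (corner e))"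
proof -
  have ec: "e \<in> carrier R" by (rule primD(1)[OF e])
  show "field (corner e)"
    unfolding corner_def
  proof (rule corner_field[OF corner_subring[OF e] prim_self[OF e] _ primD(2)[OF e]])
    fix x assume x: "x \<in> PIdl e"
    then have xc: "x \<in> carrier R" "x \<otimes> e = x" using corner_iff[OF e] by simp_all
    show "e \<otimes> x = x" using xc m_comm[OF ec] by simp
    assume xn: "x \<noteq> \<zero>"
    \<comment> \<open>The factor \<open>e\<close> matters for \<open>q = 2\<close>, where the power
      alone is the identity of \<open>R\<close>.\<close>
    have "x [^] (q - 2) \<otimes> e \<in> PIdl e" by (rule mult_corner[OF e]) (use xc in simp)
    moreover have "x \<otimes> (x [^] (q - 2) \<otimes> e) = (x [^] (q - 2) \<otimes> x) \<otimes> e"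
      using xc(1) ec nat_pow_closed[OF xc(1)] by (simp add: m_ac)
    then have "x \<otimes> (x [^] (q - 2) \<otimes> e) = e"
      using corner_pow[OF e x xn] pow_pred[OF xc(1)] primD(3)[OF e] by simp
    ultimately show "\<exists>y\<in>PIdl e. x \<otimes> y = e" by (rule bexI[rotated])
  qed
  show "finite (carrier (corner e))"
    unfolding corner_simps using finite_subset[OF nonunital_subringD(1)[OF corner_subring[OF e]] finite_carrier] .
qed

lemma corner_proj:
  assumes e: "e \<in> prim"
  shows "ring_hom_ring R (corner e) (\<lambda>x. x \<otimes> e)"
proof (rule ring_hom_ringI2[OF ring_axioms field.is_ring[OF corner_is_field(1)[OF e]]], rule ring_hom_memI)
  note e' = primD[OF e]
  fix x assume x: "x \<in> carrier R"
  show "x \<otimes> e \<in> carrier (corner e)" unfolding corner_simps by (rule mult_corner[OF e x])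
  fix y assume y: "y \<in> carrier R"
  have "(x \<otimes> e) \<otimes> (y \<otimes> e) = (x \<otimes> y) \<otimes> (e \<otimes> e)" using x y e'(1) by algebra
  then show "x \<otimes> y \<otimes> e = x \<otimes> e \<otimes>\<^bsub>corner e\<^esub> (y \<otimes> e)" using e'(3) by (simp add: corner_def)
  show "(x \<oplus> y) \<otimes> e = x \<otimes> e \<oplus>\<^bsub>corner e\<^esub> y \<otimes> e" using x y e'(1) by (simp add: corner_def l_distr)
next
  show "\<one> \<otimes> e = \<one>\<^bsub>corner e\<^esub>" unfolding corner_simps by (rule l_one[OF primD(1)[OF e]])
qed

definition "corner_iota e = (\<lambda>x. x \<otimes> e) \<circ> iota"

lemma corner_iota_hom: "e \<in> prim \<Longrightarrow> corner_iota e \<in> Ring.ring_hom prime_field (corner e)"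
  unfolding corner_iota_def by (rule ring_hom_trans[OF iota_hom ring_hom_ring.homh[OF corner_proj]])

definition "ev f x = peval R iota f x"

lemma ev_hom: "x \<in> carrier R \<Longrightarrow> ring_hom_ring (poly_ring prime_field) R (\<lambda>f. ev f x)"
  unfolding ev_def by (rule peval_hom[OF prime_field(1) is_cring iota_hom])

lemma ev_closed: "x \<in> carrier R \<Longrightarrow> f \<in> polys \<Longrightarrow> ev f x \<in> carrier R"
  by (rule ring_hom_closed[OF ring_hom_ring.homh[OF ev_hom]])

lemma ev_corner:
  assumes "e \<in> prim" "x \<in> carrier R" "f \<in> polys"
  shows "ev f x \<otimes> e = peval (corner e) (corner_iota e) f (x \<otimes> e)"
  unfolding ev_def corner_iota_def
  by (rule peval_comp[OF prime_field(1) corner_proj[OF assms(1)] iota_hom assms(2,3)])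

lemma proj_carrier: "e \<in> prim \<Longrightarrow> x \<in> carrier R \<Longrightarrow> x \<otimes> e \<in> carrier (corner e)"
  unfolding corner_simps by (rule mult_corner)

lemma var_polys: "X\<^bsub>prime_field\<^esub> \<in> polys"
  using domain.var_closed(1)[OF field.axioms(1)[OF prime_field(1)] ring.carrier_is_subring[OF field.is_ring[OF prime_field(1)]]] .

lemma ev_var: "x \<in> carrier R \<Longrightarrow> ev X\<^bsub>prime_field\<^esub> x = x"
  unfolding ev_def by (rule peval_X[OF prime_field(1) is_cring iota_hom])

text \<open>The minimal polynomial over the prime field of the component of \<open>x\<close> at
  \<open>e\<close>. Vanishing is expressed in \<open>R\<close> itself, so that different
  \<open>e\<close> can be compared through one \<open>ev f x\<close>.\<close>

definition mp :: "'a \<Rightarrow> 'a \<Rightarrow> int list" where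
  "mp e x = (SOME g. monic_irreducible prime_field g \<and>
     (\<forall>f\<in>polys. ev f x \<otimes> e = \<zero> \<longleftrightarrow> g pdivides\<^bsub>prime_field\<^esub> f))"

lemma mp:
  assumes e: "e \<in> prim" and x: "x \<in> carrier R"
  shows "monic_irreducible prime_field (mp e x)"
    "\<And>f. f \<in> polys \<Longrightarrow> ev f x \<otimes> e = \<zero> \<longleftrightarrow> mp e x pdivides\<^bsub>prime_field\<^esub> f"
proof -
  have "\<exists>g. monic_irreducible prime_field g \<and> (\<forall>f\<in>polys. ev f x \<otimes> e = \<zero> \<longleftrightarrow> g pdivides\<^bsub>prime_field\<^esub> f)"
  proof -
    obtain g where g: "monic_irreducible prime_field g"
      "\<And>f. f \<in> polys \<Longrightarrow> peval (corner e) (corner_iota e) f (x \<otimes> e) = \<zero>\<^bsub>corner e\<^esub> \<longleftrightarrow> g pdivides\<^bsub>prime_field\<^esub> f"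
      using minimal_polynomial_exists[OF prime_field(1) corner_is_field[OF e] corner_iota_hom[OF e] proj_carrier[OF e x]]
      by metis
    have "ev f x \<otimes> e = \<zero> \<longleftrightarrow> g pdivides\<^bsub>prime_field\<^esub> f" if f: "f \<in> polys" for f
      unfolding ev_corner[OF e x f] using g(2)[OF f] by (simp add: corner_simps)
    then show ?thesis using g(1) by (intro exI[of _ g]) simp
  qed
  from someI_ex[OF this]
  show "monic_irreducible prime_field (mp e x)"
    "\<And>f. f \<in> polys \<Longrightarrow> ev f x \<otimes> e = \<zero> \<longleftrightarrow> mp e x pdivides\<^bsub>prime_field\<^esub> f"
    unfolding mp_def[symmetric] by simp_all
qed

lemma monic_irreducible_polys: "monic_irreducible prime_field g \<Longrightarrow> g \<in> polys"
  by (simp add: monic_irreducible_def)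

lemma monic_irreducible_self_dvd: "g \<in> polys \<Longrightarrow> g pdivides\<^bsub>prime_field\<^esub> g"
proof -
  interpret P: domain "poly_ring prime_field"
    by (rule domain.univ_poly_is_domain[OF field.axioms(1)[OF prime_field(1)] ring.carrier_is_subring[OF field.is_ring[OF prime_field(1)]]])
  show "g \<in> polys \<Longrightarrow> ?thesis" unfolding pdivides_def by (rule P.divides_refl)
qed

lemma mp_eqI:
  assumes e: "e \<in> prim" and x: "x \<in> carrier R" and g: "monic_irreducible prime_field g" "ev g x \<otimes> e = \<zero>"
  shows "mp e x = g"
proof (rule field.monic_irreducible_unique[OF prime_field(1) mp(1)[OF e x] g(1)])
  show "mp e x pdivides\<^bsub>prime_field\<^esub> g" using mp(2)[OF e x monic_irreducible_polys[OF g(1)]] g(2) by simp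
qed

lemma mp_root: "e \<in> prim \<Longrightarrow> x \<in> carrier R \<Longrightarrow> ev (mp e x) x \<otimes> e = \<zero>"
  using mp(2)[of e x "mp e x"] monic_irreducible_self_dvd monic_irreducible_polys mp(1) by simp

lemma mp_card:
  assumes e: "e \<in> prim" and x: "x \<in> carrier R" and gen: "(\<lambda>f. ev f x \<otimes> e) ` polys = PIdl e"
  shows "card (PIdl e) = p ^ Polynomials.degree (mp e x)"
proof -
  have z: "peval (corner e) (corner_iota e) (mp e x) (x \<otimes> e) = \<zero>\<^bsub>corner e\<^esub>"
    using mp_root[OF e x] ev_corner[OF e x monic_irreducible_polys[OF mp(1)[OF e x]]] by (simp add: corner_simps)
  have "(\<lambda>f. ev f x \<otimes> e) ` polys = (\<lambda>f. peval (corner e) (corner_iota e) f (x \<otimes> e)) ` polys"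
    by (rule image_cong[OF refl ev_corner[OF e x]])
  then show ?thesis
    using root_range_card[OF prime_field(1,3) corner_is_field[OF e] corner_iota_hom[OF e] proj_carrier[OF e x] mp(1)[OF e x] z]
      gen prime_field(4) by simp
qed

text \<open>The elements whose components on \<open>A\<close> come from one common polynomial in
  \<open>x\<close> form a subring containing \<open>x\<close> and, by the zero polynomial,
  \<open>I\<close>; so they are all of \<open>R\<close>. That \<open>f\<close> is the same for all
  of \<open>A\<close> is what separates components.\<close>

lemma interpolation:
  assumes x: "x \<in> carrier R" "\<And>T. nonunital_subring T R \<Longrightarrow> x \<in> T \<Longrightarrow> I \<subseteq> T \<Longrightarrow> T = carrier R"
    and I: "I \<subseteq> carrier R" and A: "A \<subseteq> prim" "\<And>e y. e \<in> A \<Longrightarrow> y \<in> I \<Longrightarrow> y \<otimes> e = \<zero>"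
    and y: "y \<in> carrier R"
  obtains f where "f \<in> polys" "\<And>e. e \<in> A \<Longrightarrow> y \<otimes> e = ev f x \<otimes> e"
proof -
  interpret h: ring_hom_ring "poly_ring prime_field" R "\<lambda>f. ev f x" by (rule ev_hom[OF x(1)])
  define T where "T = {y \<in> carrier R. \<exists>f\<in>polys. \<forall>e\<in>A. y \<otimes> e = ev f x \<otimes> e}"
  have ec: "e \<in> carrier R" "e \<otimes> e = e" if "e \<in> A" for e using that A(1) primD(1,3) by auto
  have "T = carrier R"
  proof (rule x(2))
    show "nonunital_subring T R"
    proof (rule nonunital_subringI)
      show "T \<subseteq> carrier R" by (auto simp: T_def)
      have "\<zero> \<otimes> e = ev \<zero>\<^bsub>poly_ring prime_field\<^esub> x \<otimes> e" for e by simp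
      then show "\<zero> \<in> T" unfolding T_def using h.R.zero_closed
        by (intro CollectI conjI bexI[of _ "\<zero>\<^bsub>poly_ring prime_field\<^esub>"] ballI) simp_all
    next
      fix u v assume "u \<in> T" "v \<in> T"
      then obtain f g where u: "u \<in> carrier R" "f \<in> polys" "\<forall>e\<in>A. u \<otimes> e = ev f x \<otimes> e"
        and v: "v \<in> carrier R" "g \<in> polys" "\<forall>e\<in>A. v \<otimes> e = ev g x \<otimes> e" unfolding T_def by auto
      have fc: "ev f x \<in> carrier R" "ev g x \<in> carrier R" using ev_closed[OF x(1)] u(2) v(2) by simp_all
      have "(u \<oplus> v) \<otimes> e = ev (f \<oplus>\<^bsub>poly_ring prime_field\<^esub> g) x \<otimes> e" if e: "e \<in> A" for e
        using u v fc e ec(1)[OF e] by (simp add: l_distr)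
      then show "u \<oplus> v \<in> T" unfolding T_def using u v h.R.add.m_closed[OF u(2) v(2)]
        by (intro CollectI conjI bexI[of _ "f \<oplus>\<^bsub>poly_ring prime_field\<^esub> g"] ballI) simp_all
      have "(u \<otimes> v) \<otimes> e = ev (f \<otimes>\<^bsub>poly_ring prime_field\<^esub> g) x \<otimes> e" if e: "e \<in> A" for e
      proof -
        have "(u \<otimes> v) \<otimes> (e \<otimes> e) = (u \<otimes> e) \<otimes> (v \<otimes> e)" using u(1) v(1) ec(1)[OF e] by algebra
        also have "\<dots> = (ev f x \<otimes> e) \<otimes> (ev g x \<otimes> e)" using u(3) v(3) e by simp
        also have "\<dots> = (ev f x \<otimes> ev g x) \<otimes> (e \<otimes> e)" using fc ec(1)[OF e] by algebra
        finally show ?thesis using ec(2)[OF e] u(2) v(2) by simp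
      qed
      then show "u \<otimes> v \<in> T" unfolding T_def using u v h.R.m_closed[OF u(2) v(2)]
        by (intro CollectI conjI bexI[of _ "f \<otimes>\<^bsub>poly_ring prime_field\<^esub> g"] ballI) simp_all
    next
      fix u assume "u \<in> T"
      then obtain f where u: "u \<in> carrier R" "f \<in> polys" "\<forall>e\<in>A. u \<otimes> e = ev f x \<otimes> e" unfolding T_def by auto
      have "(\<ominus> u) \<otimes> e = ev (\<ominus>\<^bsub>poly_ring prime_field\<^esub> f) x \<otimes> e" if e: "e \<in> A" for e
        using u e ec(1)[OF e] ev_closed[OF x(1) u(2)] by (simp add: l_minus)
      then show "\<ominus> u \<in> T" unfolding T_def using u h.R.a_inv_closed[OF u(2)]
        by (intro CollectI conjI bexI[of _ "\<ominus>\<^bsub>poly_ring prime_field\<^esub> f"] ballI) simp_all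
    qed
    show "x \<in> T" unfolding T_def using x(1) var_polys ev_var[OF x(1)]
      by (intro CollectI conjI bexI[of _ "X\<^bsub>prime_field\<^esub>"] ballI) simp_all
    show "I \<subseteq> T"
    proof
      fix y assume y: "y \<in> I"
      have "y \<otimes> e = ev \<zero>\<^bsub>poly_ring prime_field\<^esub> x \<otimes> e" if "e \<in> A" for e
        using A(2)[OF that y] ec(1)[OF that] by simp
      then show "y \<in> T" unfolding T_def using I y h.R.zero_closed
        by (intro CollectI conjI bexI[of _ "\<zero>\<^bsub>poly_ring prime_field\<^esub>"] ballI) auto
    qed
  qed
  then have "y \<in> T" using y by simp
  then show thesis unfolding T_def using that by auto
qed

text \<open>Elements vanishing at \<open>e\<close> form a proper subring, without the identity,
  which would contain \<open>x\<close> and \<open>I\<close>. This rules out \<open>X\<close> as a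
  minimal polynomial.\<close>

lemma generator_proj_nonzero:
  assumes x: "x \<in> carrier R" "\<And>T. nonunital_subring T R \<Longrightarrow> x \<in> T \<Longrightarrow> I \<subseteq> T \<Longrightarrow> T = carrier R"
    and I: "I \<subseteq> carrier R" and e: "e \<in> prim" "\<And>y. y \<in> I \<Longrightarrow> y \<otimes> e = \<zero>"
  shows "x \<otimes> e \<noteq> \<zero>"
proof
  assume z: "x \<otimes> e = \<zero>"
  have ec: "e \<in> carrier R" by (rule primD(1)[OF e(1)])
  have "{y \<in> carrier R. y \<otimes> e = \<zero>} = carrier R"
  proof (rule x(2))
    show "nonunital_subring {y \<in> carrier R. y \<otimes> e = \<zero>} R"
      by (rule nonunital_subringI) (auto simp: ec l_distr l_minus m_assoc)
    show "x \<in> {y \<in> carrier R. y \<otimes> e = \<zero>}" using x(1) z by simp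
    show "I \<subseteq> {y \<in> carrier R. y \<otimes> e = \<zero>}" using I e(2) by auto
  qed
  then have "e \<otimes> e = \<zero>" using ec by auto
  then show False using primD(2,3)[OF e(1)] by simp
qed

lemma generator_range:
  assumes x: "x \<in> carrier R" "\<And>T. nonunital_subring T R \<Longrightarrow> x \<in> T \<Longrightarrow> I \<subseteq> T \<Longrightarrow> T = carrier R"
    and I: "I \<subseteq> carrier R" and e: "e \<in> prim" "\<And>y. y \<in> I \<Longrightarrow> y \<otimes> e = \<zero>"
  shows "(\<lambda>f. ev f x \<otimes> e) ` polys = PIdl e"
proof (intro equalityI subsetI)
  fix y assume "y \<in> (\<lambda>f. ev f x \<otimes> e) ` polys"
  then obtain f where "f \<in> polys" "y = ev f x \<otimes> e" by (elim imageE) (rule that)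
  then show "y \<in> PIdl e" using mult_corner[OF e(1) ev_closed[OF x(1)]] by simp
next
  fix y assume "y \<in> PIdl e"
  then have y: "y \<in> carrier R" "y \<otimes> e = y" using corner_iff[OF e(1)] by simp_all
  obtain f where f: "f \<in> polys" "\<And>e'. e' \<in> {e} \<Longrightarrow> y \<otimes> e' = ev f x \<otimes> e'"
    by (rule interpolation[of x I "{e}" y]) (use x I e y in auto)
  have "y = ev f x \<otimes> e" using f(2)[of e] y(2) by simp
  then show "y \<in> (\<lambda>f. ev f x \<otimes> e) ` polys" using f(1) by (rule image_eqI)
qed

text \<open>For a generator \<open>x\<close> modulo \<open>I\<close>, the map
  \<open>e \<mapsto> mp e x\<close> is injective: by \<open>interpolation\<close> some polynomial in
  \<open>x\<close> vanishes at \<open>f\<close> but not at \<open>e\<close>, so the minimal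
  polynomials there differ. Their degree is \<open>d\<close> since the component generates a field
  of order \<open>p ^ d\<close>, and they are not \<open>X\<close> by
  \<open>generator_proj_nonzero\<close>.\<close>

lemma card_prim_le:
  assumes I: "ideal I R" "I \<noteq> {\<zero>}" and A: "A \<subseteq> prim" "\<And>e y. e \<in> A \<Longrightarrow> y \<in> I \<Longrightarrow> y \<otimes> e = \<zero>"
    and card: "\<And>e. e \<in> A \<Longrightarrow> card (PIdl e) = p ^ d"
  shows "card A \<le> card (eligible_polys p d)"
proof -
  obtain x where x: "x \<in> carrier R" "\<And>T. nonunital_subring T R \<Longrightarrow> x \<in> T \<Longrightarrow> I \<subseteq> T \<Longrightarrow> T = carrier R"
    using generator_modulo_ideal[OF I] by metis
  have Ic: "I \<subseteq> carrier R" by (rule nonunital_subringD(1)[OF ideal_nonunital_subring[OF I(1)]])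
  have pe: "e \<in> prim" if "e \<in> A" for e using that A(1) by auto
  show ?thesis
  proof (rule card_inj_on_le[OF _ _ finite_eligible_polys[OF p_prime]])
    show "inj_on (\<lambda>e. mp e x) A"
    proof (rule inj_onI, rule ccontr)
      fix e f assume ef: "e \<in> A" "f \<in> A" "mp e x = mp f x" "e \<noteq> f"
      have e: "e \<in> prim" and f: "f \<in> prim" using pe ef by simp_all
      obtain g where g: "g \<in> polys" "\<And>e'. e' \<in> {e, f} \<Longrightarrow> e \<otimes> e' = ev g x \<otimes> e'"
        by (rule interpolation[of x I "{e, f}" e]) (use x Ic A ef(1,2) e f primD(1)[OF e] in auto)
      have "ev g x \<otimes> f = \<zero>" using g(2)[of f] prim_orthogonal[OF e f ef(4)] by simp
      then have "mp f x pdivides\<^bsub>prime_field\<^esub> g" using mp(2)[OF f x(1) g(1)] by simp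
      then have "ev g x \<otimes> e = \<zero>" using mp(2)[OF e x(1) g(1)] ef(3) by simp
      then show False using g(2)[of e] primD(2,3)[OF e] by simp
    qed
    show "(\<lambda>e. mp e x) ` A \<subseteq> eligible_polys p d"
    proof
      fix g assume "g \<in> (\<lambda>e. mp e x) ` A"
      then obtain e where eA: "e \<in> A" "g = mp e x" by (elim imageE) (rule that)
      have e: "e \<in> prim" by (rule pe[OF eA(1)])
      have "p ^ Polynomials.degree g = p ^ d"
        using mp_card[OF e x(1) generator_range[OF x Ic e A(2)[OF eA(1)]]] card[OF eA(1)] eA(2) by simp
      then have "Polynomials.degree g = d" using prime_gt_1_nat[OF p_prime] by (simp add: power_inject_exp)
      moreover have "g \<noteq> X\<^bsub>prime_field\<^esub>"
      proof
        assume "g = X\<^bsub>prime_field\<^esub>"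
        then have "x \<otimes> e = \<zero>" using mp_root[OF e x(1)] ev_var[OF x(1)] eA(2) by simp
        then show False using generator_proj_nonzero[OF x Ic e A(2)[OF eA(1)]] by simp
      qed
      ultimately show "g \<in> eligible_polys p d" using mp(1)[OF e x(1)] eA(2) by (simp add: eligible_polys_def)
    qed
  qed
qed

text \<open>The support of \<open>x\<close> is the sum of the primitive idempotents at which
  \<open>x\<close> does not vanish.\<close>

lemma pow_corner:
  assumes e: "e \<in> prim" and x: "x \<in> carrier R"
  shows "x [^] (q - 1) \<otimes> e = (if x \<otimes> e = \<zero> then \<zero> else e)"
proof -
  have "(x \<otimes> e) [^] (q - 1) = x [^] (q - 1) \<otimes> e [^] (q - 1)"
    by (rule nat_pow_distrib[OF x primD(1)[OF e]])
  also have "e [^] (q - 1) = e" by (rule corner_pow[OF e prim_self[OF e] primD(2)[OF e]])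
  finally have p: "x [^] (q - 1) \<otimes> e = (x \<otimes> e) [^] (q - 1)" by simp
  show ?thesis
  proof (cases "x \<otimes> e = \<zero>")
    case True
    have "q - 1 \<noteq> 0" using q_gt_1 by simp
    then show ?thesis unfolding p True by (simp add: nat_pow_zero)
  next
    case False
    then show ?thesis unfolding p using corner_pow[OF e mult_corner[OF e x]] by simp
  qed
qed

text \<open>
  Otherwise let \<open>z\<close> be \<open>x\<close> with its component at \<open>e0\<close> replaced by a root of \<open>g\<close>.  Then \<open>z\<close>
  is a unit, and \<open>g z\<close> vanishes at \<open>e0\<close> only, so a subring containing \<open>z\<close> contains \<open>e0\<close>,
  then \<open>R e0\<close>, then \<open>x\<close>, and is all of \<open>R\<close>: no member of the cover contains \<open>z\<close>.
\<close>

lemma eligible_poly_kills_corner: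
  assumes e0: "e0 \<in> prim" and card0: "card (PIdl e0) = p ^ d" and g: "g \<in> eligible_polys p d"
    and x: "x \<in> carrier R" "\<And>T. nonunital_subring T R \<Longrightarrow> x \<in> T \<Longrightarrow> PIdl e0 \<subseteq> T \<Longrightarrow> T = carrier R"
  shows "\<exists>e\<in>prim. e \<noteq> e0 \<and> ev g x \<otimes> e = \<zero>"
proof (rule ccontr)
  assume neg: "\<not> ?thesis"
  have gm: "monic_irreducible prime_field g" and gd: "Polynomials.degree g = d" and gX: "g \<noteq> X\<^bsub>prime_field\<^esub>"
    using g by (simp_all add: eligible_polys_def)
  have gP: "g \<in> polys" by (rule monic_irreducible_polys[OF gm])
  have e0c: "e0 \<in> carrier R" by (rule primD(1)[OF e0])
  have I: "PIdl e0 \<subseteq> carrier R" by (rule nonunital_subringD(1)[OF corner_subring[OF e0]])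
  have kill: "y \<otimes> e = \<zero>" if e: "e \<in> prim" "e \<noteq> e0" and y: "y \<in> PIdl e0" for e y
    by (rule prim_orthogonal_corner[OF e(1) e0 e(2) y])
  have cardF: "card (carrier (corner e0)) = card (carrier prime_field) ^ Polynomials.degree g"
    using card0 gd prime_field(4) by (simp add: corner_simps)
  obtain u where u: "u \<in> carrier (corner e0)" "peval (corner e0) (corner_iota e0) g u = \<zero>\<^bsub>corner e0\<^esub>"
    using root_exists[OF prime_field(1,3) corner_is_field[OF e0] corner_iota_hom[OF e0] gm cardF]
    by (elim bexE) (rule that)
  have uI: "u \<in> PIdl e0" using u(1) by (simp add: corner_simps)
  then have uc: "u \<in> carrier R" "u \<otimes> e0 = u" using corner_iff[OF e0] by simp_all
  \<comment> \<open>At \<open>u = \<zero>\<close> both \<open>g\<close> and \<open>X\<close> would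
    be the minimal polynomial, but \<open>g\<close> is not \<open>X\<close>.\<close>
  have un: "u \<noteq> \<zero>"
  proof
    assume "u = \<zero>"
    then have "ev g \<zero> \<otimes> e0 = \<zero>" "ev X\<^bsub>prime_field\<^esub> \<zero> \<otimes> e0 = \<zero>"
      using ev_corner[OF e0 uc(1) gP] u(2) uc(2) ev_var[OF zero_closed] e0c by (simp_all add: corner_simps)
    moreover have "monic_irreducible prime_field X\<^bsub>prime_field\<^esub>"
      unfolding monic_irreducible_def
      using var_polys domain.degree_one_imp_pirreducible[OF field.axioms(1)[OF prime_field(1)]
        field.carrier_is_subfield[OF prime_field(1)] var_polys] by (simp add: var_def)
    ultimately have "g = X\<^bsub>prime_field\<^esub>" using mp_eqI[OF e0 zero_closed] gm by metis
    then show False using gX by simp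
  qed
  define z where "z = (x \<ominus> x \<otimes> e0) \<oplus> u"
  have zc: "z \<in> carrier R" unfolding z_def using x(1) e0c uc by simp
  have ze0: "z \<otimes> e0 = u"
  proof -
    have "z \<otimes> e0 = (x \<otimes> e0 \<ominus> x \<otimes> (e0 \<otimes> e0)) \<oplus> u \<otimes> e0" unfolding z_def using x(1) e0c uc(1) by algebra
    then show ?thesis unfolding primD(3)[OF e0] uc(2) using x(1) e0c uc(1) by (simp add: a_minus_def r_neg)
  qed
  have ze: "z \<otimes> e = x \<otimes> e" if e: "e \<in> prim" "e \<noteq> e0" for e
  proof -
    have ec: "e \<in> carrier R" by (rule primD(1)[OF e(1)])
    have "z \<otimes> e = (x \<otimes> e \<ominus> (x \<otimes> e0) \<otimes> e) \<oplus> u \<otimes> e" unfolding z_def using x(1) e0c ec uc(1) by algebra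
    then show ?thesis
      unfolding kill[OF e mult_corner[OF e0 x(1)]] kill[OF e uI] using x(1) ec by (simp add: a_minus_def)
  qed
  have zn: "z \<otimes> e \<noteq> \<zero>" if e: "e \<in> prim" for e
  proof (cases "e = e0")
    case True
    then show ?thesis using ze0 un by simp
  next
    case False
    then show ?thesis using ze[OF e] generator_proj_nonzero[OF x I e kill[OF e]] by simp
  qed
  obtain S where S: "S \<in> C" "z \<in> S" by (rule C_covers[OF zc])
  note Ss = C_subring[OF S(1)]
  have q1: "q - 1 > 0" using q_gt_1 by simp
  \<comment> \<open>This puts the identity into \<open>S\<close>, so that polynomials in
    \<open>z\<close> with a constant term stay in \<open>S\<close>.\<close>
  have "z [^] (q - 1) = \<one>"
    by (rule prim_ext) (use zc zn pow_corner[OF _ zc] primD(1) in simp_all)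
  then have oneS: "\<one> \<in> S" using nonunital_subring_pow[OF Ss S(2) q1] by simp
  have evS: "ev f z \<in> S" for f
    unfolding ev_def
    by (rule peval_in_subring[OF Ss oneS S(2)]) (simp add: iota_def nonunital_subring_add_pow_int[OF Ss oneS])
  define w where "w = ev g z"
  have wc: "w \<in> carrier R" unfolding w_def by (rule ev_closed[OF zc gP])
  \<comment> \<open>Away from \<open>e0\<close> the components of \<open>z\<close> are those of
    \<open>x\<close>, where \<open>g\<close> does not vanish by \<open>neg\<close>; so the support
    of \<open>w\<close> is exactly the complement of \<open>e0\<close>.\<close>
  have "w [^] (q - 1) = \<one> \<ominus> e0"
  proof (rule prim_ext)
    fix e assume e: "e \<in> prim"
    have ec: "e \<in> carrier R" by (rule primD(1)[OF e])
    have r: "(\<one> \<ominus> e0) \<otimes> e = e \<ominus> e0 \<otimes> e" using ec e0c by algebra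
    show "w [^] (q - 1) \<otimes> e = (\<one> \<ominus> e0) \<otimes> e"
    proof (cases "e = e0")
      case True
      have "w \<otimes> e = \<zero>"
        unfolding w_def True using ev_corner[OF e0 zc gP] ze0 u(2) by (simp add: corner_simps)
      then have "w [^] (q - 1) \<otimes> e = \<zero>" using pow_corner[OF e wc] by simp
      moreover have "(\<one> \<ominus> e0) \<otimes> e = \<zero>" using r True primD(3)[OF e0] e0c by simp
      ultimately show ?thesis by simp
    next
      case False
      have "w \<otimes> e = ev g x \<otimes> e"
        unfolding w_def ev_corner[OF e zc gP] ev_corner[OF e x(1) gP] ze[OF e False] by (rule refl)
      moreover have "ev g x \<otimes> e \<noteq> \<zero>" using neg e False by auto
      ultimately have "w \<otimes> e \<noteq> \<zero>" by simp
      moreover have "e0 \<otimes> e = \<zero>" by (rule prim_orthogonal[OF e0 e]) (use False in simp)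
      ultimately show ?thesis unfolding r pow_corner[OF e wc] using ec by (simp add: a_minus_def)
    qed
  qed (use wc e0c in simp_all)
  moreover have "w [^] (q - 1) \<in> S" by (rule nonunital_subring_pow[OF Ss _ q1]) (simp add: w_def evS)
  ultimately have "\<one> \<ominus> (\<one> \<ominus> e0) \<in> S" using nonunital_subring_minus[OF Ss oneS] by simp
  moreover have "\<one> \<ominus> (\<one> \<ominus> e0) = e0" using e0c by algebra
  ultimately have e0S: "e0 \<in> S" by simp
  \<comment> \<open>The root \<open>u\<close> generates the whole field \<open>PIdl e0\<close>,
    whose order is \<open>p\<close> to the degree of \<open>g\<close>; so every \<open>y\<close>
    there is a polynomial in \<open>z\<close> cut down by \<open>e0\<close>.\<close>
  have IS: "PIdl e0 \<subseteq> S"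
  proof
    fix y assume "y \<in> PIdl e0"
    then have "y \<in> (\<lambda>f. peval (corner e0) (corner_iota e0) f u) ` polys"
      using root_range_eq_carrier[OF prime_field(1,3) corner_is_field[OF e0] corner_iota_hom[OF e0] u(1) gm u(2) cardF]
      by (simp add: corner_simps)
    then obtain f where f: "f \<in> polys" "y = peval (corner e0) (corner_iota e0) f u" by (elim imageE) (rule that)
    have "y = ev f z \<otimes> e0" unfolding f(2) ev_corner[OF e0 zc f(1)] ze0 by (rule refl)
    then show "y \<in> S" using nonunital_subringD(4)[OF Ss evS e0S] by simp
  qed
  have "(z \<ominus> u) \<oplus> x \<otimes> e0 \<in> S"
    by (rule nonunital_subringD(3)[OF Ss nonunital_subring_minus[OF Ss S(2) subsetD[OF IS uI]] subsetD[OF IS mult_corner[OF e0 x(1)]]])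
  moreover have "(z \<ominus> u) \<oplus> x \<otimes> e0 = x" unfolding z_def using x(1) e0c uc(1) by algebra
  ultimately have "x \<in> S" by simp
  then have "S = carrier R" by (rule x(2)[OF Ss _ IS])
  then show False using C_proper[OF S(1)] by simp
qed

text \<open>Each eligible \<open>g\<close> kills the component of \<open>x\<close> at some primitive
  idempotent other than \<open>e0\<close>. There it is the minimal polynomial, so \<open>g\<close>
  can be recovered from that idempotent, and its degree gives the order of the factor.\<close>

lemma card_prim_ge:
  assumes e0: "e0 \<in> prim" and card0: "card (PIdl e0) = p ^ d"
  shows "card (eligible_polys p d) \<le> card {e \<in> prim. e \<noteq> e0 \<and> card (PIdl e) = p ^ d}"
proof -
  obtain x where x: "x \<in> carrier R" "\<And>T. nonunital_subring T R \<Longrightarrow> x \<in> T \<Longrightarrow> PIdl e0 \<subseteq> T \<Longrightarrow> T = carrier R"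
    using generator_modulo_ideal[OF corner_ideal[OF e0] corner_nonzero[OF e0]] by metis
  have I: "PIdl e0 \<subseteq> carrier R" by (rule nonunital_subringD(1)[OF corner_subring[OF e0]])
  have kill: "y \<otimes> e = \<zero>" if e: "e \<in> prim" "e \<noteq> e0" and y: "y \<in> PIdl e0" for e y
    by (rule prim_orthogonal_corner[OF e(1) e0 e(2) y])
  have "\<forall>g\<in>eligible_polys p d. \<exists>e. e \<in> prim \<and> e \<noteq> e0 \<and> ev g x \<otimes> e = \<zero>"
    using eligible_poly_kills_corner[OF e0 card0 _ x] by auto
  from bchoice[OF this] obtain h where
    h0: "\<forall>g\<in>eligible_polys p d. h g \<in> prim \<and> h g \<noteq> e0 \<and> ev g x \<otimes> h g = \<zero>" by (elim exE)
  have h: "h g \<in> prim \<and> h g \<noteq> e0 \<and> ev g x \<otimes> h g = \<zero>" if "g \<in> eligible_polys p d" for g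
    by (rule bspec[OF h0 that])
  have m: "mp (h g) x = g" if "g \<in> eligible_polys p d" for g
    by (rule mp_eqI[OF _ x(1)]) (use h[OF that] that in \<open>simp_all add: eligible_polys_def\<close>)
  show ?thesis
  proof (rule card_inj_on_le)
    show "inj_on h (eligible_polys p d)" by (rule inj_on_inverseI[of _ "\<lambda>e. mp e x"]) (rule m)
    show "finite {e \<in> prim. e \<noteq> e0 \<and> card (PIdl e) = p ^ d}" using finite_prim by simp
    show "h ` eligible_polys p d \<subseteq> {e \<in> prim. e \<noteq> e0 \<and> card (PIdl e) = p ^ d}"
    proof
      fix e assume "e \<in> h ` eligible_polys p d"
      then obtain g where g: "g \<in> eligible_polys p d" "e = h g" by (elim imageE) (rule that)
      have e: "e \<in> prim" "e \<noteq> e0" using h[OF g(1)] g(2) by simp_all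
      have "card (PIdl e) = p ^ Polynomials.degree (mp e x)"
        by (rule mp_card[OF e(1) x(1) generator_range[OF x I e(1) kill[OF e]]])
      then show "e \<in> {e \<in> prim. e \<noteq> e0 \<and> card (PIdl e) = p ^ d}"
        using e m[OF g(1)] g by (simp add: eligible_polys_def)
    qed
  qed
qed

text \<open>Let \<open>A\<close> be the factors of the same order as that of \<open>e0\<close>.
  Modulo the factor of \<open>e0\<close> the two bounds show that \<open>card A - 1\<close> is the
  number of eligible polynomials. A factor of another order could be divided out without touching
  \<open>A\<close>, and \<open>card_prim_le\<close> would bound \<open>card A\<close> itself by that
  number.\<close>

lemma prim_uniform:
  obtains d where "d > 0" "\<And>e. e \<in> prim \<Longrightarrow> card (PIdl e) = p ^ d" "card prim = tau (p ^ d)" "prim \<noteq> {}"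
proof -
  obtain e0 where e0: "e0 \<in> prim"
    using prim_below[OF one_closed nontrivial] by auto
  \<comment> \<open>Both fields are \<open>corner e0\<close>: only the formula for the order is
    wanted.\<close>
  obtain d where d: "card (carrier (corner e0)) = card (carrier prime_field) ^ d"
    using finite_fields_iso(2)[OF prime_field(1,3) corner_is_field[OF e0] corner_iota_hom[OF e0]
      corner_is_field[OF e0] corner_iota_hom[OF e0] refl] by (elim exE) (rule that)
  then have cd: "card (PIdl e0) = p ^ d" using prime_field(4) by (simp add: corner_simps)
  have d0: "d > 0"
  proof (rule ccontr)
    assume "\<not> d > 0"
    then have "card (PIdl e0) = 1" using cd by simp
    then obtain y where y: "PIdl e0 = {y}" by (rule card_1_singletonE)
    then have "e0 = \<zero>" using prim_self[OF e0] nonunital_subringD(2)[OF corner_subring[OF e0]] by simp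
    then show False using primD(2)[OF e0] by simp
  qed
  define A where "A = {e \<in> prim. card (PIdl e) = p ^ d}"
  have A: "finite A" "e0 \<in> A" using finite_prim e0 cd by (simp_all add: A_def)
  have "card (A - {e0}) \<le> card (eligible_polys p d)"
  proof (rule card_prim_le[OF corner_ideal[OF e0] corner_nonzero[OF e0]])
    show "A - {e0} \<subseteq> prim" by (auto simp: A_def)
    show "y \<otimes> e = \<zero>" if "e \<in> A - {e0}" "y \<in> PIdl e0" for e y
      by (rule prim_orthogonal_corner[OF _ e0 _ that(2)]) (use that(1) in \<open>simp_all add: A_def\<close>)
  qed (simp add: A_def)
  moreover have "{e \<in> prim. e \<noteq> e0 \<and> card (PIdl e) = p ^ d} = A - {e0}" by (auto simp: A_def)
  then have "card (eligible_polys p d) \<le> card (A - {e0})" using card_prim_ge[OF e0 cd] by simp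
  ultimately have "card A = card (eligible_polys p d) + 1"
    using A card_Suc_Diff1[OF A] by simp
  then have cA: "card A = tau (p ^ d)" using tau_eq[OF p_prime d0] by simp
  have "A = prim"
  proof (rule ccontr)
    assume "A \<noteq> prim"
    then obtain f where f: "f \<in> prim" "f \<notin> A" by (auto simp: A_def)
    have "card A \<le> card (eligible_polys p d)"
    proof (rule card_prim_le[OF corner_ideal[OF f(1)] corner_nonzero[OF f(1)]])
      show "A \<subseteq> prim" by (auto simp: A_def)
      show "y \<otimes> e = \<zero>" if "e \<in> A" "y \<in> PIdl f" for e y
        by (rule prim_orthogonal_corner[OF _ f(1) _ that(2)]) (use that(1) f(2) in \<open>auto simp: A_def\<close>)
    qed (simp add: A_def)
    then show False using \<open>card A = card (eligible_polys p d) + 1\<close> by simp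
  qed
  then have "\<And>e. e \<in> prim \<Longrightarrow> card (PIdl e) = p ^ d" "card prim = tau (p ^ d)" "prim \<noteq> {}"
    using cA e0 by (auto simp: A_def)
  then show thesis using that d0 by simp
qed

end

section \<open>The classification\<close>

lemma map_ring_hom_RDirProd_list:
  assumes "\<And>e. e \<in> set es \<Longrightarrow> \<phi> e \<in> Ring.ring_hom R F"
  shows "(\<lambda>x. map (\<lambda>e. \<phi> e x) es) \<in> Ring.ring_hom R (RDirProd_list (replicate (length es) F))"
  using assms
proof (induction es)
  case Nil
  then show ?case by (simp add: Ring.ring_hom_def monoid.defs)
next
  case (Cons e es)
  then have h: "\<phi> e \<in> Ring.ring_hom R F"
    and IH: "(\<lambda>x. map (\<lambda>e. \<phi> e x) es) \<in> Ring.ring_hom R (RDirProd_list (replicate (length es) F))" by simp_all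
  have "(\<lambda>x. (\<phi> e x, map (\<lambda>e. \<phi> e x) es)) \<in> Ring.ring_hom R (RDirProd F (RDirProd_list (replicate (length es) F)))"
    using h IH by (auto simp: Ring.ring_hom_def RDirProd_def DirProd_def monoid.defs)
  from ring_hom_trans[OF this RDirProd_list_hom1]
  show ?case by (simp add: comp_def)
qed

theorem (in reduced_frobenius_ring) field_power:
  "\<exists>F :: nat ring. field F \<and> finite (carrier F) \<and> R \<simeq> RDirProd_list (replicate (tau (card (carrier F))) F)"
proof -
  obtain d where d: "d > 0" "\<And>e. e \<in> prim \<Longrightarrow> card (PIdl e) = p ^ d" "card prim = tau (p ^ d)" "prim \<noteq> {}"
    by (rule prim_uniform) (rule that)
  obtain e0 where e0: "e0 \<in> prim" using d(4) by auto
  obtain F :: "nat ring" where F: "field F" "finite (carrier F)" "corner e0 \<simeq> F"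
    by (rule field_nat_copy[OF corner_is_field[OF e0]])
  interpret F: field F by fact
  have cardF: "card (carrier F) = p ^ d"
    using ring_iso_same_card[OF F(3)] d(2)[OF e0] by (simp add: corner_simps)
  \<comment> \<open>All factors have the order of \<open>F\<close> and are extensions of the same
    prime field, so each is a copy of \<open>F\<close>.\<close>
  have "\<forall>e\<in>prim. \<exists>h. h \<in> ring_iso (corner e) F"
  proof
    fix e assume e: "e \<in> prim"
    have "corner e \<simeq> corner e0"
      by (rule finite_fields_iso(1)[OF prime_field(1,3) corner_is_field[OF e] corner_iota_hom[OF e]
        corner_is_field[OF e0] corner_iota_hom[OF e0]]) (simp add: corner_simps d(2) e e0)
    from ring_iso_trans[OF this F(3)] show "\<exists>h. h \<in> ring_iso (corner e) F"
      by (auto simp: is_ring_iso_def)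
  qed
  from bchoice[OF this] obtain h where h0: "\<forall>e\<in>prim. h e \<in> ring_iso (corner e) F" by (elim exE)
  have h: "h e \<in> ring_iso (corner e) F" if "e \<in> prim" for e by (rule bspec[OF h0 that])
  obtain es where es: "set es = prim" "distinct es" using finite_distinct_list[OF finite_prim] by (elim exE conjE) (rule that)
  define n where "n = length es"
  have n: "n = tau (card (carrier F))" using distinct_card[OF es(2)] es(1) d(3) cardF by (simp add: n_def)
  define \<Psi> where "\<Psi> x = map (\<lambda>e. h e (x \<otimes> e)) es" for x
  have ese: "es ! i \<in> prim" if "i < n" for i using that es(1) nth_mem[of i es] by (simp add: n_def)
  have hom: "\<Psi> \<in> Ring.ring_hom R (RDirProd_list (replicate n F))"
    unfolding \<Psi>_def[abs_def] n_def
  proof (rule map_ring_hom_RDirProd_list)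
    fix e assume "e \<in> set es"
    then have e: "e \<in> prim" using es(1) by simp
    have "h e \<in> Ring.ring_hom (corner e) F" using h[OF e] by (simp add: ring_iso_def)
    from ring_hom_trans[OF ring_hom_ring.homh[OF corner_proj[OF e]] this]
    show "(\<lambda>x. h e (x \<otimes> e)) \<in> Ring.ring_hom R F" by (simp add: comp_def)
  qed
  have bij: "bij_betw \<Psi> (carrier R) (carrier (RDirProd_list (replicate n F)))"
    unfolding bij_betw_def
  proof (intro conjI equalityI subsetI)
    show "inj_on \<Psi> (carrier R)"
    proof (rule inj_onI)
      fix x y assume xy: "x \<in> carrier R" "y \<in> carrier R" "\<Psi> x = \<Psi> y"
      show "x = y"
      proof (rule prim_ext[OF xy(1,2)])
        fix e assume e: "e \<in> prim"
        then have "h e (x \<otimes> e) = h e (y \<otimes> e)" using xy(3) es(1) by (simp add: \<Psi>_def)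
        then show "x \<otimes> e = y \<otimes> e"
          using bij_betw_imp_inj_on[OF ring_iso_memE(5)[OF h[OF e]]] proj_carrier[OF e xy(1)] proj_carrier[OF e xy(2)]
          by (simp add: inj_on_def)
      qed
    qed
  next
    fix l assume "l \<in> \<Psi> ` carrier R"
    then show "l \<in> carrier (RDirProd_list (replicate n F))" by (elim imageE) (simp add: ring_hom_closed[OF hom])
  next
    fix l assume l: "l \<in> carrier (RDirProd_list (replicate n F))"
    have len: "length l = n" using RDirProd_list_carrier_mem(1)[OF l] by simp
    have li: "l ! i \<in> carrier F" if "i < n" for i using RDirProd_list_carrier_mem(2)[OF l, of i] that by simp
    \<comment> \<open>\<open>THE\<close> recovers the position of \<open>e\<close> in the list
      \<open>es\<close>, whose entries are distinct; \<open>y e\<close> is the preimage, in the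
      factor of \<open>e\<close>, of the entry of \<open>l\<close> at that position.\<close>
    define y where "y e = inv_into (PIdl e) (h e) (l ! (THE i. i < n \<and> es ! i = e))" for e
    have idx: "(THE i. i < n \<and> es ! i = es ! j) = j" if "j < n" for j
      using that es(2) by (intro the_equality) (auto simp: n_def nth_eq_iff_index_eq)
    have yj: "y (es ! j) \<in> PIdl (es ! j)" "h (es ! j) (y (es ! j)) = l ! j" if j: "j < n" for j
    proof -
      have "h (es ! j) ` (PIdl (es ! j)) = carrier F"
        using bij_betw_imp_surj_on[OF ring_iso_memE(5)[OF h[OF ese[OF j]]]] by (simp add: corner_simps)
      then show "y (es ! j) \<in> PIdl (es ! j)" "h (es ! j) (y (es ! j)) = l ! j"
        unfolding y_def idx[OF j] using li[OF j] by (simp_all add: inv_into_into f_inv_into_f)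
    qed
    have yP: "y e \<in> PIdl e" if e: "e \<in> prim" for e
    proof -
      have "e \<in> set es" using e es(1) by simp
      then have "\<exists>j<n. es ! j = e" by (simp add: in_set_conv_nth n_def)
      then obtain j where j: "j < n" "es ! j = e" by (elim exE conjE) (rule that)
      show ?thesis using yj(1)[OF j(1)] j(2) by simp
    qed
    define x where "x = (\<Oplus>e\<in>prim. y e)"
    have yc: "y e \<in> carrier R" if "e \<in> prim" for e using yP[OF that] corner_iff[OF that] by simp
    have xc: "x \<in> carrier R" unfolding x_def using yc by (intro finsum_closed) simp
    have "\<Psi> x = l"
    proof (rule nth_equalityI)
      show "length (\<Psi> x) = length l" using len by (simp add: \<Psi>_def n_def)
      fix j assume "j < length (\<Psi> x)"
      then have j: "j < n" by (simp add: \<Psi>_def n_def)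
      have "x \<otimes> es ! j = y (es ! j)" unfolding x_def by (rule corner_sum[OF yP ese[OF j]])
      then show "\<Psi> x ! j = l ! j" using j yj(2)[OF j] by (simp add: \<Psi>_def n_def)
    qed
    from this[symmetric] xc show "l \<in> \<Psi> ` carrier R" by (rule image_eqI)
  qed
  have "\<Psi> \<in> ring_iso R (RDirProd_list (replicate n F))" using hom bij by (simp add: ring_iso_def)
  then have "R \<simeq> RDirProd_list (replicate (tau (card (carrier F))) F)" unfolding n by (rule is_ring_isoI)
  then show ?thesis using F(1,2) by (intro exI[of _ F]) simp
qed

section \<open>Nilradical and Jacobson radical\<close>

lemma (in frobenius_ring) nil_subset_jacobson_radical: "nil \<subseteq> jacobson_radical R"
proof
  fix x assume x: "x \<in> nil"
  have xc: "x \<in> carrier R" by (rule nilD(1)[OF x])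
  have "x \<in> M" if M: "maximalideal M R" for M
  proof -
    have P: "primeideal M R" by (rule maximalideal_prime[OF M])
    have MI: "ideal M R" by (rule primeideal.axioms(1)[OF P])
    have "x [^] n \<in> M \<Longrightarrow> x \<in> M" for n :: nat
    proof (induction n)
      case 0
      then show ?case using ideal.I_r_closed[OF MI, of \<one> x] xc by simp
    next
      case (Suc n)
      then show ?case using primeideal.I_prime[OF P, of "x [^] n" x] xc by auto
    qed
    moreover have "x [^] q \<in> M" using nilD(2)[OF x] additive_subgroup.zero_closed[OF ideal.axioms(1)[OF MI]] by simp
    ultimately show ?thesis by simp
  qed
  then show "x \<in> jacobson_radical R" using xc by (simp add: jacobson_radical_def)
qed

lemma (in frobenius_ring) maximalideal_exists:
  assumes I: "ideal I R" "I \<noteq> carrier R"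
  shows "\<exists>M. maximalideal M R \<and> I \<subseteq> M"
proof -
  define P where "P = {J. ideal J R \<and> J \<noteq> carrier R \<and> I \<subseteq> J}"
  have "P \<subseteq> Pow (carrier R)"
    using nonunital_subringD(1)[OF ideal_nonunital_subring] by (auto simp: P_def)
  then have "finite P" using finite_carrier by (meson finite_Pow_iff finite_subset)
  moreover have "I \<in> P" using I by (simp add: P_def)
  ultimately obtain M where M: "M \<in> P" "I \<subseteq> M" "\<And>J. J \<in> P \<Longrightarrow> M \<subseteq> J \<Longrightarrow> J = M"
    using finite_has_maximal2 by metis
  have "maximalideal M R"
  proof (rule maximalidealI)
    show "ideal M R" "carrier R \<noteq> M" using M(1) by (auto simp: P_def)
    fix J assume J: "ideal J R" "M \<subseteq> J" "J \<subseteq> carrier R"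
    then show "J = M \<or> J = carrier R" using M(2) M(3)[of J] by (auto simp: P_def)
  qed
  then show ?thesis using M(2) by blast
qed

text \<open>If the annihilator \<open>N\<close> of \<open>x\<close> were proper, a maximal ideal
  over it would contain the support \<open>f\<close> of \<open>x\<close>, because it contains
  \<open>x\<close>, and also \<open>\<one> \<ominus> f\<close>, which annihilates \<open>x\<close>;
  so it would contain the identity.\<close>

lemma (in reduced_frobenius_ring) jacobson_radical_zero: "jacobson_radical R = {\<zero>}"
proof (intro equalityI subsetI)
  fix x assume x: "x \<in> jacobson_radical R"
  then have xc: "x \<in> carrier R" and xM: "\<And>M. maximalideal M R \<Longrightarrow> x \<in> M" by (simp_all add: jacobson_radical_def)
  define N where "N = {r \<in> carrier R. r \<otimes> x = \<zero>}"
  have N: "ideal N R" by (rule idealI') (auto simp: N_def xc l_distr m_assoc)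
  have "N = carrier R"
  proof (rule ccontr)
    assume NR: "N \<noteq> carrier R"
    obtain M where M: "maximalideal M R" "N \<subseteq> M"
      using maximalideal_exists[OF N NR] by (elim exE conjE) (rule that)
    have MI: "ideal M R" by (rule maximalideal.axioms(1)[OF M(1)])
    define f where "f = x [^] (q - 1)"
    have fc: "f \<in> carrier R" using xc by (simp add: f_def)
    have fM: "f \<in> M" unfolding f_def pow_pred[OF xc]
      by (rule ideal.I_l_closed[OF MI xM[OF M(1)]]) (use xc in simp)
    have "(\<one> \<ominus> f) \<otimes> x = x \<ominus> x \<otimes> f" using xc fc by algebra
    then have "\<one> \<ominus> f \<in> M" using M(2) xc fc idempotent(1)[OF xc] by (auto simp: N_def f_def)
    then have "(\<one> \<ominus> f) \<oplus> f \<in> M" using fM additive_subgroup.a_closed[OF ideal.axioms(1)[OF MI]] by simp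
    moreover have "(\<one> \<ominus> f) \<oplus> f = \<one>" using fc by algebra
    ultimately have "M = carrier R" using ideal.one_imp_carrier[OF MI] by simp
    then show False using maximalideal.I_notcarr[OF M(1)] by simp
  qed
  then have "\<one> \<otimes> x = \<zero>" by (auto simp: N_def)
  then show "x \<in> {\<zero>}" using xc by simp
next
  fix x assume "x \<in> {\<zero>}"
  then show "x \<in> jacobson_radical R" using nil_subset_jacobson_radical nil_zero by auto
qed

text \<open>Distinguishing cases by \<open>nil\<close> agrees with distinguishing them by the
  Jacobson radical: \<open>nil\<close> always lies inside the radical, and if \<open>nil\<close> is
  zero, so is the radical.\<close>

theorem (in frobenius_ring) classification:
  "(jacobson_radical R = {\<zero>} \<longrightarrow>
      (\<exists>F :: nat ring. field F \<and> finite (carrier F) \<and>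
         R \<simeq> RDirProd_list (replicate (tau (card (carrier F))) F))) \<and>
   (jacobson_radical R \<noteq> {\<zero>} \<longrightarrow>
      (\<exists>F :: nat ring. field F \<and> finite (carrier F) \<and> R \<simeq> local_matrix_ring F))"
proof (cases "nil = {\<zero>}")
  case True
  then interpret reduced_frobenius_ring R C p q k by unfold_locales
  show ?thesis using jacobson_radical_zero field_power by simp
next
  case False
  have "jacobson_radical R \<noteq> {\<zero>}"
    using False nil_subset_jacobson_radical nil_closed(1) by auto
  then show ?thesis using nil_nonzero_imp_local_matrix_ring[OF False] by simp
qed

theorem theorem4p8:
  fixes R :: "('a, 'm) ring_scheme"
  assumes "cring R"
    and "sigma_elementary R"
    and "finite_covering_number R"
  shows "(jacobson_radical R = {\<zero>\<^bsub>R\<^esub>} \<longrightarrow>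
            (\<exists>F :: nat ring. field F \<and> finite (carrier F) \<and>
               R \<simeq> RDirProd_list (replicate (tau (card (carrier F))) F)))
       \<and> (jacobson_radical R \<noteq> {\<zero>\<^bsub>R\<^esub>} \<longrightarrow>
            (\<exists>F :: nat ring. field F \<and> finite (carrier F) \<and>
               R \<simeq> local_matrix_ring F))"
proof -
  obtain C where "finite_elementary_ring R C"
    using cring.sigma_elementary_imp_finite_elementary_ring[OF assms] by (elim exE)
  then obtain p q k where "frobenius_ring R C p q k"
    using finite_elementary_ring.frobenius_ring_exists[of R C] by (elim meta_impE exE) assumption+
  then show ?thesis by (rule frobenius_ring.classification)
qed

end
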